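(* Let $R$ be a commutative ring with unit and let $S=K\setminus L$ be a finite relative simplicial complex equipped with a Morse shelling, that is, a Morse tiling together with a filtration $\emptyset=S_0\subset S_1\subset\dots\subset S_N=S$ by closed subsets of $S$ such that each $S_p\setminus S_{p-1}$ is a single tile. Then the shelling induces two spectral sequences (those of the filtrations of the simplicial chain and cochain complexes defined in the context) which converge to the relative homology $H_*(K,L;R)$ and to the relative cohomology $H^*(K,L;R)$ respectively, and whose first pages are free graded $R$-modules over the critical tiles of the shelling (that is, free with a basis in bijection with the critical tiles).
   Context: Simplices are closed; an open simplex is the relative interior of a simplex. A finite relative simplicial complex is a complement $S=K\setminus L$, where $L$ is a (possibly empty) subcomplex of a finite simplicial complex $K$; it is regarded as the union of the open simplices of $K$ that are not in $L$, with the topology induced from $K$. Morse tiles: a Morse tile $T$ of dimension $n\ge 0$ and order $k\in\{0,\dots,n+1\}$ is an $n$-simplex $\overline T$ (its underlying simplex) from which one removes $k$ of its (closed) codimension one faces together with one possibly empty (closed) face $\mu$ of codimension greater than one, called its Morse face; when $\mu$ is non-empty it is understood not to be contained in the removed codimension one faces. The tile is critical of index $k$ iff $\dim\mu=k-1$ (with $\dim\emptyset=-1$); moreover the open $n$-simplex (all codimension one faces removed) is critical of index $n$. In particular a closed simplex is critical of index $0$. Non-critical tiles are called regular. Morse tiling: a partition of $S$ by Morse tiles (each tile $T\subset S$ having underlying simplex $\overline T\in K$) such that for every $j\ge 0$ the union of the tiles of dimension greater than $j$ is closed in $S$. Induced spectral sequences: identify the relative simplicial chain complex $C_*(K,L;R)$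 with the free module on the (oriented) simplices of $S$. Since $S_p$ is closed in $S$, the simplices of $S$ contained in $S_p$ span a subcomplex $F_p\subset C_*(K,L;R)$, and $0=F_0\subset F_1\subset\dots\subset F_N=C_*(K,L;R)$; the homology spectral sequence is the one of this filtration, with $E^0_{p,d-p}=(F_p/F_{p-1})_d$. Dually, let $F^p\subset C^*(K,L;R)$ be the subcomplex of cochains vanishing on all simplices of $S_p$, so that $0=F^N\subset\dots\subset F^0=C^*(K,L;R)$; the cohomology spectral sequence is the one of this filtration, with $E_0^{p,d-p}=(F^p/F^{p+1})^d$. *)

theory Defs
  imports "HOL-Analysis.Analysis" "HOL-Algebra.AbelCoset" "HOL-Algebra.Module"
begin

section \<open>Relative simplicial complexes and Morse shellings\<close>

text \<open>
  Simplicial complexes are the geometric ones of \<^theory>\<open>HOL-Analysis.Polytope\<close>; since these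
  are closed under faces, a nonempty complex contains the empty simplex, which is discarded here.
\<close>

definition rel_simplices :: "'a::euclidean_space set set \<Rightarrow> 'a set set \<Rightarrow> 'a set set" where
  "rel_simplices K L = {\<sigma> \<in> K - L. \<sigma> \<noteq> {}}"

definition rel_space :: "'a::euclidean_space set set \<Rightarrow> 'a set set \<Rightarrow> 'a set" where
  "rel_space K L = (\<Union>\<sigma> \<in> rel_simplices K L. rel_interior \<sigma>)"

text \<open>
  In contrast to \<^const>\<open>facet_of\<close>, the empty face counts as a codimension one face of a point,
  so that an \<open>n\<close>-simplex has \<open>n + 1\<close> codimension one faces for every \<open>n \<ge> 0\<close>.
\<close>

definition codim1_faces :: "'a::euclidean_space set \<Rightarrow> 'a set set" where
  "codim1_faces \<Delta> = {F. F face_of \<Delta> \<and> aff_dim F = aff_dim \<Delta> - 1}"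

text \<open>
  \<open>T\<close> is a Morse tile with underlying \<open>n\<close>-simplex \<open>\<Delta>\<close>, removed codimension one faces \<open>\<Phi>\<close>
  (so its order is \<open>card \<Phi>\<close>) and Morse face \<open>\<mu>\<close>.
\<close>

definition morse_tile_data ::
  "'a::euclidean_space set \<Rightarrow> nat \<Rightarrow> 'a set set \<Rightarrow> 'a set \<Rightarrow> 'a set \<Rightarrow> bool" where
  "morse_tile_data \<Delta> n \<Phi> \<mu> T \<longleftrightarrow>
     int n simplex \<Delta> \<and> \<Phi> \<subseteq> codim1_faces \<Delta> \<and>
     (\<mu> = {} \<or> \<mu> face_of \<Delta> \<and> aff_dim \<mu> < int n - 1 \<and> (\<forall>F\<in>\<Phi>. \<not> \<mu> \<subseteq> F)) \<and>
     T = \<Delta> - (\<Union>\<Phi> \<union> \<mu>)"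

definition morse_tile :: "'a::euclidean_space set set \<Rightarrow> nat \<Rightarrow> 'a set \<Rightarrow> bool" where
  "morse_tile K n T \<longleftrightarrow> (\<exists>\<Delta>\<in>K. \<exists>\<Phi> \<mu>. morse_tile_data \<Delta> n \<Phi> \<mu> T)"

definition critical_tile :: "'a::euclidean_space set set \<Rightarrow> int \<Rightarrow> 'a set \<Rightarrow> bool" where
  "critical_tile K k T \<longleftrightarrow>
     (\<exists>\<Delta>\<in>K. \<exists>n \<Phi> \<mu>. morse_tile_data \<Delta> n \<Phi> \<mu> T \<and>
        (k = int (card \<Phi>) \<and> aff_dim \<mu> = k - 1 \<or> \<Phi> = codim1_faces \<Delta> \<and> k = int n))"

definition morse_tiling ::
  "'a::euclidean_space set set \<Rightarrow> 'a set set \<Rightarrow> 'a set set \<Rightarrow> bool" where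
  "morse_tiling K L \<T> \<longleftrightarrow>
     partition_on (rel_space K L) \<T> \<and> (\<forall>T\<in>\<T>. \<exists>n. morse_tile K n T) \<and>
     (\<forall>j. closedin (top_of_set (rel_space K L)) (\<Union>{T \<in> \<T>. \<exists>n>j. morse_tile K n T}))"

definition morse_shelling ::
  "'a::euclidean_space set set \<Rightarrow> 'a set set \<Rightarrow> 'a set set \<Rightarrow> nat \<Rightarrow> (nat \<Rightarrow> 'a set) \<Rightarrow> bool" where
  "morse_shelling K L \<T> N S \<longleftrightarrow>
     morse_tiling K L \<T> \<and> S 0 = {} \<and> S N = rel_space K L \<and>
     (\<forall>p\<le>N. closedin (top_of_set (rel_space K L)) (S p)) \<and>
     (\<forall>p<N. S p \<subseteq> S (Suc p) \<and> S (Suc p) - S p \<in> \<T>)"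

text \<open>
  The \<open>p\<close>-th tile (\<open>1 \<le> p \<le> N\<close>) if it is critical of index \<open>k\<close>, nothing otherwise. When \<open>p\<close> and
  \<open>k\<close> vary, these sets partition the set of all critical tiles of the shelling.
\<close>

definition critical_tiles_at ::
  "'a::euclidean_space set set \<Rightarrow> 'a set set \<Rightarrow> nat \<Rightarrow> (nat \<Rightarrow> 'a set) \<Rightarrow> int \<Rightarrow> int \<Rightarrow> 'a set set" where
  "critical_tiles_at K \<T> N S p k =
     {T \<in> \<T>. critical_tile K k T \<and> (\<exists>i<N. p = int (Suc i) \<and> T = S (Suc i) - S i)}"


section \<open>Modules\<close>

text \<open>
  The sort is that of all commutative rings with unit; \<^class>\<open>comm_ring_1\<close> would exclude the
  zero ring. The fields \<^const>\<open>mult\<close> and \<^const>\<open>one\<close> of a module record play no role.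
\<close>

definition type_ring :: "'r::{comm_ring,monoid_mult} ring" where
  "type_ring = \<lparr>carrier = UNIV, mult = (*), one = 1, zero = 0, add = (+)\<rparr>"

definition function_module :: "'s set \<Rightarrow> ('r::{comm_ring,monoid_mult}, 's \<Rightarrow> 'r) module" where
  "function_module A =
     \<lparr>carrier = {c. \<forall>x. x \<notin> A \<longrightarrow> c x = 0}, mult = undefined, one = undefined,
      zero = (\<lambda>x. 0), add = (\<lambda>c c' x. c x + c' x), smult = (\<lambda>a c x. a * c x)\<rparr>"

definition quotient_module :: "('r, 'm) module \<Rightarrow> 'm set \<Rightarrow> ('r, 'm set) module" where
  "quotient_module M B =
     \<lparr>carrier = a_rcosets\<^bsub>M\<^esub> B, mult = undefined, one = undefined,
      zero = B, add = set_add M, smult = (\<lambda>a X. \<Union>x\<in>X. B +>\<^bsub>M\<^esub> (a \<odot>\<^bsub>M\<^esub> x))\<rparr>"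

definition module_hom_set :: "'r ring \<Rightarrow> ('r, 'm) module \<Rightarrow> ('r, 'n) module \<Rightarrow> ('m \<Rightarrow> 'n) set" where
  "module_hom_set R M N =
     {h \<in> carrier M \<rightarrow> carrier N.
        (\<forall>x\<in>carrier M. \<forall>y\<in>carrier M. h (x \<oplus>\<^bsub>M\<^esub> y) = h x \<oplus>\<^bsub>N\<^esub> h y) \<and>
        (\<forall>a\<in>carrier R. \<forall>x\<in>carrier M. h (a \<odot>\<^bsub>M\<^esub> x) = a \<odot>\<^bsub>N\<^esub> h x)}"

definition module_iso :: "'r ring \<Rightarrow> ('r, 'm) module \<Rightarrow> ('r, 'n) module \<Rightarrow> bool" where
  "module_iso R M N \<longleftrightarrow> (\<exists>h \<in> module_hom_set R M N. bij_betw h (carrier M) (carrier N))"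

definition free_on :: "'r ring \<Rightarrow> ('r, 'm) module \<Rightarrow> 'i set \<Rightarrow> bool" where
  "free_on R M I \<longleftrightarrow>
     finite I \<and>
     (\<exists>b \<in> I \<rightarrow> carrier M. \<forall>x\<in>carrier M.
        \<exists>!a. a \<in> I \<rightarrow>\<^sub>E carrier R \<and> x = finsum M (\<lambda>i. a i \<odot>\<^bsub>M\<^esub> b i) I)"


section \<open>Spectral sequences\<close>

text \<open>
  Homological and cohomological conventions are treated together: \<open>e = 1\<close> is homological (the
  differential \<open>D\<close> lowers the degree by 1, filtrations increase) and \<open>e = -1\<close> is cohomological
  (\<open>D\<close> raises the degree by 1, filtrations decrease). Pages are indexed so that
  \<open>E r p q\<close> is \<open>E\<^sup>r\<^bsub>p,q\<^esub>\<close> in the first case and \<open>E\<^sub>r\<^bsup>p,q\<^esup>\<close> in the second.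
\<close>

definition complex_homology ::
  "int \<Rightarrow> (int \<Rightarrow> ('r, 'm) module) \<Rightarrow> ('m \<Rightarrow> 'm) \<Rightarrow> int \<Rightarrow> ('r, 'm set) module" where
  "complex_homology e C D n =
     quotient_module ((C n)\<lparr>carrier := a_kernel (C n) (C (n - e)) D\<rparr>) (D ` carrier (C (n + e)))"

text \<open>The image of the homology of \<open>F p\<close> in the homology of \<open>C\<close>.\<close>

definition homology_filtration ::
  "int \<Rightarrow> (int \<Rightarrow> ('r, 'm) module) \<Rightarrow> ('m \<Rightarrow> 'm) \<Rightarrow> (int \<Rightarrow> int \<Rightarrow> 'm set) \<Rightarrow> int \<Rightarrow> int \<Rightarrow> 'm set set" where
  "homology_filtration e C D F p n =
     (\<lambda>c. (D ` carrier (C (n + e))) +>\<^bsub>C n\<^esub> c) ` (F p n \<inter> a_kernel (C n) (C (n - e)) D)"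

text \<open>
  The spectral sequence of a filtered complex, \<open>F p n\<close> being the degree \<open>n\<close> part of the \<open>p\<close>-th
  step of the filtration. For \<open>r = 0\<close>, where \<open>r - 1 = -1\<close>, the quotient is \<open>F p n / F (p - e) n\<close>.
\<close>

definition ss_cycles ::
  "int \<Rightarrow> ('m \<Rightarrow> 'm) \<Rightarrow> (int \<Rightarrow> int \<Rightarrow> 'm set) \<Rightarrow> int \<Rightarrow> int \<Rightarrow> int \<Rightarrow> 'm set" where
  "ss_cycles e D F r p n = {c \<in> F p n. D c \<in> F (p - e * r) (n - e)}"

definition ss_boundaries ::
  "int \<Rightarrow> (int \<Rightarrow> ('r, 'm) module) \<Rightarrow> ('m \<Rightarrow> 'm) \<Rightarrow> (int \<Rightarrow> int \<Rightarrow> 'm set) \<Rightarrow>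
   int \<Rightarrow> int \<Rightarrow> int \<Rightarrow> 'm set" where
  "ss_boundaries e C D F r p n =
     ss_cycles e D F (r - 1) (p - e) n <+>\<^bsub>C n\<^esub>
     D ` ss_cycles e D F (r - 1) (p + e * (r - 1)) (n + e)"

definition ss_page ::
  "int \<Rightarrow> (int \<Rightarrow> ('r, 'm) module) \<Rightarrow> ('m \<Rightarrow> 'm) \<Rightarrow> (int \<Rightarrow> int \<Rightarrow> 'm set) \<Rightarrow>
   nat \<Rightarrow> int \<Rightarrow> int \<Rightarrow> ('r, 'm set) module" where
  "ss_page e C D F r p q =
     quotient_module ((C (p + q))\<lparr>carrier := ss_cycles e D F (int r) p (p + q)\<rparr>)
       (ss_boundaries e C D F (int r) p (p + q))"

definition ss_diff ::
  "int \<Rightarrow> (int \<Rightarrow> ('r, 'm) module) \<Rightarrow> ('m \<Rightarrow> 'm) \<Rightarrow> (int \<Rightarrow> int \<Rightarrow> 'm set) \<Rightarrow>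
   nat \<Rightarrow> int \<Rightarrow> int \<Rightarrow> 'm set \<Rightarrow> 'm set" where
  "ss_diff e C D F r p q X =
     (\<Union>x\<in>X. ss_boundaries e C D F (int r) (p - e * int r) (p + q - e) +>\<^bsub>C (p + q - e)\<^esub> D x)"

definition spectral_sequence ::
  "'r ring \<Rightarrow> int \<Rightarrow> (nat \<Rightarrow> int \<Rightarrow> int \<Rightarrow> ('r, 'm) module) \<Rightarrow>
   (nat \<Rightarrow> int \<Rightarrow> int \<Rightarrow> 'm \<Rightarrow> 'm) \<Rightarrow> bool" where
  "spectral_sequence R e E d \<longleftrightarrow>
     (\<forall>r p q.
        let s = e * int r; t = e * (int r - 1) in
        Module.module R (E r p q) \<and>
        d r p q \<in> module_hom_set R (E r p q) (E r (p - s) (q + t)) \<and>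
        (\<forall>x\<in>carrier (E r p q).
           d r (p - s) (q + t) (d r p q x) = \<zero>\<^bsub>E r (p - 2 * s) (q + 2 * t)\<^esub>) \<and>
        module_iso R (E (Suc r) p q)
          (quotient_module
            ((E r p q)\<lparr>carrier := a_kernel (E r p q) (E r (p - s) (q + t)) (d r p q)\<rparr>)
            (d r (p + s) (q - t) ` carrier (E r (p + s) (q - t)))))"

text \<open>Bounded convergence of \<open>E\<close> to the graded module \<open>H\<close> endowed with the filtration \<open>\<Psi>\<close>.\<close>

definition ss_converges ::
  "'r ring \<Rightarrow> int \<Rightarrow> (nat \<Rightarrow> int \<Rightarrow> int \<Rightarrow> ('r, 'm) module) \<Rightarrow>
   (int \<Rightarrow> ('r, 'n) module) \<Rightarrow> (int \<Rightarrow> int \<Rightarrow> 'n set) \<Rightarrow> bool" where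
  "ss_converges R e E H \<Psi> \<longleftrightarrow>
     (\<forall>n. Module.module R (H n)) \<and>
     (\<forall>p n. submodule (\<Psi> p n) R (H n) \<and> \<Psi> (p - e) n \<subseteq> \<Psi> p n) \<and>
     (\<forall>n. \<exists>l u. \<forall>p. (e * p \<le> l \<longrightarrow> \<Psi> p n = {\<zero>\<^bsub>H n\<^esub>}) \<and> (e * p \<ge> u \<longrightarrow> \<Psi> p n = carrier (H n))) \<and>
     (\<forall>p q. \<exists>r0. \<forall>r\<ge>r0. module_iso R (E r p q)
        (quotient_module ((H (p + q))\<lparr>carrier := \<Psi> p (p + q)\<rparr>) (\<Psi> (p - e) (p + q))))"


section \<open>Simplicial chains and cochains\<close>

text \<open>
  Simplices are oriented by a total order of the vertices, given by an injection \<open>ord\<close> of the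
  vertices into the naturals: the face of \<open>[v\<^sub>0, \<dots>, v\<^sub>n]\<close> opposite to \<open>v\<^sub>i\<close> has incidence number
  \<open>(-1)\<^sup>i\<close>. Note that \<^const>\<open>facet_of\<close> excludes the empty face, so vertices have zero boundary.
\<close>

definition incidence ::
  "('a::euclidean_space \<Rightarrow> nat) \<Rightarrow> 'a set \<Rightarrow> 'a set \<Rightarrow> 'r::{comm_ring,monoid_mult}" where
  "incidence ord \<sigma> \<tau> =
     (if \<tau> facet_of \<sigma>
      then let v = (THE v. v extreme_point_of \<sigma> \<and> v \<notin> \<tau>)
           in (- 1) ^ card {w. w extreme_point_of \<sigma> \<and> ord w < ord v}
      else 0)"

text \<open>
  As all complexes are finite, both the chains and the cochains of degree \<open>n\<close> are the functions on
  the set of \<open>n\<close>-simplices of \<open>K - L\<close>, a simplex \<open>\<sigma>\<close> being identified, as a chain, with the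
  indicator function of \<open>\<sigma>\<close>.
\<close>

definition chain_module ::
  "'a::euclidean_space set set \<Rightarrow> 'a set set \<Rightarrow> int \<Rightarrow>
   ('r::{comm_ring,monoid_mult}, 'a set \<Rightarrow> 'r) module" where
  "chain_module K L n = function_module {\<sigma> \<in> rel_simplices K L. aff_dim \<sigma> = n}"

definition boundary ::
  "('a::euclidean_space \<Rightarrow> nat) \<Rightarrow> 'a set set \<Rightarrow> 'a set set \<Rightarrow>
   ('a set \<Rightarrow> 'r::{comm_ring,monoid_mult}) \<Rightarrow> 'a set \<Rightarrow> 'r" where
  "boundary ord K L c \<tau> =
     (if \<tau> \<in> rel_simplices K L then \<Sum>\<sigma>\<in>rel_simplices K L. incidence ord \<sigma> \<tau> * c \<sigma> else 0)"

definition coboundary ::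
  "('a::euclidean_space \<Rightarrow> nat) \<Rightarrow> 'a set set \<Rightarrow> 'a set set \<Rightarrow>
   ('a set \<Rightarrow> 'r::{comm_ring,monoid_mult}) \<Rightarrow> 'a set \<Rightarrow> 'r" where
  "coboundary ord K L f \<sigma> =
     (if \<sigma> \<in> rel_simplices K L then \<Sum>\<tau>\<in>rel_simplices K L. incidence ord \<sigma> \<tau> * f \<tau> else 0)"

text \<open>
  The filtrations are extended to all integers \<open>p\<close> by \<open>S p = S 0\<close> for \<open>p < 0\<close> and
  \<open>S p = S N\<close> for \<open>p > N\<close>.
\<close>

definition filtration_step :: "nat \<Rightarrow> (nat \<Rightarrow> 'a set) \<Rightarrow> int \<Rightarrow> 'a set" where
  "filtration_step N S p = S (min N (nat p))"

definition chain_filtration ::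
  "'a::euclidean_space set set \<Rightarrow> 'a set set \<Rightarrow> nat \<Rightarrow> (nat \<Rightarrow> 'a set) \<Rightarrow> int \<Rightarrow> int \<Rightarrow>
   ('a set \<Rightarrow> 'r::{comm_ring,monoid_mult}) set" where
  "chain_filtration K L N S p n =
     {c \<in> carrier (chain_module K L n).
        \<forall>\<sigma>\<in>rel_simplices K L. \<not> rel_interior \<sigma> \<subseteq> filtration_step N S p \<longrightarrow> c \<sigma> = 0}"

definition cochain_filtration ::
  "'a::euclidean_space set set \<Rightarrow> 'a set set \<Rightarrow> nat \<Rightarrow> (nat \<Rightarrow> 'a set) \<Rightarrow> int \<Rightarrow> int \<Rightarrow>
   ('a set \<Rightarrow> 'r::{comm_ring,monoid_mult}) set" where
  "cochain_filtration K L N S p n =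
     {f \<in> carrier (chain_module K L n).
        \<forall>\<sigma>\<in>rel_simplices K L. rel_interior \<sigma> \<subseteq> filtration_step N S p \<longrightarrow> f \<sigma> = 0}"


section \<open>The two spectral sequences of a filtration\<close>

definition rel_homology ::
  "('a::euclidean_space \<Rightarrow> nat) \<Rightarrow> 'a set set \<Rightarrow> 'a set set \<Rightarrow> int \<Rightarrow>
   ('r::{comm_ring,monoid_mult}, ('a set \<Rightarrow> 'r) set) module" where
  "rel_homology ord K L = complex_homology 1 (chain_module K L) (boundary ord K L)"

definition rel_homology_filtration ::
  "('a::euclidean_space \<Rightarrow> nat) \<Rightarrow> 'a set set \<Rightarrow> 'a set set \<Rightarrow> nat \<Rightarrow> (nat \<Rightarrow> 'a set) \<Rightarrow> int \<Rightarrow> int \<Rightarrow>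
   ('a set \<Rightarrow> 'r::{comm_ring,monoid_mult}) set set" where
  "rel_homology_filtration ord K L N S =
     homology_filtration 1 (chain_module K L) (boundary ord K L) (chain_filtration K L N S)"

definition homology_page ::
  "('a::euclidean_space \<Rightarrow> nat) \<Rightarrow> 'a set set \<Rightarrow> 'a set set \<Rightarrow> nat \<Rightarrow> (nat \<Rightarrow> 'a set) \<Rightarrow>
   nat \<Rightarrow> int \<Rightarrow> int \<Rightarrow> ('r::{comm_ring,monoid_mult}, ('a set \<Rightarrow> 'r) set) module" where
  "homology_page ord K L N S =
     ss_page 1 (chain_module K L) (boundary ord K L) (chain_filtration K L N S)"

definition homology_diff ::
  "('a::euclidean_space \<Rightarrow> nat) \<Rightarrow> 'a set set \<Rightarrow> 'a set set \<Rightarrow> nat \<Rightarrow> (nat \<Rightarrow> 'a set) \<Rightarrow>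
   nat \<Rightarrow> int \<Rightarrow> int \<Rightarrow> ('a set \<Rightarrow> 'r::{comm_ring,monoid_mult}) set \<Rightarrow> ('a set \<Rightarrow> 'r) set" where
  "homology_diff ord K L N S =
     ss_diff 1 (chain_module K L) (boundary ord K L) (chain_filtration K L N S)"

definition rel_cohomology ::
  "('a::euclidean_space \<Rightarrow> nat) \<Rightarrow> 'a set set \<Rightarrow> 'a set set \<Rightarrow> int \<Rightarrow>
   ('r::{comm_ring,monoid_mult}, ('a set \<Rightarrow> 'r) set) module" where
  "rel_cohomology ord K L = complex_homology (- 1) (chain_module K L) (coboundary ord K L)"

definition rel_cohomology_filtration ::
  "('a::euclidean_space \<Rightarrow> nat) \<Rightarrow> 'a set set \<Rightarrow> 'a set set \<Rightarrow> nat \<Rightarrow> (nat \<Rightarrow> 'a set) \<Rightarrow> int \<Rightarrow> int \<Rightarrow>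
   ('a set \<Rightarrow> 'r::{comm_ring,monoid_mult}) set set" where
  "rel_cohomology_filtration ord K L N S =
     homology_filtration (- 1) (chain_module K L) (coboundary ord K L) (cochain_filtration K L N S)"

definition cohomology_page ::
  "('a::euclidean_space \<Rightarrow> nat) \<Rightarrow> 'a set set \<Rightarrow> 'a set set \<Rightarrow> nat \<Rightarrow> (nat \<Rightarrow> 'a set) \<Rightarrow>
   nat \<Rightarrow> int \<Rightarrow> int \<Rightarrow> ('r::{comm_ring,monoid_mult}, ('a set \<Rightarrow> 'r) set) module" where
  "cohomology_page ord K L N S =
     ss_page (- 1) (chain_module K L) (coboundary ord K L) (cochain_filtration K L N S)"

definition cohomology_diff ::
  "('a::euclidean_space \<Rightarrow> nat) \<Rightarrow> 'a set set \<Rightarrow> 'a set set \<Rightarrow> nat \<Rightarrow> (nat \<Rightarrow> 'a set) \<Rightarrow>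
   nat \<Rightarrow> int \<Rightarrow> int \<Rightarrow> ('a set \<Rightarrow> 'r::{comm_ring,monoid_mult}) set \<Rightarrow> ('a set \<Rightarrow> 'r) set" where
  "cohomology_diff ord K L N S =
     ss_diff (- 1) (chain_module K L) (coboundary ord K L) (cochain_filtration K L N S)"

end

theory Submission
  imports Defs "HOL-Library.Function_Algebras"
begin

text \<open>
  The graded piece of the filtration attached to a tile is the complex of the faces \<open>\<sigma>\<close> of a
  simplex with vertex set \<open>V\<close> such that \<open>A \<subseteq> \<sigma>\<close> and \<open>\<not> \<sigma> \<subseteq> M\<close>, where \<open>A\<close> is the set of vertices
  opposite to the removed codimension one faces and \<open>M\<close> the vertex set of the Morse face. For a
  suitable vertex \<open>v\<close>, toggling \<open>v\<close> pairs off all these faces if the tile is regular, and all but one,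
  whose dimension is the index, if the tile is critical. The pairing gives a contraction of
  the complex onto a free module of rank zero or one, which is therefore its homology; transposing the
  contraction gives the cohomology. So the first pages are free over the critical
  tiles, and the other assertions hold for every bounded filtration.
\<close>

section \<open>Quotient modules\<close>

text \<open>The ring may have zero divisors or be zero, so freeness is not obtained by counting
  ranks: a generator and a coefficient functional are produced explicitly. Toggling a single vertex
  makes this easy. A face without \<open>v\<close> has exactly one coface of the next dimension
  containing \<open>v\<close>, and the incidence number is a sign, hence its own inverse. One step
  of the pairing is therefore already the homotopy, and no sums over gradient paths appear. What is
  left over, the failure of the homotopy to contract to zero, commutes with the differential; this
  confines it to the unpaired face, where it yields the functional.

  The geometry of the shelling enters through two facts. Closedness of the steps in \<open>S\<close>
  makes them subcomplexes. A face that meets the relative interior of a simplex contains that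
  simplex, so every tile is a union of open simplices and its stratum can be read off from vertex
  sets.

  The sign \<open>e\<close> lets one argument about filtered complexes serve both homology and
  cohomology.\<close>

lemma submodule_iff:
  assumes "Module.module R M"
  shows "submodule B R M \<longleftrightarrow> B \<subseteq> carrier M \<and> \<zero>\<^bsub>M\<^esub> \<in> B \<and>
    (\<forall>x\<in>B. \<forall>y\<in>B. x \<oplus>\<^bsub>M\<^esub> y \<in> B) \<and> (\<forall>a\<in>carrier R. \<forall>x\<in>B. a \<odot>\<^bsub>M\<^esub> x \<in> B)"
proof -
  interpret Module.module R M by fact
  show ?thesis
  proof
    assume "submodule B R M"
    then interpret submodule B R M .
    show "B \<subseteq> carrier M \<and> \<zero>\<^bsub>M\<^esub> \<in> B \<and>
      (\<forall>x\<in>B. \<forall>y\<in>B. x \<oplus>\<^bsub>M\<^esub> y \<in> B) \<and> (\<forall>a\<in>carrier R. \<forall>x\<in>B. a \<odot>\<^bsub>M\<^esub> x \<in> B)"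
      using subset one_closed m_closed by auto
  next
    assume B: "B \<subseteq> carrier M \<and> \<zero>\<^bsub>M\<^esub> \<in> B \<and>
      (\<forall>x\<in>B. \<forall>y\<in>B. x \<oplus>\<^bsub>M\<^esub> y \<in> B) \<and> (\<forall>a\<in>carrier R. \<forall>x\<in>B. a \<odot>\<^bsub>M\<^esub> x \<in> B)"
    have "\<ominus>\<^bsub>M\<^esub> x \<in> B" if "x \<in> B" for x
    proof -
      \<comment> \<open>Negation is scaling by minus one, so closure under inverses comes from
        closure under scaling.\<close>
      have "\<ominus>\<^bsub>R\<^esub> \<one>\<^bsub>R\<^esub> \<odot>\<^bsub>M\<^esub> x \<in> B" using B that by auto
      moreover have "\<ominus>\<^bsub>R\<^esub> \<one>\<^bsub>R\<^esub> \<odot>\<^bsub>M\<^esub> x = \<ominus>\<^bsub>M\<^esub> x"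
        using B that smult_l_minus[of "\<one>\<^bsub>R\<^esub>" x] by (auto simp: subset_iff)
      ultimately show ?thesis by simp
    qed
    then show "submodule B R M"
      using B by (intro submoduleI) auto
  qed
qed

lemma module_submodule_carrier:
  assumes "Module.module R M" "submodule B R M"
  shows "Module.module R (M\<lparr>carrier := B\<rparr>)"
  using submodule.submodule_is_module[OF assms(2,1)] .

lemma module_hom_zero:
  assumes "Module.module R M" "Module.module R N" "h \<in> module_hom_set R M N"
  shows "h \<zero>\<^bsub>M\<^esub> = \<zero>\<^bsub>N\<^esub>"
proof -
  interpret M: Module.module R M by fact
  interpret N: Module.module R N by fact
  have "h \<zero>\<^bsub>M\<^esub> \<in> carrier N" "h (\<zero>\<^bsub>M\<^esub> \<oplus>\<^bsub>M\<^esub> \<zero>\<^bsub>M\<^esub>) = h \<zero>\<^bsub>M\<^esub> \<oplus>\<^bsub>N\<^esub> h \<zero>\<^bsub>M\<^esub>"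
    using assms(3) M.zero_closed unfolding module_hom_set_def by blast+
  then show ?thesis by simp
qed

lemma module_hom_compose:
  assumes "g \<in> module_hom_set R M N" "h \<in> module_hom_set R N P"
  shows "(\<lambda>x. h (g x)) \<in> module_hom_set R M P"
  using assms unfolding module_hom_set_def by (auto simp: Pi_iff)

lemma module_hom_image_submodule:
  assumes "Module.module R M" "Module.module R N" "h \<in> module_hom_set R M N"
  shows "submodule (h ` carrier M) R N"
proof -
  interpret M: Module.module R M by fact
  have "\<zero>\<^bsub>N\<^esub> \<in> h ` carrier M"
    using module_hom_zero[OF assms] M.zero_closed by (metis image_eqI)
  moreover have "x \<oplus>\<^bsub>N\<^esub> y \<in> h ` carrier M" if xy: "x \<in> h ` carrier M" "y \<in> h ` carrier M" for x y
  proof -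
    from xy obtain x' y' where "x' \<in> carrier M" "y' \<in> carrier M" "x = h x'" "y = h y'" by blast
    moreover from this have "h (x' \<oplus>\<^bsub>M\<^esub> y') = x \<oplus>\<^bsub>N\<^esub> y"
      using assms(3) unfolding module_hom_set_def by blast
    ultimately show ?thesis by (metis M.add.m_closed image_eqI)
  qed
  moreover have "a \<odot>\<^bsub>N\<^esub> x \<in> h ` carrier M" if ax: "a \<in> carrier R" "x \<in> h ` carrier M" for a x
  proof -
    from ax obtain x' where "x' \<in> carrier M" "x = h x'" by blast
    moreover from this ax have "h (a \<odot>\<^bsub>M\<^esub> x') = a \<odot>\<^bsub>N\<^esub> x"
      using assms(3) unfolding module_hom_set_def by blast
    ultimately show ?thesis using ax by (metis M.smult_closed image_eqI)
  qed
  moreover have "h ` carrier M \<subseteq> carrier N"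
    using assms(3) unfolding module_hom_set_def by blast
  ultimately show ?thesis
    using assms(2) by (simp add: submodule_iff)
qed

lemma module_hom_kernel_submodule:
  assumes "Module.module R M" "Module.module R N" "h \<in> module_hom_set R M N"
  shows "submodule (a_kernel M N h) R M"
proof -
  interpret M: Module.module R M by fact
  interpret N: Module.module R N by fact
  show ?thesis
    using assms module_hom_zero[OF assms]
    by (auto simp: submodule_iff a_kernel_def' module_hom_set_def)
qed

locale module_quotient = Module.module R M for R :: "'r ring" and M :: "('r, 'm) module" (structure) +
  fixes B :: "'m set"
  assumes B: "submodule B R M"
begin

sublocale abelian_subgroup B M
proof (rule abelian_subgroupI3)
  show "additive_subgroup B M"
    using B by (simp add: additive_subgroup_def submodule_def)
qed (rule abelian_group_axioms)

lemma coset_eq_iff: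
  assumes "x \<in> carrier M" "y \<in> carrier M"
  shows "B +> x = B +> y \<longleftrightarrow> x \<ominus> y \<in> B"
proof -
  have "B +> x = B +> y \<longleftrightarrow> x \<in> B +> y"
    using a_rcos_self[of x] a_repr_independence'[of x y] assms by auto
  then show ?thesis using a_rcos_module[of y x] assms by (simp add: a_minus_def)
qed

lemma carrier_quotient: "carrier (quotient_module M B) = (\<lambda>x. B +> x) ` carrier M"
  by (auto simp: quotient_module_def A_RCOSETS_def')

lemma zero_quotient: "\<zero>\<^bsub>quotient_module M B\<^esub> = B"
  by (simp add: quotient_module_def)

lemma coset_zero: "x \<in> carrier M \<Longrightarrow> B +> x = B \<longleftrightarrow> x \<in> B"
  using a_rcos_self[of x] a_rcos_const[of x] by auto

lemma add_quotient:
  assumes "x \<in> carrier M" "y \<in> carrier M"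
  shows "(B +> x) \<oplus>\<^bsub>quotient_module M B\<^esub> (B +> y) = B +> (x \<oplus> y)"
  using a_rcos_sum[OF assms] by (simp add: quotient_module_def)

text \<open>The definition unites the cosets of all scaled representatives. These coincide because
  \<open>B\<close> is closed under scaling, and the union is over a nonempty set.\<close>

lemma smult_quotient:
  assumes "a \<in> carrier R" "x \<in> carrier M"
  shows "a \<odot>\<^bsub>quotient_module M B\<^esub> (B +> x) = B +> (a \<odot> x)"
proof -
  have "B +> (a \<odot> y) = B +> (a \<odot> x)" if y: "y \<in> B +> x" for y
  proof -
    have yM: "y \<in> carrier M" using y assms a_elemrcos_carrier by blast
    have "y \<ominus> x \<in> B" using y assms yM a_rcos_module[of x y] by (simp add: a_minus_def)
    then have "a \<odot> (y \<ominus> x) \<in> B" by (rule submodule.smult_closed[OF B assms(1)])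
    then have "a \<odot> y \<ominus> a \<odot> x \<in> B"
      using assms yM by (simp add: a_minus_def smult_r_distr smult_r_minus)
    then show ?thesis using assms yM by (simp add: coset_eq_iff)
  qed
  moreover have "B +> x \<noteq> {}" using a_rcos_self assms by blast
  ultimately have "(\<Union>y\<in>B +> x. B +> (a \<odot> y)) = B +> (a \<odot> x)" by (intro SUP_eq_const)
  then show ?thesis by (simp add: quotient_module_def)
qed

lemma module_quotient_module: "Module.module R (quotient_module M B)"
proof (rule moduleI)
  let ?Q = "quotient_module M B"
  show "cring R" by (rule R.is_cring)
  show "abelian_group ?Q"
  proof (rule abelian_groupI)
    fix x assume "x \<in> carrier ?Q"
    then obtain x' where "x' \<in> carrier M" "x = B +> x'" by (auto simp: carrier_quotient)
    then show "\<exists>y\<in>carrier ?Q. y \<oplus>\<^bsub>?Q\<^esub> x = \<zero>\<^bsub>?Q\<^esub>"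
      by (intro bexI[of _ "B +> (\<ominus> x')"])
        (auto simp: carrier_quotient add_quotient zero_quotient l_neg a_coset_add_zero[OF a_subset])
  next
    fix x assume "x \<in> carrier ?Q"
    then obtain x' where "x' \<in> carrier M" "x = B +> x'" by (auto simp: carrier_quotient)
    then show "\<zero>\<^bsub>?Q\<^esub> \<oplus>\<^bsub>?Q\<^esub> x = x"
      using add_quotient[of \<zero> x'] by (simp add: zero_quotient a_coset_add_zero[OF a_subset])
  next
    show "\<zero>\<^bsub>?Q\<^esub> \<in> carrier ?Q"
      unfolding carrier_quotient zero_quotient
      using a_coset_add_zero[OF a_subset]
      by (intro image_eqI[where x = \<zero>]) simp_all
  next
    fix x y z assume "x \<in> carrier ?Q" "y \<in> carrier ?Q" "z \<in> carrier ?Q"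
    then show "(x \<oplus>\<^bsub>?Q\<^esub> y) \<oplus>\<^bsub>?Q\<^esub> z = x \<oplus>\<^bsub>?Q\<^esub> (y \<oplus>\<^bsub>?Q\<^esub> z)"
      by (auto simp: carrier_quotient add_quotient a_assoc)
  next
    fix x y assume "x \<in> carrier ?Q" "y \<in> carrier ?Q"
    then obtain x' y' where "x' \<in> carrier M" "x = B +> x'" "y' \<in> carrier M" "y = B +> y'"
      by (auto simp: carrier_quotient)
    then show "x \<oplus>\<^bsub>?Q\<^esub> y = y \<oplus>\<^bsub>?Q\<^esub> x"
      by (simp add: add_quotient a_comm[of x' y'])
  qed (auto simp: carrier_quotient add_quotient)
qed (auto simp: carrier_quotient add_quotient smult_quotient smult_l_distr smult_r_distr
    smult_assoc1)

lemma projection_hom: "(\<lambda>x. B +> x) \<in> module_hom_set R M (quotient_module M B)"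
  by (auto simp: module_hom_set_def carrier_quotient add_quotient smult_quotient)

text \<open>First isomorphism theorem; through \<open>quot_iso\<close> it identifies both the
  successor of a page and the limit page.\<close>

lemma quotient_iso:
  assumes N: "Module.module R N" and h: "h \<in> module_hom_set R M N"
    and surj: "h ` carrier M = carrier N"
    and ker: "\<And>x. x \<in> carrier M \<Longrightarrow> h x = \<zero>\<^bsub>N\<^esub> \<longleftrightarrow> x \<in> B"
  shows "module_iso R (quotient_module M B) N"
proof -
  interpret N: Module.module R N by fact
  \<comment> \<open>The choice is harmless: by \<open>eq\<close> below, \<open>h\<close> is constant
    on each coset.\<close>
  define g where "g X = h (SOME x. x \<in> X)" for X
  have add: "h (x \<oplus> y) = h x \<oplus>\<^bsub>N\<^esub> h y" if "x \<in> carrier M" "y \<in> carrier M" for x y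
    using h that by (auto simp: module_hom_set_def)
  have hN: "h x \<in> carrier N" if "x \<in> carrier M" for x using h that by (auto simp: module_hom_set_def)
  have sm: "h (a \<odot> x) = a \<odot>\<^bsub>N\<^esub> h x" if "a \<in> carrier R" "x \<in> carrier M" for a x
    using h that by (auto simp: module_hom_set_def)
  have eq: "h x = h y \<longleftrightarrow> x \<ominus> y \<in> B" if "x \<in> carrier M" "y \<in> carrier M" for x y
  proof -
    have "h x = h (x \<ominus> y) \<oplus>\<^bsub>N\<^esub> h y"
      using that add[of "x \<ominus> y" y] by (simp add: a_minus_def add.m_assoc l_neg)
    then have "h x = h y \<longleftrightarrow> h (x \<ominus> y) = \<zero>\<^bsub>N\<^esub>"
      using that hN by (metis N.add.r_cancel_one' minus_closed)
    then show ?thesis using that ker by simp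
  qed
  have g: "g (B +> x) = h x" if x: "x \<in> carrier M" for x
  proof -
    have "(SOME y. y \<in> B +> x) \<in> B +> x" using a_rcos_self[OF x] by (rule someI)
    moreover from this have "(SOME y. y \<in> B +> x) \<in> carrier M" using a_elemrcos_carrier x by blast
    ultimately show ?thesis using x a_rcos_module[of x "SOME y. y \<in> B +> x"]
      by (simp add: g_def eq a_minus_def)
  qed
  have "g \<in> module_hom_set R (quotient_module M B) N"
    by (auto simp: module_hom_set_def carrier_quotient add_quotient smult_quotient g hN add sm)
  moreover have "bij_betw g (carrier (quotient_module M B)) (carrier N)"
    unfolding bij_betw_def
  proof
    show "inj_on g (carrier (quotient_module M B))"
      by (auto simp: inj_on_def carrier_quotient g eq coset_eq_iff)
    show "g ` carrier (quotient_module M B) = carrier N"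
      using surj by (auto simp: carrier_quotient image_image g)
  qed
  ultimately show ?thesis by (auto simp: module_iso_def)
qed

end

section \<open>Free modules of rank zero and one\<close>

lemma free_on_empty:
  assumes "carrier M = {\<zero>\<^bsub>M\<^esub>}"
  shows "free_on R M {}"
  using assms by (auto simp: free_on_def finsum_def finprod_def)

lemma free_on_singleton:
  assumes "Module.module R M" "g \<in> carrier M"
    and ex: "\<And>x. x \<in> carrier M \<Longrightarrow> \<exists>!s. s \<in> carrier R \<and> x = s \<odot>\<^bsub>M\<^esub> g"
  shows "free_on R M {i}"
proof -
  interpret Module.module R M by fact
  have fs: "finsum M (\<lambda>j. a j \<odot>\<^bsub>M\<^esub> g) {i} = a i \<odot>\<^bsub>M\<^esub> g" if "a i \<in> carrier R" for a
    using assms(2) that by (subst finsum_insert) auto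
  have "\<exists>!a. a \<in> {i} \<rightarrow>\<^sub>E carrier R \<and> x = finsum M (\<lambda>j. a j \<odot>\<^bsub>M\<^esub> g) {i}" if x: "x \<in> carrier M" for x
  proof -
    obtain s where s: "s \<in> carrier R" "x = s \<odot>\<^bsub>M\<^esub> g"
      and uniq: "\<And>s'. s' \<in> carrier R \<Longrightarrow> x = s' \<odot>\<^bsub>M\<^esub> g \<Longrightarrow> s' = s" using ex[OF x] by blast
    show ?thesis
    proof (rule ex1I[of _ "\<lambda>j\<in>{i}. s"])
      show "(\<lambda>j\<in>{i}. s) \<in> {i} \<rightarrow>\<^sub>E carrier R \<and> x = finsum M (\<lambda>j. (\<lambda>j\<in>{i}. s) j \<odot>\<^bsub>M\<^esub> g) {i}"
        using s fs[of "\<lambda>j\<in>{i}. s"] by simp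
    next
      fix a assume a: "a \<in> {i} \<rightarrow>\<^sub>E carrier R \<and> x = finsum M (\<lambda>j. a j \<odot>\<^bsub>M\<^esub> g) {i}"
      then have "a i \<in> carrier R" by auto
      with a fs[of a] have "a i = s" using uniq by metis
      with a show "a = (\<lambda>j\<in>{i}. s)" by (auto simp: PiE_iff extensional_def fun_eq_iff)
    qed
  qed
  then show ?thesis
    unfolding free_on_def using assms(2)
    by (intro conjI bexI[of _ "\<lambda>_. g"] ballI) simp_all
qed

section \<open>The spectral sequence of a bounded filtered complex\<close>

text \<open>All modules of a filtered complex add by the \<open>(+)\<close> of the ambient type, so
  a coset need not mention the module or its degree.\<close>

definition coset :: "'m::ab_group_add set \<Rightarrow> 'm \<Rightarrow> 'm set" where
  "coset B x = (\<lambda>b. b + x) ` B"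

lemma r_coset_eq_coset:
  assumes "add M = (+)"
  shows "B +>\<^bsub>M\<^esub> x = coset B x"
  using assms by (auto simp: a_r_coset_def' coset_def)

lemma submodule_restrict:
  assumes "Module.module R M" "submodule Z R M" "submodule B R M" "B \<subseteq> Z"
  shows "submodule B R (M\<lparr>carrier := Z\<rparr>)"
  using assms module_submodule_carrier[OF assms(1,2)] by (simp add: submodule_iff)

text \<open>The filtration grows with \<open>e * p\<close> in both conventions, as passing from
  \<open>p\<close> to \<open>p - e\<close> lowers \<open>e * p\<close> by one. The bounds
  \<open>l\<close> and \<open>u\<close> are uniform in the degree. Elements of all degrees share one
  type, so that \<open>D\<close> is a single map.\<close>

locale filtered_complex =
  fixes R :: "'r ring" and scl :: "'r \<Rightarrow> 'm::ab_group_add \<Rightarrow> 'm"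
    and C :: "int \<Rightarrow> ('r, 'm) module" and D :: "'m \<Rightarrow> 'm" and F :: "int \<Rightarrow> int \<Rightarrow> 'm set"
    and e l u :: int
  assumes e: "e = 1 \<or> e = - 1"
    and C_module: "Module.module R (C n)"
    and C_add: "add (C n) = (+)" and C_zero: "zero (C n) = 0" and C_smult: "smult (C n) = scl"
    and D_add: "D (x + y) = D x + D y"
    and D_scl: "a \<in> carrier R \<Longrightarrow> D (scl a x) = scl a (D x)"
    and D_closed: "x \<in> carrier (C n) \<Longrightarrow> D x \<in> carrier (C (n - e))"
    and D_D: "x \<in> carrier (C n) \<Longrightarrow> D (D x) = 0"
    and F_submodule: "submodule (F p n) R (C n)"
    and F_mono: "F (p - e) n \<subseteq> F p n"
    and D_F: "x \<in> F p n \<Longrightarrow> D x \<in> F p (n - e)"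
    and F_bot: "e * p \<le> l \<Longrightarrow> F p n = {0}"
    and F_top: "u \<le> e * p \<Longrightarrow> F p n = carrier (C n)"
begin

lemma submodule_C_iff:
  "submodule B R (C n) \<longleftrightarrow> B \<subseteq> carrier (C n) \<and> 0 \<in> B \<and> (\<forall>x\<in>B. \<forall>y\<in>B. x + y \<in> B) \<and>
    (\<forall>a\<in>carrier R. \<forall>x\<in>B. scl a x \<in> B)"
  by (simp add: submodule_iff[OF C_module] C_add C_zero C_smult)

lemma submodule_D:
  assumes "submodule B R (C n)"
  shows "B \<subseteq> carrier (C n)" "0 \<in> B" "x \<in> B \<Longrightarrow> y \<in> B \<Longrightarrow> x + y \<in> B"
    "a \<in> carrier R \<Longrightarrow> x \<in> B \<Longrightarrow> scl a x \<in> B"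
  using assms by (auto simp: submodule_C_iff)

lemma submodule_carrier: "submodule (carrier (C n)) R (C n)"
proof -
  interpret Module.module R "C n" by (rule C_module)
  show ?thesis using a_closed zero_closed smult_closed by (simp add: submodule_iff[OF C_module])
qed

lemma submodule_uminus:
  assumes "submodule B R (C n)" "x \<in> B"
  shows "- x \<in> B"
proof -
  interpret Module.module R "C n" by (rule C_module)
  interpret submodule B R "C n" by fact
  have "\<ominus>\<^bsub>C n\<^esub> x \<in> B" using assms(2) by (simp add: a_inv_def)
  moreover have "\<ominus>\<^bsub>C n\<^esub> x + x = 0"
    using assms M.l_neg[of x] submodule_D(1)[OF assms(1)] by (auto simp: C_add C_zero)
  ultimately show ?thesis by (metis eq_neg_iff_add_eq_0)
qed

lemma submodule_minus:
  assumes "submodule B R (C n)" "x \<in> B" "y \<in> B"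
  shows "x - y \<in> B"
  using submodule_D(3)[OF assms(1,2) submodule_uminus[OF assms(1,3)]] by simp

lemma D_0 [simp]: "D 0 = 0"
  using D_add[of 0 0] by simp

lemma D_minus: "D (x - y) = D x - D y"
  using D_add[of "x - y" y] by (simp add: algebra_simps)

lemma scl_add:
  assumes "a \<in> carrier R" "x \<in> carrier (C n)" "y \<in> carrier (C n)"
  shows "scl a (x + y) = scl a x + scl a y"
  using Module.module.smult_r_distr[OF C_module assms] by (simp add: C_add C_smult)

lemma F_carrier: "F p n \<subseteq> carrier (C n)"
  using F_submodule submodule_D(1) by blast

lemma coset_eq_iff:
  assumes "submodule B R (C n)"
  shows "coset B x = coset B y \<longleftrightarrow> x - y \<in> B"
proof
  assume *: "coset B x = coset B y"
  have "0 + x \<in> coset B x" using submodule_D(2)[OF assms] by (auto simp: coset_def)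
  with * obtain b where "x = b + y" "b \<in> B" by (auto simp: coset_def)
  then show "x - y \<in> B" by simp
next
  assume *: "x - y \<in> B"
  show "coset B x = coset B y"
  proof (intro Set.set_eqI iffI)
    fix z assume "z \<in> coset B x"
    then obtain b where "z = b + x" "b \<in> B" by (auto simp: coset_def)
    then have "z = (b + (x - y)) + y" "b + (x - y) \<in> B" using * submodule_D(3)[OF assms] by auto
    then show "z \<in> coset B y" unfolding coset_def by blast
  next
    fix z assume "z \<in> coset B y"
    then obtain b where "z = b + y" "b \<in> B" by (auto simp: coset_def)
    then have "z = (b - (x - y)) + x" "b - (x - y) \<in> B" using * submodule_minus[OF assms] by auto
    then show "z \<in> coset B x" unfolding coset_def by blast
  qed
qed

lemma coset_0: "coset B 0 = B"
  by (simp add: coset_def)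

lemma coset_eq_self_iff:
  assumes "submodule B R (C n)"
  shows "coset B x = B \<longleftrightarrow> x \<in> B"
  using coset_eq_iff[OF assms, of x 0] by (simp add: coset_0)

text \<open>Pages and homology are both subquotients \<open>Z / B\<close> of some
  \<open>C n\<close>; their module structure and the maps out of them are treated once,
  here.\<close>

definition quot :: "int \<Rightarrow> 'm set \<Rightarrow> 'm set \<Rightarrow> ('r, 'm set) module" where
  "quot n Z B = quotient_module ((C n)\<lparr>carrier := Z\<rparr>) B"

context
  fixes n Z B
  assumes Z: "submodule Z R (C n)" and B: "submodule B R (C n)" and BZ: "B \<subseteq> Z"
begin

lemma module_quotient_quot: "module_quotient R ((C n)\<lparr>carrier := Z\<rparr>) B"
  using module_submodule_carrier[OF C_module Z] submodule_restrict[OF C_module Z B BZ]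
  by (simp add: module_quotient_def module_quotient_axioms_def)

lemma r_coset_quot: "B +>\<^bsub>(C n)\<lparr>carrier := Z\<rparr>\<^esub> x = coset B x"
  by (rule r_coset_eq_coset) (simp add: C_add)

lemma quot_module: "Module.module R (quot n Z B)"
  using module_quotient.module_quotient_module[OF module_quotient_quot] by (simp add: quot_def)

lemma quot_carrier: "carrier (quot n Z B) = coset B ` Z"
  using module_quotient.carrier_quotient[OF module_quotient_quot] by (simp add: quot_def r_coset_quot)

lemma quot_zero: "zero (quot n Z B) = B"
  using module_quotient.zero_quotient[OF module_quotient_quot] by (simp add: quot_def)

lemma quot_add:
  assumes "x \<in> Z" "y \<in> Z"
  shows "coset B x \<oplus>\<^bsub>quot n Z B\<^esub> coset B y = coset B (x + y)"
  using module_quotient.add_quotient[OF module_quotient_quot] assms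
  by (simp add: quot_def r_coset_quot C_add)

lemma quot_smult:
  assumes "a \<in> carrier R" "x \<in> Z"
  shows "a \<odot>\<^bsub>quot n Z B\<^esub> coset B x = coset B (scl a x)"
  using module_quotient.smult_quotient[OF module_quotient_quot] assms
  by (simp add: quot_def r_coset_quot C_smult)

lemma quot_hom: "coset B \<in> module_hom_set R ((C n)\<lparr>carrier := Z\<rparr>) (quot n Z B)"
  using module_quotient.projection_hom[OF module_quotient_quot] by (simp add: quot_def r_coset_quot)

lemma quot_iso:
  assumes "Module.module R N" "h \<in> module_hom_set R ((C n)\<lparr>carrier := Z\<rparr>) N" "h ` Z = carrier N"
    and "\<And>x. x \<in> Z \<Longrightarrow> h x = \<zero>\<^bsub>N\<^esub> \<longleftrightarrow> x \<in> B"
  shows "module_iso R (quot n Z B) N"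
  using module_quotient.quotient_iso[OF module_quotient_quot, of N h] assms by (simp add: quot_def)

lemma quot_free_empty:
  assumes "Z \<subseteq> B"
  shows "free_on R (quot n Z B) {}"
proof (rule free_on_empty)
  show "carrier (quot n Z B) = {\<zero>\<^bsub>quot n Z B\<^esub>}"
    unfolding quot_carrier quot_zero
    using assms submodule_D(2)[OF Z] coset_eq_self_iff[OF B] by (auto simp: coset_0 image_iff intro!: bexI[of _ 0])
qed

lemma quot_free_singleton:
  assumes "g \<in> Z" and ex: "\<And>x. x \<in> Z \<Longrightarrow> \<exists>!s. s \<in> carrier R \<and> x - scl s g \<in> B"
  shows "free_on R (quot n Z B) {i}"
proof (rule free_on_singleton[OF quot_module])
  show "coset B g \<in> carrier (quot n Z B)" using assms(1) by (simp add: quot_carrier)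
  fix X assume "X \<in> carrier (quot n Z B)"
  then obtain x where x: "x \<in> Z" "X = coset B x" by (auto simp: quot_carrier)
  have "X = s \<odot>\<^bsub>quot n Z B\<^esub> coset B g \<longleftrightarrow> x - scl s g \<in> B" if "s \<in> carrier R" for s
    using that x assms(1) by (simp add: quot_smult coset_eq_iff[OF B])
  then show "\<exists>!s. s \<in> carrier R \<and> X = s \<odot>\<^bsub>quot n Z B\<^esub> coset B g"
    using ex[OF x(1)] by metis
qed

end

section \<open>Pages and differentials\<close>

abbreviation "cyc \<equiv> ss_cycles e D F"
abbreviation "bnd \<equiv> ss_boundaries e C D F"

lemma cyc_iff: "x \<in> cyc r p n \<longleftrightarrow> x \<in> F p n \<and> D x \<in> F (p - e * r) (n - e)"
  by (simp add: ss_cycles_def)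

lemma cyc_submodule: "submodule (cyc r p n) R (C n)"
  using F_carrier[of p n] submodule_D(2-4)[OF F_submodule] submodule_D(2-4)[OF F_submodule]
  by (auto simp: submodule_C_iff ss_cycles_def D_add D_scl)

lemma bnd_iff:
  "x \<in> bnd r p n \<longleftrightarrow>
    (\<exists>y\<in>cyc (r - 1) (p - e) n. \<exists>z\<in>cyc (r - 1) (p + e * (r - 1)) (n + e). x = y + D z)"
  by (auto simp: ss_boundaries_def set_add_def' C_add)

lemma bnd_submodule: "submodule (bnd r p n) R (C n)"
proof -
  note cyc1 = submodule_D[OF cyc_submodule[of "r - 1" "p - e" n]]
  note cyc2 = submodule_D[OF cyc_submodule[of "r - 1" "p + e * (r - 1)" "n + e"]]
  have carr: "bnd r p n \<subseteq> carrier (C n)"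
  proof
    fix x assume "x \<in> bnd r p n"
    then obtain y z where yz: "y \<in> cyc (r - 1) (p - e) n"
      "z \<in> cyc (r - 1) (p + e * (r - 1)) (n + e)" "x = y + D z" by (auto simp: bnd_iff)
    have "D z \<in> carrier (C n)" using D_closed[of z "n + e"] yz cyc2(1) by auto
    then show "x \<in> carrier (C n)" using yz cyc1(1) submodule_D(3)[OF submodule_carrier] by auto
  qed
  moreover have "0 \<in> bnd r p n"
    unfolding bnd_iff using cyc1(2) cyc2(2) by (intro bexI[of _ 0]) auto
  moreover have "x + x' \<in> bnd r p n" if xx': "x \<in> bnd r p n" "x' \<in> bnd r p n" for x x'
  proof -
    obtain y z y' z' where "y \<in> cyc (r - 1) (p - e) n" "y' \<in> cyc (r - 1) (p - e) n"
      "z \<in> cyc (r - 1) (p + e * (r - 1)) (n + e)" "x = y + D z"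
      "z' \<in> cyc (r - 1) (p + e * (r - 1)) (n + e)" "x' = y' + D z'"
      using xx' unfolding bnd_iff by blast
    then show ?thesis unfolding bnd_iff
      by (intro bexI[of _ "y + y'"] bexI[of _ "z + z'"]) (auto simp: cyc1 cyc2 D_add)
  qed
  moreover have "scl a x \<in> bnd r p n" if a: "a \<in> carrier R" and x: "x \<in> bnd r p n" for a x
  proof -
    obtain y z where yz: "y \<in> cyc (r - 1) (p - e) n"
      "z \<in> cyc (r - 1) (p + e * (r - 1)) (n + e)" "x = y + D z" using x unfolding bnd_iff by blast
    have "y \<in> carrier (C n)" "D z \<in> carrier (C n)"
      using yz cyc1(1) cyc2(1) D_closed[of z "n + e"] by auto
    then have "scl a x = scl a y + D (scl a z)" using a yz by (simp add: scl_add D_scl)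
    then show ?thesis unfolding bnd_iff
      using yz cyc1(4)[OF a yz(1)] cyc2(4)[OF a yz(2)] by blast
  qed
  ultimately show ?thesis by (simp add: submodule_C_iff)
qed

text \<open>The summand \<open>D z\<close> is a cycle, and the shifts cancel: \<open>r - 1\<close>
  steps below \<open>p - e\<close> is the level \<open>p - e * r\<close>.\<close>

lemma bnd_subset_cyc:
  assumes "0 \<le> r"
  shows "bnd r p n \<subseteq> cyc r p n"
proof
  fix x assume "x \<in> bnd r p n"
  then obtain y z where y: "y \<in> cyc (r - 1) (p - e) n"
    and z: "z \<in> cyc (r - 1) (p + e * (r - 1)) (n + e)" and x: "x = y + D z" by (auto simp: bnd_iff)
  have "z \<in> carrier (C (n + e))" using z submodule_D(1)[OF cyc_submodule] by blast
  then have "D x = D y" by (simp add: x D_add D_D)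
  moreover have "D y \<in> F (p - e * r) (n - e)" "y \<in> F p n" using y F_mono
    by (auto simp: cyc_iff algebra_simps)
  moreover have "D z \<in> F p n" using z by (simp add: cyc_iff)
  ultimately show "x \<in> cyc r p n"
    using submodule_D(3)[OF F_submodule] by (simp add: cyc_iff x)
qed

text \<open>Only \<open>D y\<close> survives, and \<open>y\<close> itself witnesses that it is a
  boundary at the target, because \<open>p - e * r + e * (r - 1)\<close> is the level
  \<open>p - e\<close> of \<open>y\<close>.\<close>

lemma D_bnd:
  assumes "x \<in> bnd r p n"
  shows "D x \<in> bnd r (p - e * r) (n - e)"
proof -
  obtain y z where y: "y \<in> cyc (r - 1) (p - e) n"
    and z: "z \<in> cyc (r - 1) (p + e * (r - 1)) (n + e)" and x: "x = y + D z"
    using assms by (auto simp: bnd_iff)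
  have "z \<in> carrier (C (n + e))" using z submodule_D(1)[OF cyc_submodule] by blast
  then have "D x = 0 + D y" by (simp add: x D_add D_D)
  moreover have "y \<in> cyc (r - 1) (p - e * r + e * (r - 1)) (n - e + e)" using y by (simp add: algebra_simps)
  ultimately show ?thesis
    unfolding bnd_iff using submodule_D(2)[OF cyc_submodule] by blast
qed

lemma D_cyc:
  assumes "x \<in> cyc r p n"
  shows "D x \<in> cyc r (p - e * r) (n - e)"
proof -
  have "D (D x) = 0" using assms submodule_D(1)[OF cyc_submodule] D_D by blast
  then show ?thesis using assms submodule_D(2)[OF F_submodule] by (simp add: cyc_iff)
qed

text \<open>Indexed by the total degree \<open>n\<close> instead of the complementary degree, which
  keeps sums \<open>p + q\<close> out of the arguments.\<close>

definition page :: "nat \<Rightarrow> int \<Rightarrow> int \<Rightarrow> ('r, 'm set) module" where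
  "page r p n = quot n (cyc r p n) (bnd r p n)"

definition diff :: "nat \<Rightarrow> int \<Rightarrow> int \<Rightarrow> 'm set \<Rightarrow> 'm set" where
  "diff r p n X = (\<Union>x\<in>X. coset (bnd r (p - e * int r) (n - e)) (D x))"

lemma ss_page_eq: "ss_page e C D F r p q = page r p (p + q)"
  by (simp add: ss_page_def page_def quot_def)

lemma ss_diff_eq: "ss_diff e C D F r p q = diff r p (p + q)"
  by (simp add: fun_eq_iff ss_diff_def diff_def r_coset_eq_coset[OF C_add])

text \<open>Cited by number below: module, carrier, zero, addition, scaling, projection,
  isomorphism.\<close>

lemmas page_facts =
  quot_module[OF cyc_submodule bnd_submodule bnd_subset_cyc[OF of_nat_0_le_iff], folded page_def]
  quot_carrier[OF cyc_submodule bnd_submodule bnd_subset_cyc[OF of_nat_0_le_iff], folded page_def]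
  quot_zero[OF cyc_submodule bnd_submodule bnd_subset_cyc[OF of_nat_0_le_iff], folded page_def]
  quot_add[OF cyc_submodule bnd_submodule bnd_subset_cyc[OF of_nat_0_le_iff], folded page_def]
  quot_smult[OF cyc_submodule bnd_submodule bnd_subset_cyc[OF of_nat_0_le_iff], folded page_def]
  quot_hom[OF cyc_submodule bnd_submodule bnd_subset_cyc[OF of_nat_0_le_iff], folded page_def]
  quot_iso[OF cyc_submodule bnd_submodule bnd_subset_cyc[OF of_nat_0_le_iff], folded page_def]

text \<open>\<open>D\<close> sends boundaries of the source page to boundaries of the target page,
  so all cosets in the union defining \<open>diff\<close> agree.\<close>

lemma diff_coset:
  "diff r p n (coset (bnd r p n) x) = coset (bnd r (p - e * int r) (n - e)) (D x)"
proof -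
  have "coset (bnd r (p - e * int r) (n - e)) (D y) = coset (bnd r (p - e * int r) (n - e)) (D x)"
    if y: "y \<in> coset (bnd r p n) x" for y
  proof -
    obtain b where "b \<in> bnd r p n" "y = b + x" using y by (auto simp: coset_def)
    then show ?thesis using D_bnd[of b r p n] by (simp add: coset_eq_iff[OF bnd_submodule] D_add)
  qed
  moreover have "coset (bnd r p n) x \<noteq> {}"
    using submodule_D(2)[OF bnd_submodule] by (auto simp: coset_def)
  ultimately show ?thesis unfolding diff_def by (intro SUP_eq_const)
qed

lemma diff_hom: "diff r p n \<in> module_hom_set R (page r p n) (page r (p - e * int r) (n - e))"
proof -
  have "scl a x \<in> cyc r p n" "x + y \<in> cyc r p n"
    if "x \<in> cyc r p n" "y \<in> cyc r p n" "a \<in> carrier R" for a x y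
    using that submodule_D[OF cyc_submodule] by auto
  then show ?thesis
    by (auto simp: module_hom_set_def page_facts diff_coset D_cyc D_add D_scl)
qed

lemma diff_diff:
  assumes "X \<in> carrier (page r p n)"
  shows "diff r (p - e * int r) (n - e) (diff r p n X) = bnd r (p - 2 * (e * int r)) (n - 2 * e)"
proof -
  obtain x where x: "x \<in> cyc r p n" "X = coset (bnd r p n) x" using assms by (auto simp: page_facts)
  then have "D (D x) = 0" using submodule_D(1)[OF cyc_submodule] D_D by blast
  then show ?thesis by (simp add: x diff_coset coset_0 algebra_simps)
qed

text \<open>If \<open>D x = y + D z\<close> is a boundary at the target, then \<open>z\<close> is
  itself a boundary of the page, and \<open>x - z\<close> represents the same class with
  differential \<open>y\<close> one level deeper. Conversely, when \<open>D x\<close> lies one level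
  deeper it belongs to the first summand of the boundaries.\<close>

lemma kernel_diff:
  "a_kernel (page r p n) (page r (p - e * int r) (n - e)) (diff r p n) =
    coset (bnd r p n) ` cyc (Suc r) p n"
proof (intro Set.set_eqI iffI)
  fix X assume "X \<in> a_kernel (page r p n) (page r (p - e * int r) (n - e)) (diff r p n)"
  then obtain x where x: "x \<in> cyc r p n" "X = coset (bnd r p n) x"
    and "coset (bnd r (p - e * int r) (n - e)) (D x) = bnd r (p - e * int r) (n - e)"
    by (auto simp: a_kernel_def' page_facts diff_coset)
  then have "D x \<in> bnd r (p - e * int r) (n - e)"
    by (simp add: coset_eq_self_iff[OF bnd_submodule])
  then obtain y z where y: "y \<in> cyc (int r - 1) (p - e * int r - e) (n - e)"
    and z: "z \<in> cyc (int r - 1) (p - e) n" and Dx: "D x = y + D z"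
    by (auto simp: bnd_iff algebra_simps)
  have "0 \<in> cyc (int r - 1) (p + e * (int r - 1)) (n + e)"
    using submodule_D(2)[OF cyc_submodule] .
  then have zb: "z \<in> bnd r p n" unfolding bnd_iff
    using z by (intro bexI[of _ z] bexI[of _ 0]) auto
  have "z \<in> F p n" using z F_mono by (auto simp: cyc_iff)
  then have "x - z \<in> F p n" using x submodule_minus[OF F_submodule] by (simp add: cyc_iff)
  moreover have "D (x - z) = y" by (simp add: D_minus Dx)
  ultimately have "x - z \<in> cyc (Suc r) p n" using y by (simp add: cyc_iff algebra_simps)
  moreover have "X = coset (bnd r p n) (x - z)"
    using zb by (simp add: x coset_eq_iff[OF bnd_submodule])
  ultimately show "X \<in> coset (bnd r p n) ` cyc (Suc r) p n" by blast
next
  fix X assume "X \<in> coset (bnd r p n) ` cyc (Suc r) p n"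
  then obtain x where x: "x \<in> cyc (Suc r) p n" "X = coset (bnd r p n) x" by blast
  have Dx: "D x \<in> F (p - e * int r - e) (n - e)" using x by (simp add: cyc_iff algebra_simps)
  then have "x \<in> cyc r p n" using F_mono x by (auto simp: cyc_iff)
  have "D (D x) = 0" using x submodule_D(1)[OF cyc_submodule] D_D by blast
  then have "D x \<in> cyc (int r - 1) (p - e * int r - e) (n - e)"
    using Dx submodule_D(2)[OF F_submodule] by (simp add: cyc_iff)
  then have "D x \<in> bnd r (p - e * int r) (n - e)"
    unfolding bnd_iff using submodule_D(2)[OF cyc_submodule]
    by (intro bexI[of _ "D x"] bexI[of _ 0]) auto
  then show "X \<in> a_kernel (page r p n) (page r (p - e * int r) (n - e)) (diff r p n)"
    using \<open>x \<in> cyc r p n\<close>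
    by (auto simp: a_kernel_def' page_facts diff_coset x coset_eq_self_iff[OF bnd_submodule])
qed

lemma cyc_Suc_subset: "cyc (Suc r) p n \<subseteq> cyc r p n"
proof
  fix x assume "x \<in> cyc (Suc r) p n"
  then have "x \<in> F p n" "D x \<in> F (p - e * int r - e) (n - e)" by (simp_all add: cyc_iff algebra_simps)
  then show "x \<in> cyc r p n" using F_mono by (auto simp: cyc_iff)
qed

text \<open>A boundary \<open>D w\<close> of stage \<open>r\<close> can be absorbed into the image
  of the differential, because \<open>w\<close> also qualifies as a stage \<open>r\<close> cycle at
  the source level. This explains the second summand of \<open>bnd (Suc r) p n\<close>.\<close>

lemma coset_in_image_diff_iff:
  assumes x: "x \<in> cyc (Suc r) p n"
  shows "coset (bnd r p n) x \<in> diff r (p + e * int r) (n + e) ` carrier (page r (p + e * int r) (n + e))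
    \<longleftrightarrow> x \<in> bnd (Suc r) p n"
proof -
  have "coset (bnd r p n) x \<in> diff r (p + e * int r) (n + e) ` carrier (page r (p + e * int r) (n + e))
    \<longleftrightarrow> (\<exists>y\<in>cyc r (p + e * int r) (n + e). coset (bnd r p n) x =
      diff r (p + e * int r) (n + e) (coset (bnd r (p + e * int r) (n + e)) y))"
    by (auto simp: page_facts)
  also have "\<dots> \<longleftrightarrow> (\<exists>y\<in>cyc r (p + e * int r) (n + e). x - D y \<in> bnd r p n)"
    by (simp add: diff_coset coset_eq_iff[OF bnd_submodule])
  also have "\<dots> \<longleftrightarrow> x \<in> bnd (Suc r) p n"
  proof
    assume "\<exists>y\<in>cyc r (p + e * int r) (n + e). x - D y \<in> bnd r p n"
    then obtain y where y: "y \<in> cyc r (p + e * int r) (n + e)" and "x - D y \<in> bnd r p n" by blast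
    then obtain v w where v: "v \<in> cyc (int r - 1) (p - e) n"
      and w: "w \<in> cyc (int r - 1) (p + e * (int r - 1)) (n + e)" and "x - D y = v + D w"
      by (auto simp: bnd_iff)
    then have xv: "x = v + D (w + y)" by (simp add: D_add algebra_simps)
    have "w \<in> F (p + e * int r - e) (n + e)" "D w \<in> F p n"
      using w by (simp_all add: cyc_iff algebra_simps)
    then have "w \<in> cyc r (p + e * int r) (n + e)" using F_mono by (auto simp: cyc_iff)
    then have wy: "w + y \<in> cyc r (p + e * int r) (n + e)" using y submodule_D(3)[OF cyc_submodule] by blast
    then have "D (D (w + y)) = 0" using submodule_D(1)[OF cyc_submodule] D_D by blast
    \<comment> \<open>As \<open>x\<close> is a cycle of stage \<open>r + 1\<close>, this puts
      \<open>D v\<close> one level deeper than the choice of \<open>v\<close> gave.\<close>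
    then have "D v = D x" by (simp add: xv D_add)
    then have "v \<in> cyc r (p - e) n" using v x by (simp add: cyc_iff algebra_simps)
    then show "x \<in> bnd (Suc r) p n"
      unfolding bnd_iff using wy xv by (intro bexI[of _ v] bexI[of _ "w + y"]) simp_all
  next
    assume "x \<in> bnd (Suc r) p n"
    then obtain v w where v: "v \<in> cyc r (p - e) n" and w: "w \<in> cyc r (p + e * int r) (n + e)"
      and xv: "x = v + D w" by (auto simp: bnd_iff)
    have "D v \<in> F (p - e * int r - e) (n - e)" using v by (simp add: cyc_iff algebra_simps)
    then have "D v \<in> F (p - e * int r) (n - e)" using F_mono by blast
    then have "v \<in> cyc (int r - 1) (p - e) n" using v by (simp add: cyc_iff algebra_simps)
    then have "v \<in> bnd r p n"
      unfolding bnd_iff using submodule_D(2)[OF cyc_submodule]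
      by (intro bexI[of _ v] bexI[of _ 0]) auto
    then show "\<exists>y\<in>cyc r (p + e * int r) (n + e). x - D y \<in> bnd r p n"
      using w xv by (intro bexI[of _ w]) auto
  qed
  finally show ?thesis .
qed

text \<open>The stage \<open>r + 1\<close> cycles project onto the homology of the page:
  \<open>kernel_diff\<close> gives surjectivity, and \<open>coset_in_image_diff_iff\<close>
  identifies the kernel of the composite projection.\<close>

lemma page_Suc_iso:
  "module_iso R (page (Suc r) p n)
    (quotient_module
      ((page r p n)\<lparr>carrier := a_kernel (page r p n) (page r (p - e * int r) (n - e)) (diff r p n)\<rparr>)
      (diff r (p + e * int r) (n + e) ` carrier (page r (p + e * int r) (n + e))))"
proof -
  let ?K = "a_kernel (page r p n) (page r (p - e * int r) (n - e)) (diff r p n)"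
  let ?I = "diff r (p + e * int r) (n + e) ` carrier (page r (p + e * int r) (n + e))"
  have K: "submodule ?K R (page r p n)"
    by (rule module_hom_kernel_submodule[OF _ _ diff_hom]) (simp_all add: page_facts)
  have "diff r (p + e * int r) (n + e) \<in>
      module_hom_set R (page r (p + e * int r) (n + e)) (page r p n)"
    using diff_hom[of r "p + e * int r" "n + e"] by simp
  then have I: "submodule ?I R (page r p n)"
    by (intro module_hom_image_submodule) (simp_all add: page_facts)
  have "?I \<subseteq> ?K"
  proof
    fix X assume "X \<in> ?I"
    then obtain Y where Y: "Y \<in> carrier (page r (p + e * int r) (n + e))"
      and X: "X = diff r (p + e * int r) (n + e) Y" by blast
    have "X \<in> carrier (page r p n)"
      using \<open>X \<in> ?I\<close> I by (auto simp: submodule_iff[OF page_facts(1)])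
    then show "X \<in> ?K" using diff_diff[OF Y]
      by (simp add: X a_kernel_def' page_facts)
  qed
  then have "submodule ?I R ((page r p n)\<lparr>carrier := ?K\<rparr>)"
    using submodule_restrict[OF page_facts(1) K I] by simp
  then interpret Q: module_quotient R "(page r p n)\<lparr>carrier := ?K\<rparr>" ?I
    using module_submodule_carrier[OF page_facts(1) K]
    by (simp add: module_quotient_def module_quotient_axioms_def)
  let ?h = "\<lambda>x. ?I +>\<^bsub>(page r p n)\<lparr>carrier := ?K\<rparr>\<^esub> coset (bnd r p n) x"
  show ?thesis
  proof (rule page_facts(7)[of _ ?h])
    show "Module.module R (quotient_module ((page r p n)\<lparr>carrier := ?K\<rparr>) ?I)"
      by (rule Q.module_quotient_module)
    have "coset (bnd r p n) \<in> module_hom_set R ((C n)\<lparr>carrier := cyc (Suc r) p n\<rparr>) ((page r p n)\<lparr>carrier := ?K\<rparr>)"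
      using page_facts(6)[of r p n] cyc_Suc_subset[of r p n] unfolding kernel_diff
      by (auto simp: module_hom_set_def subset_iff)
    then show "?h \<in> module_hom_set R ((C n)\<lparr>carrier := cyc (Suc r) p n\<rparr>)
        (quotient_module ((page r p n)\<lparr>carrier := ?K\<rparr>) ?I)"
      by (rule module_hom_compose[OF _ Q.projection_hom])
    show "?h ` cyc (Suc r) p n = carrier (quotient_module ((page r p n)\<lparr>carrier := ?K\<rparr>) ?I)"
      unfolding Q.carrier_quotient by (simp add: kernel_diff image_image)
    fix x assume x: "x \<in> cyc (Suc r) p n"
    then have "coset (bnd r p n) x \<in> carrier ((page r p n)\<lparr>carrier := ?K\<rparr>)"
      by (simp add: kernel_diff)
    then show "?h x = \<zero>\<^bsub>quotient_module ((page r p n)\<lparr>carrier := ?K\<rparr>) ?I\<^esub> \<longleftrightarrow> x \<in> bnd (Suc r) p n"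
      unfolding Q.zero_quotient coset_in_image_diff_iff[OF x, symmetric] by (rule Q.coset_zero)
  qed
qed

lemma is_spectral_sequence: "spectral_sequence R e (ss_page e C D F) (ss_diff e C D F)"
  unfolding spectral_sequence_def Let_def ss_page_eq ss_diff_eq
proof (intro allI conjI ballI)
  fix r :: nat and p q :: int
  \<comment> \<open>The bidegree shifts of the definition change the total degree by
    \<open>e\<close> only.\<close>
  have deg: "p - e * int r + (q + e * (int r - 1)) = p + q - e"
    "p + e * int r + (q - e * (int r - 1)) = p + q + e"
    "p - 2 * (e * int r) + (q + 2 * (e * (int r - 1))) = p + q - 2 * e"
    by (simp_all add: algebra_simps)
  note page_facts(1,3)[simp]
  show "Module.module R (page r p (p + q))" by simp
  show "diff r p (p + q) \<in> module_hom_set R (page r p (p + q))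
      (page r (p - e * int r) (p - e * int r + (q + e * (int r - 1))))"
    unfolding deg by (rule diff_hom)
  show "diff r (p - e * int r) (p - e * int r + (q + e * (int r - 1))) (diff r p (p + q) X) =
      \<zero>\<^bsub>page r (p - 2 * (e * int r)) (p - 2 * (e * int r) + (q + 2 * (e * (int r - 1))))\<^esub>"
    if "X \<in> carrier (page r p (p + q))" for X
    unfolding deg using diff_diff[OF that] by simp
  show "module_iso R (page (Suc r) p (p + q))
      (quotient_module
        (page r p (p + q)\<lparr>carrier := a_kernel (page r p (p + q))
          (page r (p - e * int r) (p - e * int r + (q + e * (int r - 1)))) (diff r p (p + q))\<rparr>)
        (diff r (p + e * int r) (p + e * int r + (q - e * (int r - 1))) `
         carrier (page r (p + e * int r) (p + e * int r + (q - e * (int r - 1))))))"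
    unfolding deg by (rule page_Suc_iso)
qed

section \<open>Homology of the complex and the limit page\<close>

definition ker where "ker n = a_kernel (C n) (C (n - e)) D"
definition img where "img n = D ` carrier (C (n + e))"

lemma ker_iff: "x \<in> ker n \<longleftrightarrow> x \<in> carrier (C n) \<and> D x = 0"
  by (simp add: ker_def a_kernel_def' C_zero)

lemma ker_submodule: "submodule (ker n) R (C n)"
  unfolding ker_def
  by (rule module_hom_kernel_submodule[OF C_module C_module])
    (auto simp: module_hom_set_def C_add C_smult D_add D_scl D_closed)

lemma img_submodule: "submodule (img n) R (C n)"
proof -
  have "D \<in> module_hom_set R (C (n + e)) (C n)"
    using D_closed[of _ "n + e"] by (auto simp: module_hom_set_def C_add C_smult D_add D_scl)
  then show ?thesis unfolding img_def by (rule module_hom_image_submodule[OF C_module C_module])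
qed

lemma img_subset_ker: "img n \<subseteq> ker n"
  using D_D D_closed[of _ "n + e"] by (auto simp: ker_iff img_def)

lemma complex_homology_eq: "complex_homology e C D n = quot n (ker n) (img n)"
  by (simp add: complex_homology_def quot_def ker_def img_def)

lemma homology_filtration_eq: "homology_filtration e C D F p n = coset (img n) ` (F p n \<inter> ker n)"
  by (simp add: homology_filtration_def ker_def img_def r_coset_eq_coset[OF C_add])

lemmas H_facts = quot_module[OF ker_submodule img_submodule img_subset_ker, folded complex_homology_eq]
  quot_carrier[OF ker_submodule img_submodule img_subset_ker, folded complex_homology_eq]
  quot_zero[OF ker_submodule img_submodule img_subset_ker, folded complex_homology_eq]
  quot_hom[OF ker_submodule img_submodule img_subset_ker, folded complex_homology_eq]

lemma F_ker_submodule: "submodule (F p n \<inter> ker n) R (C n)"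
  using F_submodule[of p n] ker_submodule[of n] by (auto simp: submodule_C_iff)

lemma F_ker_hom:
  "coset (img n) \<in> module_hom_set R ((C n)\<lparr>carrier := F p n \<inter> ker n\<rparr>) (complex_homology e C D n)"
  using H_facts(4)[of n] by (auto simp: module_hom_set_def)

lemma homology_filtration_submodule:
  "submodule (homology_filtration e C D F p n) R (complex_homology e C D n)"
  using module_hom_image_submodule[OF module_submodule_carrier[OF C_module F_ker_submodule]
      H_facts(1) F_ker_hom]
  by (simp add: homology_filtration_eq)

lemma homology_filtration_mono:
  "homology_filtration e C D F (p - e) n \<subseteq> homology_filtration e C D F p n"
  using F_mono by (auto simp: homology_filtration_eq)

text \<open>The first bound on \<open>r\<close> makes \<open>F (p - e * r)\<close> zero, so that
  stage \<open>r\<close> cycles are genuine cycles. The second makes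
  \<open>F (p + e * (r - 1))\<close> the whole complex, so that every genuine boundary lying in
  \<open>F p n\<close> is available.\<close>

lemma page_limit_iso:
  assumes r: "e * p - l \<le> int r" "u - e * p + 1 \<le> int r"
  shows "module_iso R (page r p n)
    (quotient_module ((complex_homology e C D n)\<lparr>carrier := homology_filtration e C D F p n\<rparr>)
      (homology_filtration e C D F (p - e) n))"
proof -
  let ?\<Psi> = "\<lambda>p. homology_filtration e C D F p n"
  have ee: "e * (e * k) = k" for k using e by auto
  have bot: "F (p - e * int r) m = {0}" for m
    by (rule F_bot) (use r in \<open>simp add: right_diff_distrib ee\<close>)
  have top: "F (p + e * (int r - 1)) m = carrier (C m)" for m
    by (rule F_top) (use r in \<open>simp add: distrib_left ee\<close>)
  have cyc_r: "cyc r p n = F p n \<inter> ker n"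
    using F_carrier[of p n] by (auto simp: cyc_iff bot ker_iff)
  \<comment> \<open>This is the same level \<open>p - e * r\<close>: one step lower, stage
    \<open>r - 1\<close> already suffices.\<close>
  have "F (p - e - e * (int r - 1)) m = {0}" for m
    using bot[of m] by (simp add: right_diff_distrib)
  then have cyc_r': "cyc (int r - 1) (p - e) n = F (p - e) n \<inter> ker n"
    using F_carrier[of "p - e" n] by (auto simp: cyc_iff ker_iff)
  interpret Q: module_quotient R "(complex_homology e C D n)\<lparr>carrier := ?\<Psi> p\<rparr>" "?\<Psi> (p - e)"
    using module_submodule_carrier[OF H_facts(1) homology_filtration_submodule]
      submodule_restrict[OF H_facts(1) homology_filtration_submodule homology_filtration_submodule
        homology_filtration_mono]
    by (simp add: module_quotient_def module_quotient_axioms_def)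
  let ?h = "\<lambda>x. ?\<Psi> (p - e) +>\<^bsub>(complex_homology e C D n)\<lparr>carrier := ?\<Psi> p\<rparr>\<^esub> coset (img n) x"
  show ?thesis
  proof (rule page_facts(7)[of _ ?h])
    show "Module.module R (quotient_module ((complex_homology e C D n)\<lparr>carrier := ?\<Psi> p\<rparr>) (?\<Psi> (p - e)))"
      by (rule Q.module_quotient_module)
    have "coset (img n) \<in> module_hom_set R ((C n)\<lparr>carrier := cyc r p n\<rparr>)
        ((complex_homology e C D n)\<lparr>carrier := ?\<Psi> p\<rparr>)"
      using F_ker_hom[of n p] unfolding cyc_r by (auto simp: module_hom_set_def homology_filtration_eq)
    then show "?h \<in> module_hom_set R ((C n)\<lparr>carrier := cyc r p n\<rparr>)
        (quotient_module ((complex_homology e C D n)\<lparr>carrier := ?\<Psi> p\<rparr>) (?\<Psi> (p - e)))"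
      by (rule module_hom_compose[OF _ Q.projection_hom])
    show "?h ` cyc r p n =
        carrier (quotient_module ((complex_homology e C D n)\<lparr>carrier := ?\<Psi> p\<rparr>) (?\<Psi> (p - e)))"
      unfolding Q.carrier_quotient by (simp add: cyc_r homology_filtration_eq image_image)
    fix x assume x: "x \<in> cyc r p n"
    then have "coset (img n) x \<in> carrier ((complex_homology e C D n)\<lparr>carrier := ?\<Psi> p\<rparr>)"
      by (auto simp: cyc_r homology_filtration_eq)
    then have "?h x = \<zero>\<^bsub>quotient_module ((complex_homology e C D n)\<lparr>carrier := ?\<Psi> p\<rparr>) (?\<Psi> (p - e))\<^esub>
        \<longleftrightarrow> coset (img n) x \<in> ?\<Psi> (p - e)"
      unfolding Q.zero_quotient by (rule Q.coset_zero)
    also have "\<dots> \<longleftrightarrow> (\<exists>y \<in> F (p - e) n \<inter> ker n. x - y \<in> img n)"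
      by (auto simp: homology_filtration_eq coset_eq_iff[OF img_submodule])
    also have "\<dots> \<longleftrightarrow> x \<in> bnd r p n"
    proof
      assume "\<exists>y \<in> F (p - e) n \<inter> ker n. x - y \<in> img n"
      then obtain y z where y: "y \<in> F (p - e) n \<inter> ker n" and z: "z \<in> carrier (C (n + e))"
        and "x - y = D z" by (auto simp: img_def)
      then have xy: "x = y + D z" by (simp add: algebra_simps)
      have "y \<in> F p n" using y F_mono by blast
      \<comment> \<open>The only condition left on \<open>z\<close> is that \<open>D z\<close>,
        which is \<open>x - y\<close>, lies in \<open>F p n\<close>.\<close>
      then have "x - y \<in> F p n" using x submodule_minus[OF F_submodule] by (simp add: cyc_iff)
      then have "z \<in> cyc (int r - 1) (p + e * (int r - 1)) (n + e)"
        using z by (simp add: cyc_iff top \<open>x - y = D z\<close>)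
      then show "x \<in> bnd r p n" unfolding bnd_iff using y xy cyc_r' by blast
    next
      assume "x \<in> bnd r p n"
      then obtain y z where y: "y \<in> F (p - e) n \<inter> ker n"
        and z: "z \<in> cyc (int r - 1) (p + e * (int r - 1)) (n + e)" and "x = y + D z"
        by (auto simp: bnd_iff cyc_r')
      then have "x - y \<in> img n" by (auto simp: cyc_iff top img_def)
      then show "\<exists>y \<in> F (p - e) n \<inter> ker n. x - y \<in> img n" using y by blast
    qed
    finally show "?h x = \<zero>\<^bsub>quotient_module ((complex_homology e C D n)\<lparr>carrier := ?\<Psi> p\<rparr>) (?\<Psi> (p - e))\<^esub>
        \<longleftrightarrow> x \<in> bnd r p n" .
  qed
qed

lemma spectral_sequence_converges:
  "ss_converges R e (ss_page e C D F) (complex_homology e C D) (homology_filtration e C D F)"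
  unfolding ss_converges_def ss_page_eq
proof (intro conjI allI)
  fix n p
  show "Module.module R (complex_homology e C D n)" by (rule H_facts(1))
  show "submodule (homology_filtration e C D F p n) R (complex_homology e C D n)"
    by (rule homology_filtration_submodule)
  show "homology_filtration e C D F (p - e) n \<subseteq> homology_filtration e C D F p n"
    by (rule homology_filtration_mono)
next
  fix n
  have "(e * p \<le> l \<longrightarrow> homology_filtration e C D F p n = {\<zero>\<^bsub>complex_homology e C D n\<^esub>}) \<and>
      (u \<le> e * p \<longrightarrow> homology_filtration e C D F p n = carrier (complex_homology e C D n))" for p
    using submodule_D(1,2)[OF ker_submodule[of n]]
    by (auto simp: homology_filtration_eq H_facts F_bot F_top coset_0)
  then show "\<exists>l u. \<forall>p. (e * p \<le> l \<longrightarrow> homology_filtration e C D F p n = {\<zero>\<^bsub>complex_homology e C D n\<^esub>}) \<and>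
      (u \<le> e * p \<longrightarrow> homology_filtration e C D F p n = carrier (complex_homology e C D n))"
    by blast
next
  fix p q
  show "\<exists>r0. \<forall>r\<ge>r0. module_iso R (page r p (p + q))
      (quotient_module
        (complex_homology e C D (p + q)\<lparr>carrier := homology_filtration e C D F p (p + q)\<rparr>)
        (homology_filtration e C D F (p - e) (p + q)))"
    by (rule exI[of _ "nat (max (e * p - l) (u - e * p + 1))"]) (auto intro!: page_limit_iso)
qed

section \<open>The first page\<close>

lemma cyc_1: "cyc 1 p n = {x \<in> F p n. D x \<in> F (p - e) (n - e)}"
  by (auto simp: cyc_iff)

text \<open>\<open>D\<close> preserves each filtration step, so stage 0 cycles are everything, and
  the first page is the homology of \<open>F p / F (p - e)\<close>.\<close>

lemma bnd_1_iff: "x \<in> bnd 1 p n \<longleftrightarrow> (\<exists>y\<in>F (p - e) n. \<exists>z\<in>F p (n + e). x = y + D z)"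
proof -
  have "cyc 0 q m = F q m" for q m using D_F by (auto simp: cyc_iff)
  then show ?thesis by (simp add: bnd_iff)
qed

end

section \<open>Based complexes\<close>

lemma type_ring_simps [simp]:
  "carrier type_ring = UNIV" "mult type_ring = (*)" "one type_ring = 1" "zero type_ring = 0"
  "add type_ring = (+)"
  by (simp_all add: type_ring_def)

lemma cring_type_ring: "cring (type_ring :: 'r::{comm_ring,monoid_mult} ring)"
proof (rule cringI)
  show "abelian_group (type_ring :: 'r ring)"
    by (rule abelian_groupI) (auto simp: algebra_simps intro: exI[of _ "- _"])
  show "Group.comm_monoid (type_ring :: 'r ring)"
    by (rule comm_monoidI) (auto simp: algebra_simps)
qed (simp add: algebra_simps)

lemma function_module_module:
  "Module.module (type_ring :: 'r::{comm_ring,monoid_mult} ring) (function_module A :: ('r, 's \<Rightarrow> 'r) module)"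
proof (rule moduleI)
  show "abelian_group (function_module A :: ('r, 's \<Rightarrow> 'r) module)"
  proof (rule abelian_groupI)
    fix x assume "x \<in> carrier (function_module A :: ('r, 's \<Rightarrow> 'r) module)"
    then show "\<exists>y\<in>carrier (function_module A). y \<oplus>\<^bsub>function_module A\<^esub> x = \<zero>\<^bsub>function_module A\<^esub>"
      by (intro bexI[of _ "\<lambda>s. - x s"]) (auto simp: function_module_def)
  qed (auto simp: function_module_def algebra_simps)
qed (auto simp: function_module_def algebra_simps cring_type_ring)

lemma function_module_simps:
  "carrier (function_module A) = {c. \<forall>x. x \<notin> A \<longrightarrow> c x = 0}" "add (function_module A) = (+)"
  "zero (function_module A) = 0" "smult (function_module A) = (\<lambda>a c x. a * c x)"
  by (simp_all add: function_module_def fun_eq_iff)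

lemma mult_zeroI: "(a \<noteq> 0 \<Longrightarrow> b \<noteq> 0 \<Longrightarrow> False) \<Longrightarrow> a * b = (0 :: 'r::mult_zero)"
  by (cases "a = 0"; cases "b = 0") auto

text \<open>
  A linear map between free modules with finite bases is given by its matrix; the entry at
  \<open>(\<sigma>, \<tau>)\<close> is the coefficient of \<open>\<tau>\<close> in the image of \<open>\<sigma>\<close>. In these terms the following says that
  \<open>H\<close> is a chain homotopy between the identity of the complex with differential \<open>J\<close> and the
  map \<open>c \<mapsto> \<phi>(c) a\<close>, with \<open>a\<close> a cycle and \<open>\<phi>\<close> a cocycle. Transposing
  all matrices just exchanges \<open>a\<close> and \<open>\<phi>\<close>, which yields cohomology for free.
\<close>

definition contraction ::
  "int \<Rightarrow> 's set \<Rightarrow> ('s \<Rightarrow> int) \<Rightarrow> ('s \<Rightarrow> 's \<Rightarrow> 'r::{comm_ring,monoid_mult}) \<Rightarrow>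
   ('s \<Rightarrow> 's \<Rightarrow> 'r) \<Rightarrow> ('s \<Rightarrow> 'r) \<Rightarrow> ('s \<Rightarrow> 'r) \<Rightarrow> bool" where
  "contraction e X deg J H a \<phi> \<longleftrightarrow>
     (\<forall>\<sigma>\<in>X. \<forall>\<tau>\<in>X. (\<Sum>\<rho>\<in>X. J \<sigma> \<rho> * H \<rho> \<tau> + H \<sigma> \<rho> * J \<rho> \<tau>) = (if \<sigma> = \<tau> then 1 else 0) - \<phi> \<sigma> * a \<tau>) \<and>
     (\<forall>\<sigma>\<in>X. \<forall>\<tau>\<in>X. H \<sigma> \<tau> \<noteq> 0 \<longrightarrow> deg \<tau> = deg \<sigma> + e) \<and>
     (\<forall>\<tau>\<in>X. (\<Sum>\<sigma>\<in>X. a \<sigma> * J \<sigma> \<tau>) = 0) \<and> (\<forall>\<sigma>\<in>X. (\<Sum>\<tau>\<in>X. J \<sigma> \<tau> * \<phi> \<tau>) = 0)"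

text \<open>Transposition swaps the two products in the homotopy formula; commutativity of the ring
  keeps the entries the same.\<close>

lemma contraction_transpose:
  assumes "contraction e X deg J H a \<phi>"
  shows "contraction (- e) X deg (\<lambda>\<sigma> \<tau>. J \<tau> \<sigma>) (\<lambda>\<sigma> \<tau>. H \<tau> \<sigma>) \<phi> a"
  unfolding contraction_def
proof (intro conjI ballI impI)
  fix \<sigma> \<tau> assume st: "\<sigma> \<in> X" "\<tau> \<in> X"
  have "(\<Sum>\<rho>\<in>X. J \<rho> \<sigma> * H \<tau> \<rho> + H \<rho> \<sigma> * J \<tau> \<rho>) = (\<Sum>\<rho>\<in>X. J \<tau> \<rho> * H \<rho> \<sigma> + H \<tau> \<rho> * J \<rho> \<sigma>)"
    by (intro sum.cong) (simp_all add: mult.commute add.commute)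
  also have "\<dots> = (if \<tau> = \<sigma> then 1 else 0) - \<phi> \<tau> * a \<sigma>"
    using assms st unfolding contraction_def by blast
  finally show "(\<Sum>\<rho>\<in>X. J \<rho> \<sigma> * H \<tau> \<rho> + H \<rho> \<sigma> * J \<tau> \<rho>) =
      (if \<sigma> = \<tau> then 1 else 0) - a \<sigma> * \<phi> \<tau>" by (auto simp: mult.commute)
  assume "H \<tau> \<sigma> \<noteq> 0"
  then have "deg \<sigma> = deg \<tau> + e" using assms st unfolding contraction_def by blast
  then show "deg \<tau> = deg \<sigma> + - e" by simp
next
  fix \<tau> assume "\<tau> \<in> X"
  then have "(\<Sum>\<sigma>\<in>X. J \<tau> \<sigma> * \<phi> \<sigma>) = 0" "(\<Sum>\<sigma>\<in>X. a \<sigma> * J \<sigma> \<tau>) = 0"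
    using assms unfolding contraction_def by blast+
  then show "(\<Sum>\<sigma>\<in>X. \<phi> \<sigma> * J \<tau> \<sigma>) = 0" "(\<Sum>\<sigma>\<in>X. J \<sigma> \<tau> * a \<sigma>) = 0"
    by (simp_all add: mult.commute)
qed

text \<open>Each filtration step is spanned by a part \<open>Y p\<close> of one basis
  \<open>A\<close>. Chains use the incidence matrix and the cells inside a step; cochains use its
  transpose and the cells outside.\<close>

locale based_filtration =
  fixes e :: int and A :: "'s set" and deg :: "'s \<Rightarrow> int"
    and J :: "'s \<Rightarrow> 's \<Rightarrow> 'r::{comm_ring,monoid_mult}" and Y :: "int \<Rightarrow> 's set" and l u :: int
  assumes e: "e = 1 \<or> e = - 1" and finite_A: "finite A"
    and J_deg: "\<lbrakk>\<sigma> \<in> A; \<tau> \<in> A; J \<sigma> \<tau> \<noteq> 0\<rbrakk> \<Longrightarrow> deg \<tau> = deg \<sigma> - e"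
    and J_J: "\<lbrakk>\<sigma> \<in> A; \<tau> \<in> A\<rbrakk> \<Longrightarrow> (\<Sum>\<rho>\<in>A. J \<sigma> \<rho> * J \<rho> \<tau>) = 0"
    and Y_subset: "Y p \<subseteq> A" and Y_mono: "Y (p - e) \<subseteq> Y p"
    and Y_closed: "\<lbrakk>\<sigma> \<in> Y p; \<tau> \<in> A; J \<sigma> \<tau> \<noteq> 0\<rbrakk> \<Longrightarrow> \<tau> \<in> Y p"
    and Y_bot: "e * p \<le> l \<Longrightarrow> Y p = {}" and Y_top: "u \<le> e * p \<Longrightarrow> Y p = A"
begin

definition chains :: "int \<Rightarrow> ('r, 's \<Rightarrow> 'r) module" where
  "chains n = function_module {\<sigma> \<in> A. deg \<sigma> = n}"

definition differential :: "('s \<Rightarrow> 'r) \<Rightarrow> 's \<Rightarrow> 'r" where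
  "differential c \<tau> = (if \<tau> \<in> A then \<Sum>\<sigma>\<in>A. J \<sigma> \<tau> * c \<sigma> else 0)"

definition filtration :: "int \<Rightarrow> int \<Rightarrow> ('s \<Rightarrow> 'r) set" where
  "filtration p n = {c \<in> carrier (chains n). \<forall>\<sigma>\<in>A. \<sigma> \<notin> Y p \<longrightarrow> c \<sigma> = 0}"

lemma chains_iff: "c \<in> carrier (chains n) \<longleftrightarrow> (\<forall>\<sigma>. c \<sigma> \<noteq> 0 \<longrightarrow> \<sigma> \<in> A \<and> deg \<sigma> = n)"
  by (auto simp: chains_def function_module_simps)

lemma filtration_iff: "c \<in> filtration p n \<longleftrightarrow> (\<forall>\<sigma>. c \<sigma> \<noteq> 0 \<longrightarrow> \<sigma> \<in> Y p \<and> deg \<sigma> = n)"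
  using Y_subset[of p] by (auto simp: filtration_def chains_iff)

lemma differential_nonzero:
  assumes "differential c \<tau> \<noteq> 0"
  obtains \<sigma> where "\<tau> \<in> A" "\<sigma> \<in> A" "J \<sigma> \<tau> \<noteq> 0" "c \<sigma> \<noteq> 0"
proof -
  have "\<tau> \<in> A" using assms by (auto simp: differential_def split: if_splits)
  with assms have "(\<Sum>\<sigma>\<in>A. J \<sigma> \<tau> * c \<sigma>) \<noteq> 0" by (simp add: differential_def)
  then obtain \<sigma> where "\<sigma> \<in> A" "J \<sigma> \<tau> * c \<sigma> \<noteq> 0" by (rule sum.not_neutral_contains_not_neutral)
  then have "J \<sigma> \<tau> \<noteq> 0" "c \<sigma> \<noteq> 0" by auto
  then show ?thesis using that \<open>\<tau> \<in> A\<close> \<open>\<sigma> \<in> A\<close> by blast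
qed

sublocale filtered_complex "type_ring :: 'r ring" "\<lambda>a c x. a * c x" chains differential filtration e l u
proof (rule filtered_complex.intro)
  show "e = 1 \<or> e = - 1" by (rule e)
  fix n p :: int and x y :: "'s \<Rightarrow> 'r" and a :: 'r
  show "Module.module (type_ring :: 'r ring) (chains n)"
    unfolding chains_def by (rule function_module_module)
  show "add (chains n) = (+)"
    by (simp add: chains_def function_module_simps)
  show "zero (chains n) = 0"
    by (simp add: chains_def function_module_simps)
  show "smult (chains n) = (\<lambda>a c x. a * c x)"
    by (simp add: chains_def function_module_simps)
  show "differential (x + y) = differential x + differential y"
    by (auto simp: fun_eq_iff differential_def algebra_simps sum.distrib)
  show "differential (\<lambda>s. a * x s) = (\<lambda>s. a * differential x s)"
    by (auto simp: fun_eq_iff differential_def sum_distrib_left mult.left_commute)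
  show "differential x \<in> carrier (chains (n - e))" if x: "x \<in> carrier (chains n)"
    unfolding chains_iff
  proof (intro allI impI)
    fix \<tau> assume "differential x \<tau> \<noteq> 0"
    then obtain \<sigma> where "\<tau> \<in> A" "\<sigma> \<in> A" "J \<sigma> \<tau> \<noteq> 0" "x \<sigma> \<noteq> 0" by (rule differential_nonzero)
    then show "\<tau> \<in> A \<and> deg \<tau> = n - e" using J_deg x by (auto simp: chains_iff)
  qed
  show "differential (differential x) = 0"
  proof
    fix \<tau>
    have "(\<Sum>\<rho>\<in>A. J \<rho> \<tau> * (\<Sum>\<sigma>\<in>A. J \<sigma> \<rho> * x \<sigma>)) = (\<Sum>\<sigma>\<in>A. (\<Sum>\<rho>\<in>A. J \<sigma> \<rho> * J \<rho> \<tau>) * x \<sigma>)"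
      unfolding sum_distrib_left sum_distrib_right
      by (subst sum.swap) (simp add: mult.assoc mult.left_commute)
    also have "\<dots> = 0" if "\<tau> \<in> A" using that J_J by simp
    finally show "differential (differential x) \<tau> = 0 \<tau>" by (simp add: differential_def)
  qed
  show "submodule (filtration p n) type_ring (chains n)"
    unfolding submodule_iff[OF \<open>Module.module type_ring (chains n)\<close>]
    by (auto simp: filtration_def chains_def function_module_simps)
  show "filtration (p - e) n \<subseteq> filtration p n" 
    using Y_mono[of p] unfolding subset_iff filtration_iff by blast
  show "differential x \<in> filtration p (n - e)" if x: "x \<in> filtration p n"
    unfolding filtration_iff
  proof (intro allI impI)
    fix \<tau> assume "differential x \<tau> \<noteq> 0"
    then obtain \<sigma> where "\<tau> \<in> A" "\<sigma> \<in> A" "J \<sigma> \<tau> \<noteq> 0" "x \<sigma> \<noteq> 0" by (rule differential_nonzero)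
    then show "\<tau> \<in> Y p \<and> deg \<tau> = n - e" using J_deg Y_closed x by (auto simp: filtration_iff)
  qed
  show "filtration p n = {0}" if "e * p \<le> l"
    using Y_bot[OF that] by (auto simp: filtration_iff)
  show "filtration p n = carrier (chains n)" if "u \<le> e * p"
    by (simp add: filtration_def Y_top[OF that])
qed

text \<open>A cell of the lower step has no \<open>\<tau>\<close> outside that step in its
  differential. Modulo the lower step, the differential is thus given by the submatrix of the
  stratum.\<close>

lemma differential_stratum:
  assumes "c \<in> filtration p n" "\<tau> \<in> Y p - Y (p - e)"
  shows "differential c \<tau> = (\<Sum>\<sigma>\<in>Y p - Y (p - e). J \<sigma> \<tau> * c \<sigma>)"
proof -
  have "\<tau> \<in> A" using assms Y_subset by blast
  then have "(\<Sum>\<sigma>\<in>A. J \<sigma> \<tau> * c \<sigma>) = (\<Sum>\<sigma>\<in>Y p - Y (p - e). J \<sigma> \<tau> * c \<sigma>)"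
    using assms Y_subset[of p] Y_closed[of _ "p - e" \<tau>]
    by (intro sum.mono_neutral_right finite_A) (auto simp: filtration_iff dest!: mult_not_zero)
  then show ?thesis using \<open>\<tau> \<in> A\<close> by (simp add: differential_def)
qed

text \<open>An intermediate cell with nonzero contribution lies in \<open>Y p\<close> because
  \<open>\<sigma>\<close> does, and outside \<open>Y (p - e)\<close> because \<open>\<tau>\<close>
  does.\<close>

lemma J_J_stratum:
  assumes "\<sigma> \<in> Y p - Y (p - e)" "\<tau> \<in> Y p - Y (p - e)"
  shows "(\<Sum>\<rho>\<in>Y p - Y (p - e). J \<sigma> \<rho> * J \<rho> \<tau>) = 0"
proof -
  have A: "\<sigma> \<in> A" "\<tau> \<in> A" using assms Y_subset by blast+
  have "(\<Sum>\<rho>\<in>Y p - Y (p - e). J \<sigma> \<rho> * J \<rho> \<tau>) = (\<Sum>\<rho>\<in>A. J \<sigma> \<rho> * J \<rho> \<tau>)"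
    using assms A Y_subset[of p] Y_closed[of _ "p - e" \<tau>] Y_closed[of \<sigma> p]
    by (intro sum.mono_neutral_left finite_A) (auto dest!: mult_not_zero)
  then show ?thesis using J_J[OF A] by simp
qed

section \<open>The first page of a contracted stratum\<close>

context
  fixes p :: int and X H a \<phi>
  assumes X: "X = Y p - Y (p - e)" and contr: "contraction e X deg J H a \<phi>"
begin

lemma finite_X: "finite X"
  unfolding X using Y_subset finite_A by (meson Diff_subset finite_subset order_trans)

text \<open>Apply the homotopy to \<open>x\<close>. As the differential of \<open>x\<close> vanishes
  on the stratum, \<open>x\<close> minus its multiple of \<open>a\<close> agrees there with the
  differential of \<open>H x\<close>, and the rest lies in the lower step. The degree condition
  concerns only nonzero multiples of \<open>a\<close>, so the case of coefficient zero is covered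
  too.\<close>

lemma contract_cycle:
  assumes x: "x \<in> ss_cycles e differential filtration 1 p n"
    and a: "\<And>\<sigma>. \<sigma> \<in> X \<Longrightarrow> (\<Sum>\<sigma>\<in>X. \<phi> \<sigma> * x \<sigma>) * a \<sigma> \<noteq> 0 \<Longrightarrow> deg \<sigma> = n"
  shows "x - (\<lambda>\<tau>. (\<Sum>\<sigma>\<in>X. \<phi> \<sigma> * x \<sigma>) * (if \<tau> \<in> X then a \<tau> else 0)) \<in>
    ss_boundaries e chains differential filtration 1 p n"
proof -
  let ?s = "\<Sum>\<sigma>\<in>X. \<phi> \<sigma> * x \<sigma>"
  define z where "z \<rho> = (if \<rho> \<in> X then \<Sum>\<sigma>\<in>X. H \<sigma> \<rho> * x \<sigma> else 0)" for \<rho>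
  define y where "y = x - (\<lambda>\<tau>. ?s * (if \<tau> \<in> X then a \<tau> else 0)) - differential z"
  have xF: "x \<in> filtration p n" and Dx: "differential x \<in> filtration (p - e) (n - e)"
    using x by (auto simp: cyc_1)
  have "z \<in> filtration p (n + e)"
    unfolding filtration_iff
  proof (intro allI impI)
    fix \<rho> assume "z \<rho> \<noteq> 0"
    then have "\<rho> \<in> X" "(\<Sum>\<sigma>\<in>X. H \<sigma> \<rho> * x \<sigma>) \<noteq> 0" by (auto simp: z_def split: if_splits)
    then obtain \<sigma> where "\<sigma> \<in> X" "H \<sigma> \<rho> * x \<sigma> \<noteq> 0" by (meson sum.not_neutral_contains_not_neutral)
    then have "deg \<rho> = deg \<sigma> + e" "deg \<sigma> = n"
      using contr \<open>\<rho> \<in> X\<close> xF unfolding contraction_def filtration_iff by (metis mult_zero_left mult_zero_right)+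
    then show "\<rho> \<in> Y p \<and> deg \<rho> = n + e" using \<open>\<rho> \<in> X\<close> X by auto
  qed
  moreover have "y \<in> filtration (p - e) n"
  proof -
    have "y \<tau> = 0" if \<tau>: "\<tau> \<in> X" for \<tau>
    proof -
      \<comment> \<open>With rows as sources, this half of the formula is \<open>H\<close> applied
        to the differential of \<open>x\<close>.\<close>
      have "(\<Sum>\<rho>\<in>X. \<Sum>\<sigma>\<in>X. J \<sigma> \<rho> * H \<rho> \<tau> * x \<sigma>) = (\<Sum>\<rho>\<in>X. H \<rho> \<tau> * (\<Sum>\<sigma>\<in>X. J \<sigma> \<rho> * x \<sigma>))"
        by (simp add: sum_distrib_left mult.left_commute mult.assoc)
      also have "\<dots> = (\<Sum>\<rho>\<in>X. H \<rho> \<tau> * differential x \<rho>)"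
        using differential_stratum[OF xF] X by simp
      also have "\<dots> = 0"
        using Dx X by (intro sum.neutral ballI mult_zeroI) (auto simp: filtration_iff)
      finally have 1: "(\<Sum>\<rho>\<in>X. \<Sum>\<sigma>\<in>X. J \<sigma> \<rho> * H \<rho> \<tau> * x \<sigma>) = 0" .
      have "differential z \<tau> = (\<Sum>\<rho>\<in>X. \<Sum>\<sigma>\<in>X. H \<sigma> \<rho> * J \<rho> \<tau> * x \<sigma>)"
        using differential_stratum[OF \<open>z \<in> filtration p (n + e)\<close>] \<tau> X
        by (simp add: z_def sum_distrib_left mult.left_commute mult.assoc)
      also have "\<dots> = (\<Sum>\<rho>\<in>X. \<Sum>\<sigma>\<in>X. (J \<sigma> \<rho> * H \<rho> \<tau> + H \<sigma> \<rho> * J \<rho> \<tau>) * x \<sigma>)"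
        using 1 by (simp add: distrib_right sum.distrib)
      also have "\<dots> = (\<Sum>\<sigma>\<in>X. (\<Sum>\<rho>\<in>X. J \<sigma> \<rho> * H \<rho> \<tau> + H \<sigma> \<rho> * J \<rho> \<tau>) * x \<sigma>)"
        by (subst sum.swap) (simp add: sum_distrib_right)
      also have "\<dots> = (\<Sum>\<sigma>\<in>X. ((if \<sigma> = \<tau> then 1 else 0) - \<phi> \<sigma> * a \<tau>) * x \<sigma>)"
        using contr \<tau> unfolding contraction_def by (intro sum.cong) auto
      also have "\<dots> = (\<Sum>\<sigma>\<in>X. (if \<sigma> = \<tau> then x \<sigma> else 0) - \<phi> \<sigma> * x \<sigma> * a \<tau>)"
        by (intro sum.cong) (auto simp: algebra_simps)
      also have "\<dots> = x \<tau> - ?s * a \<tau>"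
        using \<tau> finite_X by (simp add: sum_subtractf sum_distrib_right)
      finally show ?thesis using \<tau> by (simp add: y_def)
    qed
    moreover have "y \<in> filtration p n"
    proof -
      have "(\<lambda>\<tau>. ?s * (if \<tau> \<in> X then a \<tau> else 0)) \<in> filtration p n"
        using a X by (auto simp: filtration_iff split: if_splits)
      then show ?thesis
        unfolding y_def using xF D_F[OF \<open>z \<in> filtration p (n + e)\<close>]
        by (intro submodule_minus[OF F_submodule]) auto
    qed
    ultimately show ?thesis using X by (auto simp: filtration_iff)
  qed
  ultimately show ?thesis
    unfolding bnd_1_iff by (intro bexI[of _ y] bexI[of _ z]) (auto simp: y_def)
qed

lemma page_1_free_empty:
  assumes "\<And>\<sigma>. \<sigma> \<in> X \<Longrightarrow> deg \<sigma> = n \<Longrightarrow> \<phi> \<sigma> = 0"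
  shows "free_on type_ring (page 1 p n) {}"
proof -
  have "x \<in> ss_boundaries e chains differential filtration 1 p n"
    if x: "x \<in> ss_cycles e differential filtration 1 p n" for x
  proof -
    have "(\<Sum>\<sigma>\<in>X. \<phi> \<sigma> * x \<sigma>) = 0"
      using x assms by (intro sum.neutral ballI mult_zeroI) (auto simp: cyc_1 filtration_iff)
    then show ?thesis using contract_cycle[OF x] by (simp flip: zero_fun_def)
  qed
  then show ?thesis
    unfolding page_def by (intro quot_free_empty cyc_submodule bnd_submodule bnd_subset_cyc) auto
qed

text \<open>The class of \<open>a\<close>, extended by zero, generates by
  \<open>contract_cycle\<close>. Its coefficient is unique because \<open>\<phi>\<close> kills
  boundaries of the stratum and takes the value 1 on \<open>a\<close>.\<close>

lemma page_1_free_singleton: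
  assumes a: "\<And>\<sigma>. \<sigma> \<in> X \<Longrightarrow> a \<sigma> \<noteq> 0 \<Longrightarrow> deg \<sigma> = n"
    and unit: "(\<Sum>\<sigma>\<in>X. a \<sigma> * \<phi> \<sigma>) = 1"
  shows "free_on type_ring (page 1 p n) {i}"
proof -
  let ?cyc = "ss_cycles e differential filtration 1 p n"
  let ?bnd = "ss_boundaries e chains differential filtration 1 p n"
  define g where "g \<tau> = (if \<tau> \<in> X then a \<tau> else 0)" for \<tau>
  have gF: "g \<in> filtration p n" using a X by (auto simp: g_def filtration_iff)
  have "differential g \<tau> = 0" if "\<tau> \<in> X" for \<tau>
    using differential_stratum[OF gF] that X contr unfolding contraction_def
    by (simp add: g_def mult.commute)
  then have g: "g \<in> ?cyc" using gF D_F[OF gF] X by (auto simp: cyc_1 filtration_iff)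
  have uniq: "s = t" if "x - (\<lambda>\<tau>. s * g \<tau>) \<in> ?bnd" "x - (\<lambda>\<tau>. t * g \<tau>) \<in> ?bnd" for x s t
  proof -
    have "(x - (\<lambda>\<tau>. t * g \<tau>)) - (x - (\<lambda>\<tau>. s * g \<tau>)) \<in> ?bnd"
      by (rule submodule_minus[OF bnd_submodule that(2,1)])
    moreover have "(x - (\<lambda>\<tau>. t * g \<tau>)) - (x - (\<lambda>\<tau>. s * g \<tau>)) = (\<lambda>\<tau>. (s - t) * g \<tau>)"
      by (simp add: fun_eq_iff algebra_simps)
    ultimately obtain y z where y: "y \<in> filtration (p - e) n" and z: "z \<in> filtration p (n + e)"
      and st: "(\<lambda>\<tau>. (s - t) * g \<tau>) = y + differential z" by (auto simp: bnd_1_iff)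
    have "(s - t) * a \<tau> = (\<Sum>\<sigma>\<in>X. J \<sigma> \<tau> * z \<sigma>)" if "\<tau> \<in> X" for \<tau>
    proof -
      have "y \<tau> = 0" using y that X by (auto simp: filtration_iff)
      then show ?thesis
        using fun_cong[OF st, of \<tau>] differential_stratum[OF z] that X by (simp add: g_def)
    qed
    then have "(\<Sum>\<tau>\<in>X. (s - t) * a \<tau> * \<phi> \<tau>) = (\<Sum>\<tau>\<in>X. (\<Sum>\<sigma>\<in>X. J \<sigma> \<tau> * z \<sigma>) * \<phi> \<tau>)" by simp
    also have "\<dots> = (\<Sum>\<sigma>\<in>X. z \<sigma> * (\<Sum>\<tau>\<in>X. J \<sigma> \<tau> * \<phi> \<tau>))"
      unfolding sum_distrib_left sum_distrib_right
      by (subst sum.swap) (simp add: mult.assoc mult.left_commute mult.commute)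
    also have "\<dots> = 0" using contr unfolding contraction_def by simp
    finally have "(s - t) * (\<Sum>\<tau>\<in>X. a \<tau> * \<phi> \<tau>) = 0" by (simp add: sum_distrib_left mult.assoc)
    then show "s = t" using unit by simp
  qed
  have "\<exists>!s. s \<in> carrier type_ring \<and> x - (\<lambda>\<tau>. s * g \<tau>) \<in> ?bnd" if x: "x \<in> ?cyc" for x
  proof (rule ex1I)
    have "deg \<sigma> = n" if "\<sigma> \<in> X" "(\<Sum>\<sigma>\<in>X. \<phi> \<sigma> * x \<sigma>) * a \<sigma> \<noteq> 0" for \<sigma>
      using a[of \<sigma>] that mult_not_zero by blast
    from contract_cycle[OF x this]
    show "(\<Sum>\<sigma>\<in>X. \<phi> \<sigma> * x \<sigma>) \<in> carrier type_ring \<and>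
        x - (\<lambda>\<tau>. (\<Sum>\<sigma>\<in>X. \<phi> \<sigma> * x \<sigma>) * g \<tau>) \<in> ?bnd" by (simp add: g_def)
    fix s assume "s \<in> carrier type_ring \<and> x - (\<lambda>\<tau>. s * g \<tau>) \<in> ?bnd"
    then show "s = (\<Sum>\<sigma>\<in>X. \<phi> \<sigma> * x \<sigma>)"
      using uniq \<open>(\<Sum>\<sigma>\<in>X. \<phi> \<sigma> * x \<sigma>) \<in> carrier type_ring \<and> _\<close> by blast
  qed
  then show ?thesis
    unfolding page_def
    by (intro quot_free_singleton[of _ _ _ g] cyc_submodule bnd_submodule bnd_subset_cyc)
      (use g in auto)
qed

end

end

text \<open>\<open>U\<close> holds the upper cells, and \<open>m\<close> pairs every lower cell with
  an upper one. By \<open>uniq\<close> the submatrix of \<open>J\<close> from upper to lower cells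
  is, up to signs, a partial permutation matrix, so it is inverted entry by entry. The only cell
  that can stay unpaired is \<open>c\<close>, a cycle by assumption.\<close>

lemma matching_contraction:
  fixes J :: "'s \<Rightarrow> 's \<Rightarrow> 'r::{comm_ring,monoid_mult}" and deg :: "'s \<Rightarrow> int"
  assumes fin: "finite X"
    and JJ: "\<And>\<sigma> \<tau>. \<sigma> \<in> X \<Longrightarrow> \<tau> \<in> X \<Longrightarrow> (\<Sum>\<rho>\<in>X. J \<sigma> \<rho> * J \<rho> \<tau>) = 0"
    and J_deg: "\<And>\<sigma> \<tau>. \<sigma> \<in> X \<Longrightarrow> \<tau> \<in> X \<Longrightarrow> J \<sigma> \<tau> \<noteq> 0 \<Longrightarrow> deg \<tau> = deg \<sigma> - 1"
    and U: "U \<subseteq> X" and m: "\<And>\<sigma>. \<sigma> \<in> X - U \<Longrightarrow> m \<sigma> \<in> U" and inj: "inj_on m (X - U)"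
    and unit: "\<And>\<sigma>. \<sigma> \<in> X - U \<Longrightarrow> J (m \<sigma>) \<sigma> * J (m \<sigma>) \<sigma> = 1"
    and m_deg: "\<And>\<sigma>. \<sigma> \<in> X - U \<Longrightarrow> deg (m \<sigma>) = deg \<sigma> + 1"
    and uniq: "\<And>\<sigma> \<rho>. \<sigma> \<in> X - U \<Longrightarrow> \<rho> \<in> U \<Longrightarrow> J \<rho> \<sigma> \<noteq> 0 \<Longrightarrow> \<rho> = m \<sigma>"
    and crit: "U - m ` (X - U) \<subseteq> {c}"
    and c: "\<And>\<tau>. c \<in> U - m ` (X - U) \<Longrightarrow> \<tau> \<in> X \<Longrightarrow> J c \<tau> = 0"
  shows "\<exists>H a \<phi>. contraction 1 X deg J H a \<phi> \<and>
    (if c \<in> U - m ` (X - U)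
     then (\<forall>\<sigma>\<in>X. (a \<sigma> \<noteq> 0 \<longrightarrow> deg \<sigma> = deg c) \<and> (\<phi> \<sigma> \<noteq> 0 \<longrightarrow> deg \<sigma> = deg c)) \<and>
       (\<Sum>\<sigma>\<in>X. a \<sigma> * \<phi> \<sigma>) = 1
     else \<forall>\<sigma>\<in>X. a \<sigma> = 0 \<and> \<phi> \<sigma> = 0)"
proof -
  \<comment> \<open>By \<open>unit\<close> the entry \<open>J (m \<sigma>) \<sigma>\<close> is its
    own inverse, so \<open>\<sigma>\<close> has coefficient 1 in the differential of its
    image.\<close>
  define H where "H \<sigma> \<tau> = (if \<sigma> \<in> X - U \<and> \<tau> = m \<sigma> then J \<tau> \<sigma> else 0)" for \<sigma> \<tau>
  define P where "P \<sigma> \<tau> = (\<Sum>\<rho>\<in>X. J \<sigma> \<rho> * H \<rho> \<tau> + H \<sigma> \<rho> * J \<rho> \<tau>) - (if \<sigma> = \<tau> then 1 else 0)" for \<sigma> \<tau>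
  have H_deg: "deg \<tau> = deg \<sigma> + 1" if "H \<sigma> \<tau> \<noteq> 0" for \<sigma> \<tau>
    using that m_deg by (auto simp: H_def split: if_splits)
  \<comment> \<open>\<open>P\<close> is a chain map: as \<open>J\<close> squares to zero, both sides
    reduce to \<open>J H J - J\<close>.\<close>
  have comm: "(\<Sum>\<rho>\<in>X. J \<sigma> \<rho> * P \<rho> \<tau>) = (\<Sum>\<rho>\<in>X. P \<sigma> \<rho> * J \<rho> \<tau>)" if st: "\<sigma> \<in> X" "\<tau> \<in> X" for \<sigma> \<tau>
  proof -
    have 1: "(\<Sum>\<rho>\<in>X. \<Sum>\<kappa>\<in>X. J \<sigma> \<rho> * (J \<rho> \<kappa> * H \<kappa> \<tau>)) = 0"
    proof -
      have "(\<Sum>\<rho>\<in>X. \<Sum>\<kappa>\<in>X. J \<sigma> \<rho> * (J \<rho> \<kappa> * H \<kappa> \<tau>)) = (\<Sum>\<kappa>\<in>X. (\<Sum>\<rho>\<in>X. J \<sigma> \<rho> * J \<rho> \<kappa>) * H \<kappa> \<tau>)"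
        by (subst sum.swap) (simp add: sum_distrib_right mult.assoc)
      then show ?thesis using JJ st by simp
    qed
    have 2: "(\<Sum>\<rho>\<in>X. \<Sum>\<kappa>\<in>X. H \<sigma> \<kappa> * J \<kappa> \<rho> * J \<rho> \<tau>) = 0"
    proof -
      have "(\<Sum>\<rho>\<in>X. \<Sum>\<kappa>\<in>X. H \<sigma> \<kappa> * J \<kappa> \<rho> * J \<rho> \<tau>) = (\<Sum>\<kappa>\<in>X. H \<sigma> \<kappa> * (\<Sum>\<rho>\<in>X. J \<kappa> \<rho> * J \<rho> \<tau>))"
        by (subst sum.swap) (simp add: sum_distrib_left mult.assoc)
      then show ?thesis using JJ st by simp
    qed
    have "J \<sigma> \<rho> * P \<rho> \<tau> = (\<Sum>\<kappa>\<in>X. J \<sigma> \<rho> * (J \<rho> \<kappa> * H \<kappa> \<tau>)) +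
        (\<Sum>\<kappa>\<in>X. J \<sigma> \<rho> * (H \<rho> \<kappa> * J \<kappa> \<tau>)) - (if \<rho> = \<tau> then J \<sigma> \<rho> else 0)" for \<rho>
      by (simp add: P_def right_diff_distrib sum_distrib_left distrib_left sum.distrib)
    then have "(\<Sum>\<rho>\<in>X. J \<sigma> \<rho> * P \<rho> \<tau>) =
        (\<Sum>\<rho>\<in>X. \<Sum>\<kappa>\<in>X. J \<sigma> \<rho> * (H \<rho> \<kappa> * J \<kappa> \<tau>)) - J \<sigma> \<tau>"
      using 1 fin st by (simp add: sum.distrib sum_subtractf)
    also have "(\<Sum>\<rho>\<in>X. \<Sum>\<kappa>\<in>X. J \<sigma> \<rho> * (H \<rho> \<kappa> * J \<kappa> \<tau>)) =
        (\<Sum>\<rho>\<in>X. \<Sum>\<kappa>\<in>X. J \<sigma> \<kappa> * H \<kappa> \<rho> * J \<rho> \<tau>)"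
      by (subst sum.swap) (simp add: mult.assoc)
    also have "\<dots> - J \<sigma> \<tau> = (\<Sum>\<rho>\<in>X. P \<sigma> \<rho> * J \<rho> \<tau>)"
    proof -
      have "P \<sigma> \<rho> * J \<rho> \<tau> = (\<Sum>\<kappa>\<in>X. J \<sigma> \<kappa> * H \<kappa> \<rho> * J \<rho> \<tau>) +
          (\<Sum>\<kappa>\<in>X. H \<sigma> \<kappa> * J \<kappa> \<rho> * J \<rho> \<tau>) - (if \<sigma> = \<rho> then J \<rho> \<tau> else 0)" for \<rho>
        by (simp add: P_def left_diff_distrib sum_distrib_right distrib_right sum.distrib)
      then show ?thesis using 2 fin st by (simp add: sum.distrib sum_subtractf)
    qed
    finally show ?thesis .
  qed
  \<comment> \<open>\<open>H\<close> takes values in upper cells, so only \<open>H\<close> followed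
    by \<open>J\<close> reaches a lower cell, where it is the identity on lower cells and zero on
    upper ones.\<close>
  have P_down: "P \<sigma> \<tau> = 0" if "\<sigma> \<in> X" "\<tau> \<in> X - U" for \<sigma> \<tau>
  proof -
    have "(\<Sum>\<rho>\<in>X. J \<sigma> \<rho> * H \<rho> \<tau> + H \<sigma> \<rho> * J \<rho> \<tau>) = (\<Sum>\<rho>\<in>X. if \<rho> = m \<tau> \<and> \<sigma> = \<tau> then 1 else 0)"
    proof (rule sum.cong)
      fix \<rho> assume "\<rho> \<in> X"
      have "J \<sigma> \<rho> * H \<rho> \<tau> = 0" using m that by (auto simp: H_def)
      moreover have "H \<sigma> \<rho> * J \<rho> \<tau> = (if \<rho> = m \<tau> \<and> \<sigma> = \<tau> then 1 else 0)"
      proof (cases "\<sigma> \<in> X - U \<and> \<rho> = m \<sigma>")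
        case True
        then show ?thesis
          using unit[of \<tau>] uniq[of \<tau> \<rho>] m[of \<sigma>] inj_onD[OF inj, of \<sigma> \<tau>] that
          by (cases "J \<rho> \<tau> = 0") (auto simp: H_def)
      qed (use that in \<open>auto simp: H_def\<close>)
      ultimately show "J \<sigma> \<rho> * H \<rho> \<tau> + H \<sigma> \<rho> * J \<rho> \<tau> = (if \<rho> = m \<tau> \<and> \<sigma> = \<tau> then 1 else 0)" by simp
    qed simp
    also have "\<dots> = (if \<sigma> = \<tau> then 1 else 0)"
      using m[of \<tau>] U that fin by (auto simp: sum.delta)
    finally show ?thesis by (simp add: P_def)
  qed
  \<comment> \<open>Evaluate \<open>comm\<close> at the lower cell \<open>\<tau>\<close>: by
    \<open>P_down\<close> one side vanishes, and on the other only \<open>\<rho> = m \<tau>\<close>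
    survives, with an invertible factor.\<close>
  have P_up: "P \<sigma> (m \<tau>) = 0" if "\<sigma> \<in> X" "\<tau> \<in> X - U" for \<sigma> \<tau>
  proof -
    have mt: "m \<tau> \<in> X" using m U that by blast
    have "(\<Sum>\<rho>\<in>X. P \<sigma> \<rho> * J \<rho> \<tau>) = (\<Sum>\<rho>\<in>{m \<tau>}. P \<sigma> \<rho> * J \<rho> \<tau>)"
      using mt P_down[of \<sigma>] uniq that by (intro sum.mono_neutral_right fin) fastforce+
    moreover have "(\<Sum>\<rho>\<in>X. J \<sigma> \<rho> * P \<rho> \<tau>) = 0" using P_down that by simp
    ultimately have "P \<sigma> (m \<tau>) * J (m \<tau>) \<tau> = 0" using comm[of \<sigma> \<tau>] that by simp
    then have "P \<sigma> (m \<tau>) * (J (m \<tau>) \<tau> * J (m \<tau>) \<tau>) = 0" by (simp flip: mult.assoc)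
    then show ?thesis using unit that by simp
  qed
  have P_0: "P \<sigma> \<tau> = 0" if "\<sigma> \<in> X" "\<tau> \<in> X" "\<not> (\<tau> = c \<and> c \<in> U - m ` (X - U))" for \<sigma> \<tau>
    using P_down[of \<sigma> \<tau>] P_up[of \<sigma>] that crit by blast
  have eq: "(\<Sum>\<rho>\<in>X. J \<sigma> \<rho> * H \<rho> \<tau> + H \<sigma> \<rho> * J \<rho> \<tau>) = (if \<sigma> = \<tau> then 1 else 0) + P \<sigma> \<tau>" for \<sigma> \<tau>
    by (simp add: P_def)
  show ?thesis
  proof (cases "c \<in> U - m ` (X - U)")
    case False
    then have "contraction 1 X deg J H (\<lambda>_. 0) (\<lambda>_. 0)"
      unfolding contraction_def eq using P_0 H_deg by auto
    then show ?thesis using False by (intro exI[of _ H] exI[of _ "\<lambda>_. 0"]) auto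
  next
    case True
    then have cX: "c \<in> X" and cU: "c \<in> U" using U by auto
    let ?a = "\<lambda>\<tau>. if \<tau> = c then 1 else 0 :: 'r"
    \<comment> \<open>Only the column of \<open>c\<close> in \<open>P\<close> is left. It factors
      through the indicator of \<open>c\<close>, and \<open>comm\<close> makes it a cocycle.\<close>
    let ?\<phi> = "\<lambda>\<sigma>. - P \<sigma> c"
    have Jc: "J c \<tau> = 0" if "\<tau> \<in> X" for \<tau> using c[OF True that] .
    have contr: "contraction 1 X deg J H ?a ?\<phi>"
      unfolding contraction_def eq
    proof (intro conjI ballI impI)
      fix \<sigma> \<tau> assume st: "\<sigma> \<in> X" "\<tau> \<in> X"
      then show "(if \<sigma> = \<tau> then 1 else 0) + P \<sigma> \<tau> = (if \<sigma> = \<tau> then 1 else 0) - - P \<sigma> c * ?a \<tau>"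
        using P_0[of \<sigma> \<tau>] by auto
    next
      fix \<sigma> \<tau> assume "H \<sigma> \<tau> \<noteq> 0"
      then show "deg \<tau> = deg \<sigma> + 1" by (rule H_deg)
    next
      fix \<tau> assume "\<tau> \<in> X"
      then show "(\<Sum>\<sigma>\<in>X. ?a \<sigma> * J \<sigma> \<tau>) = 0" using Jc by (intro sum.neutral) auto
    next
      fix \<sigma> assume s: "\<sigma> \<in> X"
      have "(\<Sum>\<tau>\<in>X. J \<sigma> \<tau> * P \<tau> c) = (\<Sum>\<tau>\<in>X. P \<sigma> \<tau> * J \<tau> c)" using comm s cX by simp
      also have "\<dots> = 0"
      proof (rule sum.neutral, rule ballI)
        fix \<tau> assume "\<tau> \<in> X"
        then show "P \<sigma> \<tau> * J \<tau> c = 0" using P_0[OF s, of \<tau>] Jc[OF cX] by (cases "\<tau> = c") auto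
      qed
      finally show "(\<Sum>\<tau>\<in>X. J \<sigma> \<tau> * - P \<tau> c) = 0" by (simp add: sum_negf)
    qed
    have "P c c = - 1"
    proof -
      have "J c \<rho> * H \<rho> c + H c \<rho> * J \<rho> c = 0" if "\<rho> \<in> X" for \<rho>
        using Jc[OF that] cU by (simp add: H_def)
      then show ?thesis by (simp add: P_def)
    qed
    moreover have "(\<Sum>\<sigma>\<in>X. ?a \<sigma> * ?\<phi> \<sigma>) = (\<Sum>\<sigma>\<in>X. if \<sigma> = c then ?\<phi> \<sigma> else 0)"
      by (intro sum.cong) auto
    ultimately have "(\<Sum>\<sigma>\<in>X. ?a \<sigma> * ?\<phi> \<sigma>) = 1"
      using fin cX by simp
    \<comment> \<open>\<open>P\<close> preserves the degree, since \<open>J\<close> and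
      \<open>H\<close> shift it in opposite directions.\<close>
    moreover have "deg \<sigma> = deg c" if s: "\<sigma> \<in> X" "P \<sigma> c \<noteq> 0" for \<sigma>
    proof (rule ccontr)
      assume ne: "deg \<sigma> \<noteq> deg c"
      have "J \<sigma> \<rho> * H \<rho> c + H \<sigma> \<rho> * J \<rho> c = 0" if r: "\<rho> \<in> X" for \<rho>
      proof -
        have "J \<sigma> \<rho> * H \<rho> c = 0"
          using J_deg[OF s(1) r] H_deg[of \<rho> c] ne by force
        moreover have "H \<sigma> \<rho> * J \<rho> c = 0"
          using J_deg[OF r cX] H_deg[of \<sigma> \<rho>] ne by force
        ultimately show ?thesis by simp
      qed
      then have "P \<sigma> c = 0" using ne by (auto simp: P_def)
      then show False using s by simp
    qed
    ultimately show ?thesis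
      using contr True by (intro exI[of _ H] exI[of _ ?a] exI[of _ ?\<phi>]) auto
  qed
qed

section \<open>Incidence numbers\<close>

text \<open>Faces of the simplex spanned by \<open>V\<close> correspond to subsets of
  \<open>V\<close>, which turns the geometry into combinatorics of finite sets.\<close>

locale simplex_vertices =
  fixes V :: "'a::euclidean_space set"
  assumes independent: "\<not> affine_dependent V"
begin

lemma finite_V: "finite V"
  using independent by (rule aff_independent_finite)

lemma finite_subset_V: "c \<subseteq> V \<Longrightarrow> finite c"
  using finite_V by (rule finite_subset[rotated])

text \<open>A vertex of \<open>c\<close> outside \<open>c'\<close> but in its hull would lie in the
  affine hull of the other vertices, against independence.\<close>

lemma hull_subset_iff:
  assumes "c \<subseteq> V" "c' \<subseteq> V"
  shows "convex hull c \<subseteq> convex hull c' \<longleftrightarrow> c \<subseteq> c'"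
proof
  assume sub: "convex hull c \<subseteq> convex hull c'"
  show "c \<subseteq> c'"
  proof
    fix v assume "v \<in> c"
    then have "v \<in> convex hull c'" using sub hull_inc[of v c convex] by blast
    moreover have "v \<notin> convex hull c'" if "v \<notin> c'"
    proof -
      have "c' \<subseteq> V - {v}" using that assms by blast
      then have "convex hull c' \<subseteq> affine hull (V - {v})"
        using order_trans[OF convex_hull_subset_affine_hull, of c'] hull_mono[of c' "V - {v}" affine]
        by blast
      moreover have "v \<notin> affine hull (V - {v})"
        using independent \<open>v \<in> c\<close> assms(1) by (auto simp: affine_dependent_def)
      ultimately show ?thesis by (rule contra_subsetD)
    qed
    ultimately show "v \<in> c'" by blast
  qed
qed (rule hull_mono)

lemma hull_eq_iff:
  assumes "c \<subseteq> V" "c' \<subseteq> V"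
  shows "convex hull c = convex hull c' \<longleftrightarrow> c = c'"
  using hull_subset_iff[OF assms] hull_subset_iff[OF assms(2,1)] by blast

lemma independent_subset: "c \<subseteq> V \<Longrightarrow> \<not> affine_dependent c"
  using independent affine_independent_subset by blast

lemma aff_dim_hull:
  assumes "c \<subseteq> V"
  shows "aff_dim (convex hull c) = int (card c) - 1"
  using aff_dim_affine_independent[OF independent_subset[OF assms]] by (simp add: aff_dim_convex_hull)

lemma face_of_hull_iff:
  assumes "c \<subseteq> V"
  shows "\<tau> face_of convex hull c \<longleftrightarrow> (\<exists>c'. c' \<subseteq> c \<and> \<tau> = convex hull c')"
  using face_of_convex_hull_affine_independent[OF independent_subset[OF assms]] .

text \<open>For a single vertex this includes the empty face, in agreement with
  \<open>codim1_faces\<close>; incidence numbers need the extra condition that the face is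
  nonempty.\<close>

lemma codim1_face_iff:
  assumes "c \<subseteq> V"
  shows "\<tau> face_of convex hull c \<and> aff_dim \<tau> = aff_dim (convex hull c) - 1 \<longleftrightarrow>
    (\<exists>v\<in>c. \<tau> = convex hull (c - {v}))"
proof
  assume "\<tau> face_of convex hull c \<and> aff_dim \<tau> = aff_dim (convex hull c) - 1"
  then obtain c' where c': "c' \<subseteq> c" "\<tau> = convex hull c'"
    and "aff_dim \<tau> = aff_dim (convex hull c) - 1"
    using face_of_hull_iff[OF assms] by blast
  then have card: "card c = card c' + 1"
    using aff_dim_hull[OF assms] aff_dim_hull[of c'] assms by auto
  have "card (c - c') = 1"
    using card_Diff_subset[of c' c] c' card finite_subset_V assms
    by (metis add_diff_cancel_left' finite_subset)
  then obtain v where "c - c' = {v}" by (auto simp: card_1_singleton_iff)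
  then have "v \<in> c" "c' = c - {v}" using c' by auto
  then show "\<exists>v\<in>c. \<tau> = convex hull (c - {v})" using c' by blast
next
  assume "\<exists>v\<in>c. \<tau> = convex hull (c - {v})"
  then obtain v where v: "v \<in> c" "\<tau> = convex hull (c - {v})" by blast
  have "card c = card (c - {v}) + 1"
    using v(1) finite_subset_V[OF assms] by (metis Suc_eq_plus1 card.remove)
  moreover have "c - {v} \<subseteq> V" using assms by blast
  ultimately show "\<tau> face_of convex hull c \<and> aff_dim \<tau> = aff_dim (convex hull c) - 1"
    using v face_of_hull_iff[OF assms] aff_dim_hull[OF assms] aff_dim_hull[of "c - {v}"] by auto
qed

lemma incidence_hull:
  assumes "c \<subseteq> V" "v \<in> c" "c - {v} \<noteq> {}"
  shows "incidence ord (convex hull c) (convex hull (c - {v})) = (- 1) ^ card {w \<in> c. ord w < ord v}"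
proof -
  have ext: "x extreme_point_of convex hull c \<longleftrightarrow> x \<in> c" for x
    using extreme_point_of_convex_hull_affine_independent[OF independent_subset[OF assms(1)]] .
  have "convex hull (c - {v}) facet_of convex hull c"
    using codim1_face_iff[OF assms(1), of "convex hull (c - {v})"] assms
    by (auto simp: facet_of_def)
  moreover have "(THE x. x extreme_point_of convex hull c \<and> x \<notin> convex hull (c - {v})) = v"
  proof (rule the_equality)
    have "v \<notin> convex hull (c - {v})"
      using hull_subset_iff[of "{v}" "c - {v}"] assms by auto
    then show "v extreme_point_of convex hull c \<and> v \<notin> convex hull (c - {v})" using ext assms by simp
  next
    fix x assume "x extreme_point_of convex hull c \<and> x \<notin> convex hull (c - {v})"
    then show "x = v" using ext hull_inc[of x "c - {v}" convex] by blast
  qed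
  ultimately show ?thesis by (simp add: incidence_def ext)
qed

lemma incidence_nonzero:
  assumes "c \<subseteq> V" "incidence ord (convex hull c) \<tau> \<noteq> 0"
  obtains v where "v \<in> c" "c - {v} \<noteq> {}" "\<tau> = convex hull (c - {v})"
proof -
  have "\<tau> facet_of convex hull c" using assms(2) by (auto simp: incidence_def split: if_splits)
  then have "\<tau> \<noteq> {}" "\<tau> face_of convex hull c \<and> aff_dim \<tau> = aff_dim (convex hull c) - 1"
    by (auto simp: facet_of_def)
  moreover from this obtain v where "v \<in> c" "\<tau> = convex hull (c - {v})"
    using codim1_face_iff[OF assms(1), of \<tau>] by blast
  ultimately show thesis by (intro that[of v]) auto
qed

end

lemma incidence_aff_dim: "incidence ord \<sigma> \<tau> \<noteq> 0 \<Longrightarrow> aff_dim \<tau> = aff_dim \<sigma> - 1"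
  by (auto simp: incidence_def facet_of_def split: if_splits)

lemma incidence_face_of: "incidence ord \<sigma> \<tau> \<noteq> 0 \<Longrightarrow> \<tau> face_of \<sigma>"
  by (auto simp: incidence_def facet_of_def split: if_splits)

lemma minus_one_power_square: "(- 1) ^ k * (- 1) ^ k = (1 :: 'r::{comm_ring,monoid_mult})"
  by (induction k) (simp_all add: mult.left_commute)

lemma minus_one_power_Suc: "(- 1) ^ Suc k = - ((- 1) ^ k :: 'r::{comm_ring,monoid_mult})"
  by simp

text \<open>Deleting the earlier vertex \<open>v\<close> moves \<open>w\<close> forward by one
  position, while deleting \<open>w\<close> leaves the position of \<open>v\<close> unchanged; so
  the two products have opposite signs.\<close>

lemma (in simplex_vertices) incidence_swap:
  fixes ord :: "'a \<Rightarrow> nat"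
  assumes c: "c \<subseteq> V" and vw: "v \<in> c" "w \<in> c" "ord v < ord w" and ne: "c - {v} - {w} \<noteq> {}"
  shows "incidence ord (convex hull c) (convex hull (c - {v})) *
      incidence ord (convex hull (c - {v})) (convex hull (c - {v} - {w})) +
    incidence ord (convex hull c) (convex hull (c - {w})) *
      incidence ord (convex hull (c - {w})) (convex hull (c - {w} - {v})) =
    (0 :: 'r::{comm_ring,monoid_mult})"
proof -
  have "{x \<in> c. ord x < ord w} = insert v {x \<in> c - {v}. ord x < ord w}" using vw by auto
  then have 1: "card {x \<in> c. ord x < ord w} = Suc (card {x \<in> c - {v}. ord x < ord w})"
    using finite_subset_V[OF c] by simp
  have 2: "{x \<in> c. x \<noteq> w \<and> ord x < ord v} = {x \<in> c. ord x < ord v}" using vw by auto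
  have "c - {v} \<subseteq> V" "c - {w} \<subseteq> V" "w \<in> c - {v}" "v \<in> c - {w}" "c - {v} \<noteq> {}" "c - {w} \<noteq> {}"
    "c - {w} - {v} \<noteq> {}"
    using c vw ne by auto
  then show ?thesis
    using vw ne c by (simp add: incidence_hull 1 2 minus_one_power_Suc mult.commute del: power_Suc)
qed

text \<open>A nonzero term exhibits \<open>\<tau>\<close> as \<open>\<sigma>\<close> with two
  vertices removed. There are then exactly two intermediate faces, and their terms cancel by
  \<open>incidence_swap\<close>.\<close>

lemma sum_incidence_incidence:
  fixes K L :: "'a::euclidean_space set set" and ord :: "'a \<Rightarrow> nat"
  assumes K: "simplicial_complex K" and L: "simplicial_complex L"
    and ord: "inj_on ord {v. {v} \<in> K}"
    and \<sigma>: "\<sigma> \<in> rel_simplices K L" and \<tau>: "\<tau> \<in> rel_simplices K L"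
  shows "(\<Sum>\<rho>\<in>rel_simplices K L. incidence ord \<sigma> \<rho> * incidence ord \<rho> \<tau>) =
    (0 :: 'r::{comm_ring,monoid_mult})"
proof (rule ccontr)
  let ?I = "incidence ord :: 'a set \<Rightarrow> 'a set \<Rightarrow> 'r"
  let ?S = "rel_simplices K L"
  assume nz: "(\<Sum>\<rho>\<in>?S. ?I \<sigma> \<rho> * ?I \<rho> \<tau>) \<noteq> 0"
  have "\<sigma> \<in> K" using \<sigma> by (simp add: rel_simplices_def)
  then obtain c where indep: "\<not> affine_dependent c" and \<sigma>c: "\<sigma> = convex hull c"
    using K unfolding simplicial_complex_def simplex_def by meson
  interpret simplex_vertices c by unfold_locales fact
  have sub: "c - {v} \<subseteq> c" for v by blast
  have nonzero: "\<exists>v w. v \<in> c \<and> w \<in> c - {v} \<and> c - {v} - {w} \<noteq> {} \<and> \<rho> = convex hull (c - {v}) \<and>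
      \<tau> = convex hull (c - {v} - {w})" if "?I \<sigma> \<rho> * ?I \<rho> \<tau> \<noteq> 0" for \<rho>
  proof -
    have 1: "?I \<sigma> \<rho> \<noteq> 0" "?I \<rho> \<tau> \<noteq> 0" using that mult_not_zero by blast+
    obtain v where v: "v \<in> c" "\<rho> = convex hull (c - {v})"
      using incidence_nonzero[OF subset_refl, of ord \<rho>] 1(1) unfolding \<sigma>c by blast
    obtain w where "w \<in> c - {v}" "c - {v} - {w} \<noteq> {}" "\<tau> = convex hull (c - {v} - {w})"
      using incidence_nonzero[OF sub, of ord v \<tau>] 1(2) unfolding v by blast
    then show ?thesis using v by blast
  qed
  obtain \<rho> where "\<rho> \<in> ?S" "?I \<sigma> \<rho> * ?I \<rho> \<tau> \<noteq> 0"
    using nz by (rule sum.not_neutral_contains_not_neutral)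
  from nonzero[OF this(2)] obtain v w where v: "v \<in> c" and w: "w \<in> c - {v}"
    and ne: "c - {v} - {w} \<noteq> {}" and \<tau>c: "\<tau> = convex hull (c - {v} - {w})" by blast
  have swap: "c - {w} - {v} = c - {v} - {w}" by blast
  \<comment> \<open>Both intermediate faces survive in the relative complex: one lying in
    \<open>L\<close> would force its face \<open>\<tau>\<close> into \<open>L\<close>.\<close>
  have face: "convex hull (c - {x}) \<in> ?S" if x: "x = v \<or> x = w" for x
  proof -
    have "convex hull (c - {x}) face_of \<sigma>" unfolding \<sigma>c face_of_hull_iff[OF subset_refl] by blast
    then have "convex hull (c - {x}) \<in> K" using K \<open>\<sigma> \<in> K\<close> unfolding simplicial_complex_def by blast
    moreover have "\<tau> face_of convex hull (c - {x})"
      unfolding face_of_hull_iff[OF sub] using \<tau>c x swap by blast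
    then have "convex hull (c - {x}) \<notin> L"
      using L \<tau> unfolding simplicial_complex_def rel_simplices_def by blast
    ultimately show ?thesis using ne x by (auto simp: rel_simplices_def)
  qed
  \<comment> \<open>Vertices of \<open>\<sigma>\<close> are vertices of \<open>K\<close>, where
    \<open>ord\<close> is injective.\<close>
  have "ord v \<noteq> ord w"
  proof -
    have "{x} \<in> K" if "x \<in> c" for x
    proof -
      have "{x} face_of \<sigma>" unfolding \<sigma>c face_of_hull_iff[OF subset_refl] using that
        by (intro exI[of _ "{x}"]) auto
      then show ?thesis using K \<open>\<sigma> \<in> K\<close> unfolding simplicial_complex_def by blast
    qed
    then show ?thesis using ord v w unfolding inj_on_def by blast
  qed
  have "convex hull (c - {v}) \<noteq> convex hull (c - {w})"
    using hull_eq_iff[OF sub sub] v w by blast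
  moreover have "(\<Sum>\<rho>\<in>?S. ?I \<sigma> \<rho> * ?I \<rho> \<tau>) =
      (\<Sum>\<rho>\<in>{convex hull (c - {v}), convex hull (c - {w})}. ?I \<sigma> \<rho> * ?I \<rho> \<tau>)"
  proof (rule sum.mono_neutral_right)
    show "finite ?S"
      using K finite_subset[of ?S K] unfolding simplicial_complex_def rel_simplices_def by blast
    show "{convex hull (c - {v}), convex hull (c - {w})} \<subseteq> ?S" using face by blast
    \<comment> \<open>The vertices of \<open>\<sigma>\<close> missing from \<open>\<tau>\<close> are
      \<open>v\<close> and \<open>w\<close>, so an intermediate face omits one of them.\<close>
    show "\<forall>\<rho>\<in>?S - {convex hull (c - {v}), convex hull (c - {w})}. ?I \<sigma> \<rho> * ?I \<rho> \<tau> = 0"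
    proof (rule ballI, rule ccontr)
      fix \<rho> assume \<rho>: "\<rho> \<in> ?S - {convex hull (c - {v}), convex hull (c - {w})}"
        and "?I \<sigma> \<rho> * ?I \<rho> \<tau> \<noteq> 0"
      from nonzero[OF this(2)] obtain v' w' where v': "v' \<in> c" "w' \<in> c - {v'}"
        "\<rho> = convex hull (c - {v'})" "\<tau> = convex hull (c - {v'} - {w'})" by blast
      have "c - {v'} - {w'} = c - {v} - {w}"
        using hull_eq_iff[of "c - {v'} - {w'}" "c - {v} - {w}"] v'(4) \<tau>c by auto
      then have "v' = v \<or> v' = w" using v'(1,2) v w by blast
      then show False using \<rho> v' by blast
    qed
  qed
  ultimately have "(\<Sum>\<rho>\<in>?S. ?I \<sigma> \<rho> * ?I \<rho> \<tau>) =
      ?I \<sigma> (convex hull (c - {v})) * ?I (convex hull (c - {v})) \<tau> +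
      ?I \<sigma> (convex hull (c - {w})) * ?I (convex hull (c - {w})) \<tau>" by simp
  also have "\<dots> = 0"
  proof (cases "ord v < ord w")
    case True
    then show ?thesis
      using incidence_swap[OF subset_refl v _ True ne, where 'r = 'r] w
      unfolding \<sigma>c \<tau>c swap by blast
  next
    case False
    then have "ord w < ord v" using \<open>ord v \<noteq> ord w\<close> by simp
    then show ?thesis
      using incidence_swap[OF subset_refl _ v \<open>ord w < ord v\<close>, where 'r = 'r] w ne
      unfolding \<sigma>c \<tau>c swap by (metis (no_types, lifting) DiffD1 add.commute swap)
  qed
  finally show False using nz by blast
qed

section \<open>Contractions of Morse tiles\<close>

text \<open>\<open>XX\<close> is closed under adding \<open>v\<close>, so every face without
  \<open>v\<close> has a partner. Unpaired faces contain \<open>v\<close> and leave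
  \<open>XX\<close> when \<open>v\<close> is removed; at most \<open>c0\<close> does so. Its
  remaining facets are then also outside \<open>XX\<close>, which makes it a cycle of the
  stratum.\<close>

lemma (in simplex_vertices) vertex_matching:
  fixes ord :: "'a \<Rightarrow> nat"
  assumes XX: "XX = {c. A \<subseteq> c \<and> c \<subseteq> V \<and> \<not> c \<subseteq> M}" and X: "X = (\<lambda>c. convex hull c) ` XX"
    and JJ: "\<And>\<sigma> \<tau>. \<sigma> \<in> X \<Longrightarrow> \<tau> \<in> X \<Longrightarrow>
      (\<Sum>\<rho>\<in>X. incidence ord \<sigma> \<rho> * incidence ord \<rho> \<tau>) = (0 :: 'r::{comm_ring,monoid_mult})"
    and v: "v \<in> V"
    and crit: "\<And>c. c \<in> XX \<Longrightarrow> v \<in> c \<Longrightarrow> c - {v} \<notin> XX \<Longrightarrow> c = c0" and c0V: "c0 \<subseteq> V"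
    and c0: "\<And>w. c0 \<in> XX \<Longrightarrow> v \<in> c0 \<Longrightarrow> c0 - {v} \<notin> XX \<Longrightarrow> w \<in> c0 \<Longrightarrow> c0 - {w} \<notin> XX"
  shows "\<exists>H a \<phi>. contraction 1 X aff_dim (incidence ord :: _ \<Rightarrow> _ \<Rightarrow> 'r) H a \<phi> \<and>
    (if c0 \<in> XX \<and> v \<in> c0 \<and> c0 - {v} \<notin> XX
     then (\<forall>\<sigma>\<in>X. (a \<sigma> \<noteq> 0 \<longrightarrow> aff_dim \<sigma> = int (card c0) - 1) \<and>
         (\<phi> \<sigma> \<noteq> 0 \<longrightarrow> aff_dim \<sigma> = int (card c0) - 1)) \<and> (\<Sum>\<sigma>\<in>X. a \<sigma> * \<phi> \<sigma>) = 1
     else \<forall>\<sigma>\<in>X. a \<sigma> = 0 \<and> \<phi> \<sigma> = 0)"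
proof -
  let ?h = "\<lambda>c. convex hull c :: 'a set"
  let ?I = "incidence ord :: 'a set \<Rightarrow> 'a set \<Rightarrow> 'r"
  define U where "U = ?h ` {c \<in> XX. v \<in> c}"
  \<comment> \<open>The pairing acts on simplices; the extreme points recover the vertex set to
    which \<open>v\<close> is added.\<close>
  define m where "m \<sigma> = ?h (insert v {x. x extreme_point_of \<sigma>})" for \<sigma>
  have XV: "c \<subseteq> V" if "c \<in> XX" for c using that XX by blast
  have heq: "?h c = ?h c' \<longleftrightarrow> c = c'" if "c \<in> XX" "c' \<in> XX" for c c'
    using hull_eq_iff XV that by blast
  have ins: "insert v c \<in> XX" if "c \<in> XX" for c using that v XX by blast
  have m: "m (?h c) = ?h (insert v c)" if "c \<in> XX" for c
    using extreme_point_of_convex_hull_affine_independent[OF independent_subset[OF XV[OF that]]]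
    by (simp add: m_def)
  have XU: "X - U = ?h ` {c \<in> XX. v \<notin> c}" unfolding X U_def using heq by blast
  have mU: "m ` (X - U) = ?h ` {c \<in> XX. v \<in> c \<and> c - {v} \<in> XX}"
  proof (intro equalityI subsetI)
    fix \<sigma> assume "\<sigma> \<in> m ` (X - U)"
    then obtain c where "c \<in> XX" "v \<notin> c" "\<sigma> = ?h (insert v c)" unfolding XU using m by auto
    then show "\<sigma> \<in> ?h ` {c \<in> XX. v \<in> c \<and> c - {v} \<in> XX}"
      by (intro image_eqI[of _ _ "insert v c"]) (simp_all add: ins)
  next
    fix \<sigma> assume "\<sigma> \<in> ?h ` {c \<in> XX. v \<in> c \<and> c - {v} \<in> XX}"
    then obtain c where "v \<in> c" "c - {v} \<in> XX" "\<sigma> = ?h c" by blast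
    then show "\<sigma> \<in> m ` (X - U)"
      unfolding XU image_image by (intro image_eqI[of _ _ "c - {v}"]) (simp_all add: m insert_absorb)
  qed
  have crit_eq: "U - m ` (X - U) = ?h ` {c \<in> XX. v \<in> c \<and> c - {v} \<notin> XX}"
  proof -
    have "inj_on ?h XX" using heq by (auto simp: inj_on_def)
    then have "?h ` ({c \<in> XX. v \<in> c} - {c \<in> XX. v \<in> c \<and> c - {v} \<in> XX}) = U - m ` (X - U)"
      unfolding mU by (subst U_def) (rule inj_on_image_set_diff; auto)
    moreover have "{c \<in> XX. v \<in> c} - {c \<in> XX. v \<in> c \<and> c - {v} \<in> XX} =
        {c \<in> XX. v \<in> c \<and> c - {v} \<notin> XX}" by blast
    ultimately show ?thesis by simp
  qed
  have c0_iff: "?h c0 \<in> U - m ` (X - U) \<longleftrightarrow> c0 \<in> XX \<and> v \<in> c0 \<and> c0 - {v} \<notin> XX"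
    unfolding crit_eq using hull_eq_iff[OF c0V XV] by auto
  have nz: "\<exists>w\<in>c. \<tau> = ?h (c - {w}) \<and> c - {w} \<in> XX" if c: "c \<in> XX" "\<tau> \<in> X" "?I (?h c) \<tau> \<noteq> 0" for c \<tau>
  proof -
    obtain w where w: "w \<in> c" "\<tau> = ?h (c - {w})"
      using incidence_nonzero[OF XV[OF c(1)] c(3)] by blast
    obtain c' where "c' \<in> XX" "\<tau> = ?h c'" using c(2) X by blast
    then have "c' = c - {w}" using hull_eq_iff[OF XV[of c'], of "c - {w}"] w XV[OF c(1)] by blast
    then show ?thesis using w \<open>c' \<in> XX\<close> by blast
  qed
  have "\<exists>H a \<phi>. contraction 1 X aff_dim ?I H a \<phi> \<and>
    (if ?h c0 \<in> U - m ` (X - U)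
     then (\<forall>\<sigma>\<in>X. (a \<sigma> \<noteq> 0 \<longrightarrow> aff_dim \<sigma> = aff_dim (?h c0)) \<and> (\<phi> \<sigma> \<noteq> 0 \<longrightarrow> aff_dim \<sigma> = aff_dim (?h c0))) \<and>
       (\<Sum>\<sigma>\<in>X. a \<sigma> * \<phi> \<sigma>) = 1
     else \<forall>\<sigma>\<in>X. a \<sigma> = 0 \<and> \<phi> \<sigma> = 0)"
  proof (rule matching_contraction[OF _ JJ])
    have "finite XX" using finite_V XX by (auto intro: finite_subset[of _ "Pow V"])
    then show "finite X" using X by simp
    show "\<And>\<sigma> \<tau>. ?I \<sigma> \<tau> \<noteq> 0 \<Longrightarrow> aff_dim \<tau> = aff_dim \<sigma> - 1" by (rule incidence_aff_dim)
    show "U \<subseteq> X" unfolding U_def X by blast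
    show "inj_on m (X - U)"
      unfolding XU
    proof (rule inj_onI)
      fix \<sigma> \<tau> assume "\<sigma> \<in> ?h ` {c \<in> XX. v \<notin> c}" "\<tau> \<in> ?h ` {c \<in> XX. v \<notin> c}" "m \<sigma> = m \<tau>"
      then obtain c c' where c: "c \<in> XX" "v \<notin> c" "\<sigma> = ?h c" "c' \<in> XX" "v \<notin> c'" "\<tau> = ?h c'" by blast
      then have "insert v c = insert v c'" using \<open>m \<sigma> = m \<tau>\<close> m heq ins by simp
      then show "\<sigma> = \<tau>" using c by (metis insert_ident)
    qed
    show "U - m ` (X - U) \<subseteq> {?h c0}" unfolding crit_eq using crit by blast
  next
    fix \<sigma> assume "\<sigma> \<in> X - U"
    then obtain c where c: "c \<in> XX" "v \<notin> c" "\<sigma> = ?h c" unfolding XU by blast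
    have ne: "insert v c - {v} = c" "c \<noteq> {}" using c XX by auto
    show "m \<sigma> \<in> U" using c ins m unfolding U_def by auto
    have "?I (?h (insert v c)) (?h (insert v c - {v})) = (- 1) ^ card {w \<in> insert v c. ord w < ord v}"
      using ne by (intro incidence_hull XV ins c) simp_all
    then show "?I (m \<sigma>) \<sigma> * ?I (m \<sigma>) \<sigma> = 1"
      using c ne by (simp only: m minus_one_power_square)
    show "aff_dim (m \<sigma>) = aff_dim \<sigma> + 1"
      using aff_dim_hull[OF XV[OF ins[OF c(1)]]] aff_dim_hull[OF XV[OF c(1)]] c finite_subset_V[OF XV]
      by (simp add: m)
    \<comment> \<open>From a face with \<open>v\<close> to a facet without \<open>v\<close>, the
      deleted vertex can only be \<open>v\<close>.\<close>
    fix \<rho> assume "\<rho> \<in> U" "?I \<rho> \<sigma> \<noteq> 0"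
    then obtain c' where c': "c' \<in> XX" "v \<in> c'" "\<rho> = ?h c'" unfolding U_def by blast
    then obtain w where "w \<in> c'" "\<sigma> = ?h (c' - {w})" "c' - {w} \<in> XX"
      using nz[OF c'(1), of \<sigma>] \<open>\<sigma> \<in> X - U\<close> \<open>?I \<rho> \<sigma> \<noteq> 0\<close> by blast
    then have "c = c' - {w}" using heq c by blast
    then have "c' = insert v c" using c c' \<open>w \<in> c'\<close> by blast
    then show "\<rho> = m \<sigma>" using c c' m by simp
  next
    fix \<tau> assume "?h c0 \<in> U - m ` (X - U)" "\<tau> \<in> X"
    then show "?I (?h c0) \<tau> = 0" using c0_iff c0 nz[of c0 \<tau>] by blast
  qed
  then show ?thesis unfolding c0_iff aff_dim_hull[OF c0V] .
qed

text \<open>The relation between \<open>A\<close> and \<open>M\<close> decides the choice of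
  \<open>v\<close> and whether a face stays unpaired. A critical tile may have an index other than
  \<open>k\<close>; therefore the negative case claims vanishing in degree \<open>k\<close>
  only.\<close>

lemma tile_contraction:
  fixes ord :: "'a::euclidean_space \<Rightarrow> nat"
  assumes data: "morse_tile_data \<Delta> n \<Phi> \<mu> T"
    and X: "X = {\<sigma>. \<sigma> face_of \<Delta> \<and> \<sigma> \<noteq> {} \<and> (\<forall>F\<in>\<Phi>. \<not> \<sigma> \<subseteq> F) \<and> \<not> \<sigma> \<subseteq> \<mu>}"
    and JJ: "\<And>\<sigma> \<tau>. \<sigma> \<in> X \<Longrightarrow> \<tau> \<in> X \<Longrightarrow>
      (\<Sum>\<rho>\<in>X. incidence ord \<sigma> \<rho> * incidence ord \<rho> \<tau>) = (0 :: 'r::{comm_ring,monoid_mult})"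
  shows "\<exists>H a \<phi>. contraction 1 X aff_dim (incidence ord :: _ \<Rightarrow> _ \<Rightarrow> 'r) H a \<phi> \<and>
    (if k = int (card \<Phi>) \<and> aff_dim \<mu> = k - 1 \<or> \<Phi> = codim1_faces \<Delta> \<and> k = int n
     then (\<forall>\<sigma>\<in>X. (a \<sigma> \<noteq> 0 \<longrightarrow> aff_dim \<sigma> = k) \<and> (\<phi> \<sigma> \<noteq> 0 \<longrightarrow> aff_dim \<sigma> = k)) \<and>
       (\<Sum>\<sigma>\<in>X. a \<sigma> * \<phi> \<sigma>) = 1
     else \<forall>\<sigma>\<in>X. aff_dim \<sigma> = k \<longrightarrow> a \<sigma> = 0 \<and> \<phi> \<sigma> = 0)"
    (is "?C (?crit1 \<or> ?crit2)")
proof -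
  let ?h = "\<lambda>c. convex hull c :: 'a set"
  obtain V where indep: "\<not> affine_dependent V" and cardV: "int (card V) = int n + 1" and \<Delta>: "\<Delta> = ?h V"
    using data unfolding morse_tile_data_def simplex_def by auto
  interpret simplex_vertices V by unfold_locales fact
  have sub: "V - {v} \<subseteq> V" for v by blast
  have codim1: "codim1_faces \<Delta> = (\<lambda>v. ?h (V - {v})) ` V"
    unfolding codim1_faces_def \<Delta> using codim1_face_iff[OF subset_refl] by auto
  have inj: "inj_on (\<lambda>v. ?h (V - {v})) V"
    using hull_eq_iff[OF sub sub] by (auto simp: inj_on_def)
  define A where "A = {v \<in> V. ?h (V - {v}) \<in> \<Phi>}"
  have AV: "A \<subseteq> V" unfolding A_def by blast
  have \<Phi>: "\<Phi> = (\<lambda>v. ?h (V - {v})) ` A"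
    using data unfolding morse_tile_data_def codim1 A_def by blast
  have card\<Phi>: "card \<Phi> = card A"
    unfolding \<Phi> using card_image inj inj_on_subset AV by blast
  have \<Phi>_full: "\<Phi> = codim1_faces \<Delta> \<longleftrightarrow> A = V"
    unfolding \<Phi> codim1 using inj_on_image_eq_iff[OF inj AV subset_refl] .
  obtain M where MV: "M \<subseteq> V" and \<mu>: "\<mu> = ?h M"
    and M: "M \<noteq> {} \<Longrightarrow> A \<subseteq> M \<and> int (card M) < int n"
  proof (cases "\<mu> = {}")
    case True
    then show ?thesis using that[of "{}"] by simp
  next
    case False
    then have "\<mu> face_of \<Delta>" and dim: "aff_dim \<mu> < int n - 1" and F: "\<forall>F\<in>\<Phi>. \<not> \<mu> \<subseteq> F"
      using data unfolding morse_tile_data_def by auto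
    then obtain M where M: "M \<subseteq> V" "\<mu> = ?h M"
      using face_of_hull_iff[OF subset_refl] \<Delta> by blast
    have "A \<subseteq> M"
    proof
      fix v assume "v \<in> A"
      then have "\<not> ?h M \<subseteq> ?h (V - {v})" using F M by (auto simp: A_def)
      then show "v \<in> M" using hull_subset_iff[OF M(1) sub] M by blast
    qed
    then show ?thesis using that[of M] M dim aff_dim_hull[OF M(1)] by simp
  qed
  define XX where "XX = {c. A \<subseteq> c \<and> c \<subseteq> V \<and> \<not> c \<subseteq> M}"
  have XX: "X = ?h ` XX"
  proof -
    have \<Phi>_iff: "(\<forall>F\<in>\<Phi>. \<not> ?h c \<subseteq> F) \<longleftrightarrow> A \<subseteq> c" if "c \<subseteq> V" for c
      unfolding \<Phi> using hull_subset_iff[OF that sub] that AV by blast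
    have \<mu>_iff: "?h c \<subseteq> \<mu> \<longleftrightarrow> c \<subseteq> M" if "c \<subseteq> V" for c
      unfolding \<mu> using hull_subset_iff[OF that MV] .
    have "\<sigma> \<in> X \<longleftrightarrow> \<sigma> \<in> ?h ` XX" for \<sigma>
    proof -
      have "\<sigma> \<in> X \<longleftrightarrow>
          (\<exists>c. c \<subseteq> V \<and> \<sigma> = ?h c \<and> ?h c \<noteq> {} \<and> (\<forall>F\<in>\<Phi>. \<not> ?h c \<subseteq> F) \<and> \<not> ?h c \<subseteq> \<mu>)"
        unfolding X \<Delta> face_of_hull_iff[OF subset_refl] by auto
      also have "\<dots> \<longleftrightarrow> (\<exists>c. c \<subseteq> V \<and> \<sigma> = ?h c \<and> A \<subseteq> c \<and> \<not> c \<subseteq> M)"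
      proof (rule ex_cong1)
        fix c
        have "?h c \<noteq> {} \<and> (\<forall>F\<in>\<Phi>. \<not> ?h c \<subseteq> F) \<and> \<not> ?h c \<subseteq> \<mu> \<longleftrightarrow> A \<subseteq> c \<and> \<not> c \<subseteq> M"
          if "c \<subseteq> V"
          unfolding \<Phi>_iff[OF that] \<mu>_iff[OF that] convex_hull_eq_empty by blast
        then show "c \<subseteq> V \<and> \<sigma> = ?h c \<and> ?h c \<noteq> {} \<and> (\<forall>F\<in>\<Phi>. \<not> ?h c \<subseteq> F) \<and> \<not> ?h c \<subseteq> \<mu> \<longleftrightarrow>
            c \<subseteq> V \<and> \<sigma> = ?h c \<and> A \<subseteq> c \<and> \<not> c \<subseteq> M" by metis
      qed
      finally show ?thesis by (auto simp: XX_def)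
    qed
    then show ?thesis by blast
  qed
  have finA: "finite A" and finM: "finite M" using AV MV finite_subset_V by auto
  have crit: "?crit1 \<or> ?crit2 \<longleftrightarrow> (k = int (card A) \<and> card M = card A) \<or> (A = V \<and> k = int n)"
    unfolding card\<Phi> \<Phi>_full \<mu> aff_dim_hull[OF MV] by auto
  have "V \<noteq> {}" using cardV by auto
  \<comment> \<open>A nonempty Morse face contains \<open>A\<close> but has codimension greater than
    one, so it cannot contain all of \<open>V\<close>.\<close>
  have "M = {}" if AV_eq: "A = V"
  proof (rule ccontr)
    assume "M \<noteq> {}"
    then have "M = V" "int (card M) < int n" using M AV_eq MV by auto
    then show False using cardV by simp
  qed
  then have cases: "A = V \<and> M = {} \<or> A \<noteq> V \<and> M = A \<or> A \<noteq> V \<and> M \<noteq> A \<and> M \<noteq> {} \<or>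
      A \<noteq> V \<and> A \<noteq> {} \<and> M = {}"
    by blast
  have critical: ?thesis
    if v: "v \<in> V" and c0: "c0 \<in> XX" "v \<in> c0" "\<And>w. w \<in> c0 \<Longrightarrow> c0 - {w} \<notin> XX"
      and uniq: "\<And>c. c \<in> XX \<Longrightarrow> v \<in> c \<Longrightarrow> c - {v} \<notin> XX \<Longrightarrow> c = c0"
      and k: "?crit1 \<or> ?crit2 \<longleftrightarrow> k = int (card c0) - 1" for v c0
  proof -
    have "c0 \<subseteq> V" using c0 XX_def by blast
    have c0': "c0 \<in> XX \<and> v \<in> c0 \<and> c0 - {v} \<notin> XX" using c0 by blast
    obtain H a \<phi> where contr: "contraction 1 X aff_dim (incidence ord :: _ \<Rightarrow> _ \<Rightarrow> 'r) H a \<phi>"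
      and dim: "\<And>\<sigma>. \<sigma> \<in> X \<Longrightarrow> a \<sigma> \<noteq> 0 \<Longrightarrow> aff_dim \<sigma> = int (card c0) - 1"
        "\<And>\<sigma>. \<sigma> \<in> X \<Longrightarrow> \<phi> \<sigma> \<noteq> 0 \<Longrightarrow> aff_dim \<sigma> = int (card c0) - 1"
      and unit: "(\<Sum>\<sigma>\<in>X. a \<sigma> * \<phi> \<sigma>) = 1"
      using vertex_matching[OF XX_def XX JJ v uniq \<open>c0 \<subseteq> V\<close> c0(3)] unfolding if_P[OF c0'] by blast
    have "if k = int (card c0) - 1
       then (\<forall>\<sigma>\<in>X. (a \<sigma> \<noteq> 0 \<longrightarrow> aff_dim \<sigma> = k) \<and> (\<phi> \<sigma> \<noteq> 0 \<longrightarrow> aff_dim \<sigma> = k)) \<and>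
         (\<Sum>\<sigma>\<in>X. a \<sigma> * \<phi> \<sigma>) = 1
       else \<forall>\<sigma>\<in>X. aff_dim \<sigma> = k \<longrightarrow> a \<sigma> = 0 \<and> \<phi> \<sigma> = 0"
      using dim unit by auto
    then show ?thesis unfolding k using contr by blast
  qed
  have acyclic: ?thesis
    if v: "v \<in> V" and closed: "\<And>c. c \<in> XX \<Longrightarrow> c - {v} \<in> XX" and k: "\<not> (?crit1 \<or> ?crit2)" for v
  proof -
    \<comment> \<open>No face is unpaired, so \<open>V\<close> merely fills the place of
      \<open>c0\<close>.\<close>
    have V': "\<not> (V \<in> XX \<and> v \<in> V \<and> V - {v} \<notin> XX)" using closed by blast
    obtain H a \<phi> where "contraction 1 X aff_dim (incidence ord :: _ \<Rightarrow> _ \<Rightarrow> 'r) H a \<phi>"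
      "\<forall>\<sigma>\<in>X. a \<sigma> = 0 \<and> \<phi> \<sigma> = 0"
      using vertex_matching[OF XX_def XX JJ v, of V] closed unfolding if_not_P[OF V'] by blast
    then show ?thesis unfolding if_not_P[OF k] by blast
  qed
  consider "A = V" "M = {}" | "A \<noteq> V" "M = A" | "A \<noteq> V" "M \<noteq> A" "M \<noteq> {}" | "A \<noteq> V" "A \<noteq> {}" "M = {}"
    using cases by blast
  then show ?thesis
  proof cases
    \<comment> \<open>Open simplex: \<open>V\<close> is the only face, of dimension
      \<open>n\<close>.\<close>
    case 1
    obtain v where v: "v \<in> V" using \<open>V \<noteq> {}\<close> by blast
    have XX_V: "XX = {V}" unfolding XX_def using 1 \<open>V \<noteq> {}\<close> by auto
    have "?crit1 \<or> ?crit2 \<longleftrightarrow> k = int (card V) - 1" unfolding crit using 1 cardV by auto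
    then show ?thesis by (rule critical[of v V, rotated -1]) (use v XX_V in auto)
  next
    \<comment> \<open>Here order and index agree. The stratum consists of the proper supersets of
      \<open>A\<close>, and of those containing \<open>v\<close> only the smallest,
      \<open>insert v A\<close>, is unpaired; its dimension is \<open>card A\<close>. An empty
      \<open>A\<close> gives the closed simplex.\<close>
    case 2
    then obtain v where v: "v \<in> V" "v \<notin> A" using AV by blast
    have "?crit1 \<or> ?crit2 \<longleftrightarrow> k = int (card (insert v A)) - 1" unfolding crit using 2 v finA by auto
    then show ?thesis
    proof (rule critical[of v "insert v A", rotated -1])
      show "insert v A \<in> XX" using v 2 AV unfolding XX_def by blast
      show "c = insert v A" if "c \<in> XX" "v \<in> c" "c - {v} \<notin> XX" for c
        using that v 2 unfolding XX_def by blast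
      show "insert v A - {w} \<notin> XX" if "w \<in> insert v A" for w
        using that v 2 unfolding XX_def by blast
    qed (use v in auto)
  next
    \<comment> \<open>For \<open>v\<close> in \<open>M\<close> but not in \<open>A\<close>, removing
      \<open>v\<close> affects neither condition defining \<open>XX\<close>.\<close>
    case 3
    then obtain v where v: "v \<in> M" "v \<notin> A" using M by blast
    have "card A \<noteq> card M" using 3 M finM card_subset_eq by blast
    then have "\<not> (?crit1 \<or> ?crit2)" unfolding crit using 3 by auto
    moreover have "c - {v} \<in> XX" if "c \<in> XX" for c using that v unfolding XX_def by blast
    ultimately show ?thesis using acyclic[of v] v MV by blast
  next
    \<comment> \<open>Without a Morse face the second condition only demands a nonempty face, which
      \<open>A\<close> guarantees after \<open>v\<close> is removed.\<close>
    case 4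
    then obtain v where v: "v \<in> V" "v \<notin> A" using AV by blast
    have "\<not> (?crit1 \<or> ?crit2)" unfolding crit using 4 finA by auto
    moreover have "c - {v} \<in> XX" if "c \<in> XX" for c using that v 4 unfolding XX_def by blast
    ultimately show ?thesis using acyclic[of v] v by blast
  qed
qed

section \<open>The strata of a Morse shelling\<close>

text \<open>The intersection of the two simplices is a face of \<open>\<sigma>\<close> meeting its
  relative interior, hence all of \<open>\<sigma>\<close>.\<close>

lemma simplicial_complex_face_of:
  assumes K: "simplicial_complex K" and "\<sigma> \<in> K" "\<Delta> \<in> K" "x \<in> rel_interior \<sigma>" "x \<in> \<Delta>"
  shows "\<sigma> face_of \<Delta>"
proof -
  have "\<sigma> \<inter> \<Delta> face_of \<sigma>" and face: "\<Delta> \<inter> \<sigma> face_of \<Delta>"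
    using K assms(2,3) unfolding simplicial_complex_def by blast+
  moreover have "\<sigma> \<inter> \<Delta> \<inter> rel_interior \<sigma> \<noteq> {}"
    using assms(4,5) rel_interior_subset[of \<sigma>] by blast
  ultimately have "\<sigma> \<subseteq> \<sigma> \<inter> \<Delta>" by (intro subset_of_face_of[of "\<sigma> \<inter> \<Delta>" \<sigma>]) auto
  then have "\<Delta> \<inter> \<sigma> = \<sigma>" by blast
  then show ?thesis using face by simp
qed

lemma simplicial_complex_eqI:
  assumes "simplicial_complex K" "\<sigma> \<in> K" "\<sigma>' \<in> K" "x \<in> rel_interior \<sigma>" "x \<in> rel_interior \<sigma>'"
  shows "\<sigma> = \<sigma>'"
  using simplicial_complex_face_of[OF assms(1-4)] simplicial_complex_face_of[OF assms(1,3,2,5)]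
    assms(4,5) rel_interior_subset[of \<sigma>] rel_interior_subset[of \<sigma>'] face_of_imp_subset
  by (meson subset_antisym subsetD)

lemma simplicial_complex_convex:
  assumes "simplicial_complex K" "\<sigma> \<in> K"
  shows "convex \<sigma>"
  using assms convex_simplex unfolding simplicial_complex_def by blast

lemma morse_tile_data_cell:
  assumes "simplicial_complex K" "\<Delta> \<in> K" "morse_tile_data \<Delta> n \<Phi> \<mu> T" "\<sigma> \<in> K"
    and x: "x \<in> rel_interior \<sigma>" "x \<in> T"
  shows "\<sigma> face_of \<Delta>" "\<forall>F\<in>\<Phi>. \<not> \<sigma> \<subseteq> F" "\<not> \<sigma> \<subseteq> \<mu>"
proof -
  have T: "T = \<Delta> - (\<Union>\<Phi> \<union> \<mu>)" using assms(3) by (simp add: morse_tile_data_def)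
  have "x \<in> \<sigma>" using x rel_interior_subset by blast
  then show "\<forall>F\<in>\<Phi>. \<not> \<sigma> \<subseteq> F" "\<not> \<sigma> \<subseteq> \<mu>" using x T by blast+
  show "\<sigma> face_of \<Delta>"
    using simplicial_complex_face_of[OF assms(1,4,2) x(1)] x(2) T by blast
qed

text \<open>A removed face meeting the relative interior of \<open>\<sigma>\<close> would contain
  \<open>\<sigma>\<close>. With \<open>morse_tile_data_cell\<close>, one common point already puts
  the open simplex inside the tile.\<close>

lemma rel_interior_subset_morse_tile:
  assumes "morse_tile_data \<Delta> n \<Phi> \<mu> T"
    and "\<sigma> face_of \<Delta>" "\<forall>F\<in>\<Phi>. \<not> \<sigma> \<subseteq> F" "\<not> \<sigma> \<subseteq> \<mu>"
  shows "rel_interior \<sigma> \<subseteq> T"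
proof
  fix x assume x: "x \<in> rel_interior \<sigma>"
  have "\<sigma> \<subseteq> \<Delta>" using assms(2) by (rule face_of_imp_subset)
  have *: "x \<notin> F" if F: "F face_of \<Delta>" "\<not> \<sigma> \<subseteq> F" for F
    using subset_of_face_of[OF F(1) \<open>\<sigma> \<subseteq> \<Delta>\<close>] x F(2) by blast
  have "x \<notin> F" if F: "F \<in> \<Phi>" for F
  proof (rule *)
    show "F face_of \<Delta>" using assms(1) F by (auto simp: morse_tile_data_def codim1_faces_def)
    show "\<not> \<sigma> \<subseteq> F" using assms(3) F by simp
  qed
  moreover have "x \<notin> \<mu>"
  proof (cases "\<mu> = {}")
    case False
    then have "\<mu> face_of \<Delta>" using assms(1) by (simp add: morse_tile_data_def)
    then show ?thesis using assms(4) by (rule *)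
  qed simp
  moreover have "x \<in> \<Delta>" using x \<open>\<sigma> \<subseteq> \<Delta>\<close> rel_interior_subset by blast
  ultimately show "x \<in> T" using assms(1) by (auto simp: morse_tile_data_def)
qed

locale shelled_complex =
  fixes K L :: "'a::euclidean_space set set" and \<T> :: "'a set set"
    and N :: nat and S :: "nat \<Rightarrow> 'a set" and ord :: "'a \<Rightarrow> nat"
  assumes K: "simplicial_complex K" and L: "simplicial_complex L"
    and ord: "inj_on ord {v. {v} \<in> K}" and shelling: "morse_shelling K L \<T> N S"
begin

abbreviation "cells \<equiv> rel_simplices K L"

lemma cell_in_K: "\<sigma> \<in> cells \<Longrightarrow> \<sigma> \<in> K"
  by (simp add: rel_simplices_def)

lemma finite_cells: "finite cells"
  using K finite_subset[of cells K] cell_in_K unfolding simplicial_complex_def by blast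

lemma rel_interior_cell_nonempty: "\<sigma> \<in> cells \<Longrightarrow> rel_interior \<sigma> \<noteq> {}"
  using simplicial_complex_convex[OF K] rel_interior_eq_empty[of \<sigma>] by (auto simp: rel_simplices_def)

lemma rel_interior_subset_rel_space: "\<sigma> \<in> cells \<Longrightarrow> rel_interior \<sigma> \<subseteq> rel_space K L"
  by (auto simp: rel_space_def)

lemma S_0: "S 0 = {}" and S_N: "S N = rel_space K L"
  and S_mono_Suc: "p < N \<Longrightarrow> S p \<subseteq> S (Suc p)" and S_tile: "p < N \<Longrightarrow> S (Suc p) - S p \<in> \<T>"
  and S_closedin: "p \<le> N \<Longrightarrow> closedin (top_of_set (rel_space K L)) (S p)"
  using shelling unfolding morse_shelling_def by blast+

lemma S_subset: "p \<le> N \<Longrightarrow> S p \<subseteq> rel_space K L"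
  using closedin_subset[OF S_closedin] by simp

lemma tile_data:
  assumes "i < N"
  obtains \<Delta> n \<Phi> \<mu> where "\<Delta> \<in> K" "morse_tile_data \<Delta> n \<Phi> \<mu> (S (Suc i) - S i)"
proof -
  have "\<forall>T\<in>\<T>. \<exists>n. morse_tile K n T"
    using shelling by (simp add: morse_shelling_def morse_tiling_def)
  then obtain n where "morse_tile K n (S (Suc i) - S i)" using S_tile[OF assms] by blast
  then show thesis using that unfolding morse_tile_def by blast
qed

text \<open>Induction along the shelling: each added tile is a union of open simplices.\<close>

lemma S_dichotomy:
  assumes \<sigma>: "\<sigma> \<in> cells" and "p \<le> N"
  shows "rel_interior \<sigma> \<subseteq> S p \<or> rel_interior \<sigma> \<inter> S p = {}"
  using assms(2)
proof (induction p)
  case (Suc i)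
  then have "i < N" by simp
  obtain \<Delta> n \<Phi> \<mu> where data: "\<Delta> \<in> K" "morse_tile_data \<Delta> n \<Phi> \<mu> (S (Suc i) - S i)"
    using tile_data[OF \<open>i < N\<close>] by blast
  have "rel_interior \<sigma> \<subseteq> S (Suc i) - S i" if x: "x \<in> rel_interior \<sigma>" "x \<in> S (Suc i) - S i" for x
    using rel_interior_subset_morse_tile[OF data(2)
        morse_tile_data_cell[OF K data cell_in_K[OF \<sigma>] x]] .
  then show ?case using Suc S_mono_Suc[OF \<open>i < N\<close>] by auto
qed (simp add: S_0)

definition step_cells :: "int \<Rightarrow> 'a set set" where
  "step_cells p = {\<sigma> \<in> cells. rel_interior \<sigma> \<subseteq> filtration_step N S p}"

lemma step_cells_iff: "\<sigma> \<in> step_cells p \<longleftrightarrow> \<sigma> \<in> cells \<and> rel_interior \<sigma> \<subseteq> filtration_step N S p"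
  by (simp add: step_cells_def)

lemma step_cells_nonpos: "p \<le> 0 \<Longrightarrow> step_cells p = {}"
  using rel_interior_cell_nonempty by (auto simp: step_cells_def filtration_step_def S_0)

lemma step_cells_ge: "int N \<le> p \<Longrightarrow> step_cells p = cells"
  using rel_interior_subset_rel_space by (auto simp: step_cells_def filtration_step_def S_N min_def)

lemma step_cells_nat: "i \<le> N \<Longrightarrow> step_cells (int i) = {\<sigma> \<in> cells. rel_interior \<sigma> \<subseteq> S i}"
  by (auto simp: step_cells_def filtration_step_def min_def)

lemma step_cells_mono: "step_cells (p - 1) \<subseteq> step_cells p"
proof -
  consider "p \<le> 0" | i where "p = int (Suc i)" "i < N" | "int N < p"
  proof (cases "p \<le> 0 \<or> int N < p")
    case False
    then have "p = int (Suc (nat (p - 1)))" "nat (p - 1) < N" by auto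
    then show ?thesis using that(2) by blast
  qed (use that in blast)
  then show ?thesis
  proof cases
    case 2
    then show ?thesis using S_mono_Suc[of i] step_cells_nat[of i] step_cells_nat[of "Suc i"] by auto
  qed (auto simp: step_cells_nonpos step_cells_ge)
qed

text \<open>Here closedness of \<open>S p\<close> in \<open>S\<close> is used: a closed set that
  contains an open simplex contains its closure, hence all its faces. This makes the filtration
  steps subcomplexes.\<close>

lemma step_cells_face:
  assumes "\<sigma> \<in> step_cells p" "\<tau> \<in> cells" "\<tau> face_of \<sigma>"
  shows "\<tau> \<in> step_cells p"
proof -
  let ?i = "min N (nat p)"
  have \<sigma>: "\<sigma> \<in> cells" "rel_interior \<sigma> \<subseteq> S ?i"
    using assms(1) by (auto simp: step_cells_def filtration_step_def)
  obtain Z where Z: "closed Z" "S ?i = rel_space K L \<inter> Z"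
    using S_closedin[of ?i] by (auto simp: closedin_closed)
  have "convex \<sigma>" using simplicial_complex_convex[OF K cell_in_K[OF \<sigma>(1)]] .
  then have "\<sigma> \<subseteq> closure (rel_interior \<sigma>)"
    using convex_closure_rel_interior closure_subset by blast
  also have "\<dots> \<subseteq> Z" using \<sigma>(2) Z by (intro closure_minimal) auto
  finally have "\<tau> \<subseteq> Z" using face_of_imp_subset[OF assms(3)] by blast
  then have "rel_interior \<tau> \<subseteq> S ?i"
    using rel_interior_subset[of \<tau>] rel_interior_subset_rel_space[OF assms(2)] Z by blast
  then show ?thesis using assms(2) by (simp add: step_cells_def filtration_step_def)
qed

text \<open>Connects the shelling to \<open>tile_contraction\<close>: the stratum depends only on
  the description of its tile.\<close>

lemma step_cells_stratum:
  assumes i: "i < N" and data: "\<Delta> \<in> K" "morse_tile_data \<Delta> n \<Phi> \<mu> (S (Suc i) - S i)"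
  shows "step_cells (int (Suc i)) - step_cells (int i) =
    {\<sigma>. \<sigma> face_of \<Delta> \<and> \<sigma> \<noteq> {} \<and> (\<forall>F\<in>\<Phi>. \<not> \<sigma> \<subseteq> F) \<and> \<not> \<sigma> \<subseteq> \<mu>}"
proof (intro Set.set_eqI iffI)
  fix \<sigma> assume "\<sigma> \<in> step_cells (int (Suc i)) - step_cells (int i)"
  then have \<sigma>: "\<sigma> \<in> cells" "rel_interior \<sigma> \<subseteq> S (Suc i)" "\<not> rel_interior \<sigma> \<subseteq> S i"
    using i step_cells_nat[of i] step_cells_nat[of "Suc i"] by auto
  then have "rel_interior \<sigma> \<inter> S i = {}" using S_dichotomy[of \<sigma> i] i by simp
  then obtain x where "x \<in> rel_interior \<sigma>" "x \<in> S (Suc i) - S i"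
    using rel_interior_cell_nonempty[OF \<sigma>(1)] \<sigma>(2) by blast
  from morse_tile_data_cell[OF K data cell_in_K[OF \<sigma>(1)] this]
  show "\<sigma> \<in> {\<sigma>. \<sigma> face_of \<Delta> \<and> \<sigma> \<noteq> {} \<and> (\<forall>F\<in>\<Phi>. \<not> \<sigma> \<subseteq> F) \<and> \<not> \<sigma> \<subseteq> \<mu>}"
    by auto
next
  fix \<sigma> assume "\<sigma> \<in> {\<sigma>. \<sigma> face_of \<Delta> \<and> \<sigma> \<noteq> {} \<and> (\<forall>F\<in>\<Phi>. \<not> \<sigma> \<subseteq> F) \<and> \<not> \<sigma> \<subseteq> \<mu>}"
  then have \<sigma>: "\<sigma> face_of \<Delta>" "\<sigma> \<noteq> {}" and sub: "rel_interior \<sigma> \<subseteq> S (Suc i) - S i"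
    using rel_interior_subset_morse_tile[OF data(2), of \<sigma>] by auto
  have \<sigma>K: "\<sigma> \<in> K" using K data(1) \<sigma>(1) unfolding simplicial_complex_def by blast
  obtain x where x: "x \<in> rel_interior \<sigma>"
    using simplicial_complex_convex[OF K \<sigma>K] rel_interior_eq_empty[of \<sigma>] \<sigma>(2) by auto
  \<comment> \<open>A face of \<open>\<Delta>\<close> could lie in \<open>L\<close>. But
    \<open>x\<close> belongs to some open simplex of the relative complex, and open simplices of
    \<open>K\<close> sharing a point coincide.\<close>
  then have "x \<in> rel_space K L" using sub S_subset[of "Suc i"] i by auto
  then obtain \<sigma>' where \<sigma>': "\<sigma>' \<in> cells" "x \<in> rel_interior \<sigma>'" by (auto simp: rel_space_def)
  then have "\<sigma> = \<sigma>'" using simplicial_complex_eqI[OF K \<sigma>K cell_in_K] x by blast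
  then show "\<sigma> \<in> step_cells (int (Suc i)) - step_cells (int i)"
    using i step_cells_nat[of i] step_cells_nat[of "Suc i"] sub x \<sigma>' by auto
qed

section \<open>Chains and cochains of the shelling as based filtrations\<close>

interpretation homology: based_filtration 1 cells aff_dim
  "incidence ord :: _ \<Rightarrow> _ \<Rightarrow> 'r::{comm_ring,monoid_mult}" step_cells 0 "int N"
proof
  show "finite cells" by (rule finite_cells)
  show "\<And>\<sigma> \<tau>. incidence ord \<sigma> \<tau> \<noteq> (0 :: 'r) \<Longrightarrow> aff_dim \<tau> = aff_dim \<sigma> - 1" by (rule incidence_aff_dim)
  show "\<And>\<sigma> \<tau>. \<sigma> \<in> cells \<Longrightarrow> \<tau> \<in> cells \<Longrightarrow>
      (\<Sum>\<rho>\<in>cells. incidence ord \<sigma> \<rho> * incidence ord \<rho> \<tau>) = (0 :: 'r)"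
    by (rule sum_incidence_incidence[OF K L ord])
  show "\<And>p. step_cells p \<subseteq> cells" by (auto simp: step_cells_def)
  show "\<And>p. step_cells (p - 1) \<subseteq> step_cells p" by (rule step_cells_mono)
  show "\<And>\<sigma> p \<tau>. \<sigma> \<in> step_cells p \<Longrightarrow> \<tau> \<in> cells \<Longrightarrow> incidence ord \<sigma> \<tau> \<noteq> (0 :: 'r) \<Longrightarrow> \<tau> \<in> step_cells p"
    using step_cells_face incidence_face_of by blast
qed (simp_all add: step_cells_nonpos step_cells_ge)

text \<open>Cochains vanishing on a step are supported on the complementary cells, which are closed
  under passing to cofaces. They are empty for \<open>p \<ge> N\<close> and all cells for
  \<open>p \<le> 0\<close>; in terms of \<open>- p\<close> these are the bounds \<open>- N\<close>
  and 0.\<close>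

interpretation cohomology: based_filtration "- 1" cells aff_dim
  "\<lambda>\<sigma> \<tau>. incidence ord \<tau> \<sigma> :: 'r::{comm_ring,monoid_mult}" "\<lambda>p. cells - step_cells p" "- int N" 0
proof
  show "finite cells" by (rule finite_cells)
  show "\<And>\<sigma> \<tau>. incidence ord \<tau> \<sigma> \<noteq> (0 :: 'r) \<Longrightarrow> aff_dim \<tau> = aff_dim \<sigma> - - 1"
    using incidence_aff_dim by fastforce
  show "(\<Sum>\<rho>\<in>cells. incidence ord \<rho> \<sigma> * incidence ord \<tau> \<rho>) = (0 :: 'r)"
    if "\<sigma> \<in> cells" "\<tau> \<in> cells" for \<sigma> \<tau>
  proof -
    have "(\<Sum>\<rho>\<in>cells. incidence ord \<tau> \<rho> * incidence ord \<rho> \<sigma>) = (0 :: 'r)"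
      by (rule sum_incidence_incidence[OF K L ord that(2,1)])
    then show ?thesis by (simp add: mult.commute)
  qed
  show "\<And>p. cells - step_cells (p - - 1) \<subseteq> cells - step_cells p"
    using step_cells_mono[of "_ + 1"] by auto
  show "\<And>\<sigma> p \<tau>. \<sigma> \<in> cells - step_cells p \<Longrightarrow> \<tau> \<in> cells \<Longrightarrow> incidence ord \<tau> \<sigma> \<noteq> (0 :: 'r) \<Longrightarrow>
      \<tau> \<in> cells - step_cells p"
    using step_cells_face incidence_face_of by blast
qed (simp_all add: step_cells_nonpos step_cells_ge)

text \<open>A position \<open>p\<close> carries at most one tile, so the basis is empty or a
  singleton. Outside the range from 1 to \<open>N\<close> the stratum is empty and the zero matrices
  serve. The same contraction is used for homology and, transposed, for cohomology.\<close>

lemma stratum_contraction: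
  fixes p k :: int
  defines "X \<equiv> step_cells p - step_cells (p - 1)" and "I \<equiv> critical_tiles_at K \<T> N S p k"
  obtains H a \<phi> where
    "contraction 1 X aff_dim (incidence ord :: _ \<Rightarrow> _ \<Rightarrow> 'r::{comm_ring,monoid_mult}) H a \<phi>"
    "I = {} \<and> (\<forall>\<sigma>\<in>X. aff_dim \<sigma> = k \<longrightarrow> a \<sigma> = 0 \<and> \<phi> \<sigma> = 0) \<or>
     (\<exists>T. I = {T}) \<and> (\<forall>\<sigma>\<in>X. (a \<sigma> \<noteq> 0 \<longrightarrow> aff_dim \<sigma> = k) \<and> (\<phi> \<sigma> \<noteq> 0 \<longrightarrow> aff_dim \<sigma> = k)) \<and>
       (\<Sum>\<sigma>\<in>X. a \<sigma> * \<phi> \<sigma>) = 1"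
proof (cases "0 < p \<and> p \<le> int N")
  case False
  then have "X = {}"
    using step_cells_nonpos[of p] step_cells_ge[of p] step_cells_ge[of "p - 1"] by (auto simp: X_def)
  moreover have "I = {}" using False by (auto simp: I_def critical_tiles_at_def)
  ultimately show ?thesis using that[of "\<lambda>_ _. 0" "\<lambda>_. 0" "\<lambda>_. 0"] by (simp add: contraction_def)
next
  case True
  then obtain i where p: "p = int (Suc i)" and i: "i < N"
    by (metis Suc_le_eq gr0_implies_Suc of_nat_0_less_iff of_nat_le_iff zero_less_imp_eq_int)
  define T where "T = S (Suc i) - S i"
  have X: "X = step_cells (int (Suc i)) - step_cells (int i)" by (simp add: X_def p)
  have I: "I = (if critical_tile K k T then {T} else {})"
    using S_tile[OF i] i by (auto simp: I_def critical_tiles_at_def p T_def)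
  have JJ: "(\<Sum>\<rho>\<in>X. incidence ord \<sigma> \<rho> * incidence ord \<rho> \<tau>) = (0 :: 'r)" if "\<sigma> \<in> X" "\<tau> \<in> X" for \<sigma> \<tau>
    using homology.J_J_stratum[of \<sigma> p \<tau>] that by (simp add: X_def)
  \<comment> \<open>Criticality is existential over descriptions of \<open>T\<close>. For a critical
    tile a witnessing description is taken; otherwise every description fails the condition.\<close>
  obtain \<Delta> n \<Phi> \<mu> where data: "\<Delta> \<in> K" "morse_tile_data \<Delta> n \<Phi> \<mu> T"
    and crit: "critical_tile K k T \<longleftrightarrow>
      (k = int (card \<Phi>) \<and> aff_dim \<mu> = k - 1 \<or> \<Phi> = codim1_faces \<Delta> \<and> k = int n)"
  proof (cases "critical_tile K k T")
    case True
    then show ?thesis using that unfolding critical_tile_def by blast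
  next
    case False
    obtain \<Delta> n \<Phi> \<mu> where data: "\<Delta> \<in> K" "morse_tile_data \<Delta> n \<Phi> \<mu> T"
      using tile_data[OF i] unfolding T_def by blast
    then show ?thesis using that[OF data] False unfolding critical_tile_def by blast
  qed
  have X_eq: "X = {\<sigma>. \<sigma> face_of \<Delta> \<and> \<sigma> \<noteq> {} \<and> (\<forall>F\<in>\<Phi>. \<not> \<sigma> \<subseteq> F) \<and> \<not> \<sigma> \<subseteq> \<mu>}"
    using step_cells_stratum[OF i] data unfolding X T_def by blast
  obtain H a \<phi> where contr: "contraction 1 X aff_dim (incidence ord :: _ \<Rightarrow> _ \<Rightarrow> 'r) H a \<phi>"
    and "if critical_tile K k T
     then (\<forall>\<sigma>\<in>X. (a \<sigma> \<noteq> 0 \<longrightarrow> aff_dim \<sigma> = k) \<and> (\<phi> \<sigma> \<noteq> 0 \<longrightarrow> aff_dim \<sigma> = k)) \<and>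
       (\<Sum>\<sigma>\<in>X. a \<sigma> * \<phi> \<sigma>) = 1
     else \<forall>\<sigma>\<in>X. aff_dim \<sigma> = k \<longrightarrow> a \<sigma> = 0 \<and> \<phi> \<sigma> = 0"
    using tile_contraction[OF data(2) X_eq JJ, where k = k] unfolding crit by blast
  then show ?thesis using that[OF contr] unfolding I by (cases "critical_tile K k T") auto
qed

section \<open>Identification with the given complexes, and their first pages\<close>

lemma chains_eq: "homology.chains = chain_module K L" "cohomology.chains = chain_module K L"
  by (simp_all add: fun_eq_iff homology.chains_def cohomology.chains_def chain_module_def)

lemma differential_eq:
  "homology.differential = (boundary ord K L :: _ \<Rightarrow> _ \<Rightarrow> 'r::{comm_ring,monoid_mult})"
  "cohomology.differential = (coboundary ord K L :: _ \<Rightarrow> _ \<Rightarrow> 'r)"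
  by (simp_all add: fun_eq_iff homology.differential_def cohomology.differential_def
      boundary_def coboundary_def)

lemma filtration_eq:
  "homology.filtration = (chain_filtration K L N S :: _ \<Rightarrow> _ \<Rightarrow> (_ \<Rightarrow> 'r::{comm_ring,monoid_mult}) set)"
  "cohomology.filtration = (cochain_filtration K L N S :: _ \<Rightarrow> _ \<Rightarrow> (_ \<Rightarrow> 'r) set)"
  by (auto simp: fun_eq_iff homology.filtration_def cohomology.filtration_def chains_eq
      chain_filtration_def cochain_filtration_def step_cells_iff)

lemma homology_page_1_free:
  "free_on (type_ring :: 'r::{comm_ring,monoid_mult} ring) (homology_page ord K L N S 1 p q)
    (critical_tiles_at K \<T> N S p (p + q))"
proof -
  have page: "homology_page ord K L N S 1 p q = (homology.page 1 p (p + q) :: ('r, _) module)"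
    unfolding homology_page_def chains_eq[symmetric] differential_eq[symmetric] filtration_eq[symmetric]
    by (rule homology.ss_page_eq)
  let ?X = "step_cells p - step_cells (p - 1)" and ?I = "critical_tiles_at K \<T> N S p (p + q)"
  obtain H a \<phi> where contr: "contraction 1 ?X aff_dim (incidence ord :: _ \<Rightarrow> _ \<Rightarrow> 'r) H a \<phi>"
    and *: "?I = {} \<and> (\<forall>\<sigma>\<in>?X. aff_dim \<sigma> = p + q \<longrightarrow> a \<sigma> = 0 \<and> \<phi> \<sigma> = 0) \<or>
     (\<exists>T. ?I = {T}) \<and>
      (\<forall>\<sigma>\<in>?X. (a \<sigma> \<noteq> 0 \<longrightarrow> aff_dim \<sigma> = p + q) \<and> (\<phi> \<sigma> \<noteq> 0 \<longrightarrow> aff_dim \<sigma> = p + q)) \<and>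
       (\<Sum>\<sigma>\<in>?X. a \<sigma> * \<phi> \<sigma>) = 1"
    by (rule stratum_contraction)
  from * show ?thesis
  proof (elim disjE conjE exE)
    assume I: "?I = {}" and "\<forall>\<sigma>\<in>?X. aff_dim \<sigma> = p + q \<longrightarrow> a \<sigma> = 0 \<and> \<phi> \<sigma> = 0"
    then show ?thesis
      unfolding page I by (intro homology.page_1_free_empty[OF refl contr]) blast
  next
    fix T assume I: "?I = {T}" and "(\<Sum>\<sigma>\<in>?X. a \<sigma> * \<phi> \<sigma>) = 1"
      and "\<forall>\<sigma>\<in>?X. (a \<sigma> \<noteq> 0 \<longrightarrow> aff_dim \<sigma> = p + q) \<and> (\<phi> \<sigma> \<noteq> 0 \<longrightarrow> aff_dim \<sigma> = p + q)"
    then show ?thesis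
      unfolding page I by (intro homology.page_1_free_singleton[OF refl contr]) (simp_all add: mult.commute)
  qed
qed

text \<open>The index is shifted because the quotient of the cochains vanishing on
  \<open>S p\<close> by those vanishing on \<open>S (p + 1)\<close> lives on the tile numbered
  \<open>p + 1\<close>. The transposed contraction has generator \<open>\<phi>\<close> and
  functional \<open>a\<close>.\<close>

lemma cohomology_page_1_free:
  "free_on (type_ring :: 'r::{comm_ring,monoid_mult} ring) (cohomology_page ord K L N S 1 p q)
    (critical_tiles_at K \<T> N S (p + 1) (p + q))"
proof -
  have page: "cohomology_page ord K L N S 1 p q = (cohomology.page 1 p (p + q) :: ('r, _) module)"
    unfolding cohomology_page_def chains_eq[symmetric] differential_eq[symmetric] filtration_eq[symmetric]
    by (rule cohomology.ss_page_eq)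
  let ?X = "step_cells (p + 1) - step_cells (p + 1 - 1)" and ?I = "critical_tiles_at K \<T> N S (p + 1) (p + q)"
  obtain H a \<phi> where contr: "contraction 1 ?X aff_dim (incidence ord :: _ \<Rightarrow> _ \<Rightarrow> 'r) H a \<phi>"
    and *: "?I = {} \<and> (\<forall>\<sigma>\<in>?X. aff_dim \<sigma> = p + q \<longrightarrow> a \<sigma> = 0 \<and> \<phi> \<sigma> = 0) \<or>
     (\<exists>T. ?I = {T}) \<and>
      (\<forall>\<sigma>\<in>?X. (a \<sigma> \<noteq> 0 \<longrightarrow> aff_dim \<sigma> = p + q) \<and> (\<phi> \<sigma> \<noteq> 0 \<longrightarrow> aff_dim \<sigma> = p + q)) \<and>
       (\<Sum>\<sigma>\<in>?X. a \<sigma> * \<phi> \<sigma>) = 1"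
    by (rule stratum_contraction)
  have X: "?X = (cells - step_cells p) - (cells - step_cells (p - - 1))"
    by (auto simp: step_cells_def)
  from * show ?thesis
  proof (elim disjE conjE exE)
    assume I: "?I = {}" and "\<forall>\<sigma>\<in>?X. aff_dim \<sigma> = p + q \<longrightarrow> a \<sigma> = 0 \<and> \<phi> \<sigma> = 0"
    then show ?thesis
      unfolding page I by (intro cohomology.page_1_free_empty[OF X contraction_transpose[OF contr]]) blast
  next
    fix T assume I: "?I = {T}" and "(\<Sum>\<sigma>\<in>?X. a \<sigma> * \<phi> \<sigma>) = 1"
      and "\<forall>\<sigma>\<in>?X. (a \<sigma> \<noteq> 0 \<longrightarrow> aff_dim \<sigma> = p + q) \<and> (\<phi> \<sigma> \<noteq> 0 \<longrightarrow> aff_dim \<sigma> = p + q)"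
    then show ?thesis
      unfolding page I by (intro cohomology.page_1_free_singleton[OF X contraction_transpose[OF contr]]) (simp_all add: mult.commute)
  qed
qed

lemmas homology_spectral_sequence = homology.is_spectral_sequence homology.spectral_sequence_converges
lemmas cohomology_spectral_sequence = cohomology.is_spectral_sequence cohomology.spectral_sequence_converges

end

theorem theorem1p2:
  fixes K L :: "'a::euclidean_space set set"
    and \<T> :: "'a set set"
    and N :: nat
    and S :: "nat \<Rightarrow> 'a set"
    and ord :: "'a \<Rightarrow> nat"
    and R :: "'r::{comm_ring,monoid_mult} ring"
  assumes "R = type_ring"
    and "simplicial_complex K" and "simplicial_complex L" and "L \<subseteq> K"
    and "inj_on ord {v. {v} \<in> K}"
    and "morse_shelling K L \<T> N S"
  shows
    "spectral_sequence R 1 (homology_page ord K L N S) (homology_diff ord K L N S) \<and>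
     ss_converges R 1 (homology_page ord K L N S)
       (rel_homology ord K L) (rel_homology_filtration ord K L N S) \<and>
     (\<forall>p q. free_on R (homology_page ord K L N S 1 p q)
       (critical_tiles_at K \<T> N S p (p + q))) \<and>
     spectral_sequence R (- 1) (cohomology_page ord K L N S) (cohomology_diff ord K L N S) \<and>
     ss_converges R (- 1) (cohomology_page ord K L N S)
       (rel_cohomology ord K L) (rel_cohomology_filtration ord K L N S) \<and>
     (\<forall>p q. free_on R (cohomology_page ord K L N S 1 p q)
       (critical_tiles_at K \<T> N S (p + 1) (p + q)))"
proof -
  interpret shelled_complex K L \<T> N S ord
    using assms by unfold_locales
  show ?thesis
    using homology_spectral_sequence[where 'r = 'r] cohomology_spectral_sequence[where 'r = 'r]
      homology_page_1_free[where 'r = 'r] cohomology_page_1_free[where 'r = 'r]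
    unfolding assms(1) homology_page_def homology_diff_def rel_homology_def rel_homology_filtration_def
      cohomology_page_def cohomology_diff_def rel_cohomology_def rel_cohomology_filtration_def
      chains_eq differential_eq filtration_eq by blast
qed

end
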